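(* Let $X$ be a finite biquandle, let $S_\ast:\ \emptyset=S_0\subseteq S_1\subseteq\cdots\subseteq S_m$ be a filtration of $\mathrm{End}(X)$, and let $N\ge1$. Then the persistence pair $\mathcal{PM}^{(N)}(L;X,S_\ast)=\big(\mathcal P^{(N)}(L;X,S_\ast),\mathcal M^{(N)}(L;X,S_\ast)\big)$ is an invariant of links; that is, if $L_1$ and $L_2$ are virtually equivalent oriented virtual link diagrams, then $\mathcal{PM}^{(N)}(L_1;X,S_\ast)=\mathcal{PM}^{(N)}(L_2;X,S_\ast)$.
   Context: **Links.** A virtual link diagram is an immersion of finitely many circles in the plane with finitely many transversal double points, each being either a classical crossing (with over/under information) or a virtual crossing (no over/under information). Diagrams are oriented. "Link" means oriented virtual link: an equivalence class of oriented virtual link diagrams under virtual equivalence, i.e. planar isotopy and the generalized Reidemeister moves: the classical Reidemeister moves R1, R2, R3 (on classical crossings), the virtual Reidemeister moves (the analogues of R1, R2, R3 with all crossings virtual), and the mixed move (an arc having two consecutive virtual crossings is moved across a classical crossing). A semi-arc is a segment of the diagram between two consecutive classical crossings (it may pass through virtual crossings; a component with no classical crossing is one semi-arc). **Biquandles.** A biquandle is a set $X$ with operations $\underline{\triangleright},\overline{\triangleright}:X\times X\to X$ such that for all $x,y,z\in X$: (1) $x\,\underline{\triangleright}\,x=x\,\overline{\triangleright}\,x$; (2) the maps $\alpha_y(x)=x\,\overline{\triangleright}\,y$, $\beta_y(x)=x\,\underline{\triangleright}\,y$ on $X$ and $S(x,y)=(y\,\overline{\triangleright}\,x,\;x\,\underline{\triangleright}\,y)$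 on $X\times X$ are invertible; (3) $(x\underline{\triangleright}y)\underline{\triangleright}(z\underline{\triangleright}y)=(x\underline{\triangleright}z)\underline{\triangleright}(y\overline{\triangleright}z)$, $(x\underline{\triangleright}y)\overline{\triangleright}(z\underline{\triangleright}y)=(x\overline{\triangleright}z)\underline{\triangleright}(y\overline{\triangleright}z)$, $(x\overline{\triangleright}y)\overline{\triangleright}(z\overline{\triangleright}y)=(x\overline{\triangleright}z)\overline{\triangleright}(y\underline{\triangleright}z)$. $\mathrm{End}(X)$ is the set of maps $X\to X$ preserving both operations. **Colorings.** An $X$-coloring of a diagram $L$ is a labeling $f$ of the semi-arcs of $L$ by elements of $X$ such that at each classical crossing: if $x$ is the label of the semi-arc of the under-strand lying to the right of the (oriented) over-strand, and $y$ is the label of the semi-arc of the over-strand lying to the right of the (oriented) under-strand, then the other semi-arc of the under-strand (to the left of the over-strand) is labeled $x\,\underline{\triangleright}\,y$ and the other semi-arc of the over-strand (to the left of the under-strand) is labeled $y\,\overline{\triangleright}\,x$. Labels do not change at virtual crossings. $\mathrm{Col}_X(L)$ is the set of $X$-colorings. For $\alpha\in\mathrm{End}(X)$ and $f\in\mathrm{Col}_X(L)$, $\alpha\circ f\in \mathrm{Col}_X(L)$. **Coloring quiver.** A quiver is a directed graph, possibly with loops and multiple edges; $e_{\mathcal Q}(u,v)$ is the number of edges from $u$ to $v$ in $\mathcal Q$. For $S\subseteq\mathrm{End}(X)$, the $X$-coloring quiver $\mathcal Q_X^S(L)$ has vertex set $\{v_f: f\in\mathrm{Col}_X(L)\}$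 and, for each $f$ and each $\alpha\in S$, one edge $v_f\to v_{\alpha\circ f}$; thus $e(v_f,v_g)=|\{\alpha\in S:\alpha\circ f=g\}|$. **$N$-directed clique homology.** For a finite quiver $\mathcal Q$ with vertex set $V$ and $N\ge1$, the $N$-directed clique complex $\mathcal K^{(N)}(\mathcal Q)$ is the abstract ordered simplicial complex (collection of finite lists of distinct vertices closed under taking sublists) with $K_0^{(N)}(\mathcal Q)=\{(v):v\in V\}$ and, for $n>0$, $K_n^{(N)}(\mathcal Q)=\{(v_0,\dots,v_n): v_i\ne v_j \text{ and } e_{\mathcal Q}(v_i,v_j)\ge N\text{ for all } i<j\}$. Its chain group $C_n$ is the free abelian group on $K_n^{(N)}(\mathcal Q)$, with $\partial_n(v_0,\dots,v_n)=\sum_{i=0}^n(-1)^i(v_0,\dots,\widehat{v_i},\dots,v_n)$ (and $\partial_0=0$), and $H_n^{(N)}(\mathcal Q)=\ker\partial_n/\operatorname{im}\partial_{n+1}$. Define $H_n^{(N)}(L;X,S):=H_n^{(N)}(\mathcal Q_X^S(L))$. **Persistence.** A filtration $S_\ast$ of $\mathrm{End}(X)$ is a nested sequence of subsets $S_0\subseteq\cdots\subseteq S_m$ of $\mathrm{End}(X)$; it is not required that $S_m=\mathrm{End}(X)$. Write $\mathcal K_j=\mathcal K^{(N)}(\mathcal Q_X^{S_j}(L))$, so $\mathcal K_0\subseteq\cdots\subseteq\mathcal K_m$. For $i\le j$, the persistent homology group $H_n^{(N),i,j}(L;X,S_\ast)$ is the image of the inclusion-induced map $H_n^{(N)}(L;X,S_i)\to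 H_n^{(N)}(L;X,S_j)$. **Barcode.** The barcode $\mathcal P^{(N)}(L;X,S_\ast)$ is the multiset (recorded for each dimension $n\ge0$) of persistence intervals $[i,j)$ determined by the persistent homology groups, where $i$ is the birth index and $j\in\{i+1,\dots,m\}\cup\{\infty\}$ the death index ($\infty$ if the class survives to the last stage). Explicitly, with $\beta_n^{i,j}=\operatorname{rank}H_n^{(N),i,j}(L;X,S_\ast)$ and $\beta_n^{-1,j}=0$, the multiplicity of $[i,j)$ in dimension $n$ is $\beta_n^{i,j-1}-\beta_n^{i,j}-\beta_n^{i-1,j-1}+\beta_n^{i-1,j}$ for $0\le i<j\le m$, and the multiplicity of $[i,\infty)$ is $\beta_n^{i,m}-\beta_n^{i-1,m}$. **Stillborn matrix.** A stillborn homology class of dimension $i$ at stage $j$ is a homology class that is born at stage $j$ but is already trivial at that stage, i.e. a new $i$-cycle appearing in $\mathcal K_j$ (not already in $\mathcal K_{j-1}$) that is already a boundary in $\mathcal K_j$. The stillborn matrix is $\mathcal M^{(N)}(L;X,S_\ast)=(a_{ij})$, indexed by dimensions $i\ge0$ and stages $0\le j\le m$, where $a_{ij}$ is the number of (independent) stillborn homology classes of dimension $i$ at stage $j$. Explicitly, with $Z_i(\mathcal K_j)=\ker\partial_i$ and $B_i(\mathcal K_j)=\operatorname{im}\partial_{i+1}$ in $C_i(\mathcal K_j)$, and $Z_i(\mathcal K_{-1})=0$, $$a_{ij}=\operatorname{rank}\Big(B_i(\mathcal K_j)\big/\big(B_i(\mathcal K_j)\cap Z_i(\mathcal K_{j-1})\big)\Big).$$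 *)

theory Defs
  imports
    "HOL-Analysis.Analysis"
    "HOL-Algebra.Free_Abelian_Groups"
    "HOL-Library.Multiset"
    "HOL-Library.Extended_Nat"
    "HOL-Combinatorics.Permutations"
    "Graph_Theory.Digraph"
begin

section \<open>Oriented virtual link diagrams\<close>

text \<open>
  The plane is the type of complex numbers. A diagram consists of \<open>ncomp\<close> circles, the \<open>i\<close>-th one
  being immersed by the 1-periodic curve \<open>curve D i\<close>, so that a point of the circle is a real
  number modulo 1 and the orientation is that of increasing parameter. The set \<open>over D i\<close> (also
  1-periodic) consists of the times at which component \<open>i\<close> is the over-strand of a classical
  crossing. A double point neither of whose two preimages is in \<open>over\<close> is a virtual crossing.
  Only the components \<open>i < ncomp D\<close> matter.
\<close>

record vdiagram =
  ncomp :: nat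
  curve :: "nat \<Rightarrow> real \<Rightarrow> complex"
  over :: "nat \<Rightarrow> real set"

definition velocity :: "vdiagram \<Rightarrow> nat \<Rightarrow> real \<Rightarrow> complex" where
  "velocity D i t = vector_derivative (curve D i) (at t)"

text \<open>The determinant of two plane vectors: positive iff \<open>v\<close> points to the left of \<open>u\<close>.\<close>

definition det2 :: "complex \<Rightarrow> complex \<Rightarrow> real" where
  "det2 u v = Re u * Im v - Im u * Re v"

text \<open>The points with parameters \<open>(i, s)\<close> and \<open>(j, t)\<close> are different but have the same image.\<close>

definition crosses :: "vdiagram \<Rightarrow> nat \<Rightarrow> real \<Rightarrow> nat \<Rightarrow> real \<Rightarrow> bool" where
  "crosses D i s j t \<longleftrightarrow>
     i < ncomp D \<and> j < ncomp D \<and> curve D i s = curve D j t \<and> \<not> (i = j \<and> s - t \<in> \<int>)"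

text \<open>
  Immersions are of class \<open>C\<^sup>1\<close>. The last condition says that a time in \<open>over\<close> belongs to a double
  point and that at most one preimage of a double point is in \<open>over\<close>.
\<close>

definition link_diagram :: "vdiagram \<Rightarrow> bool" where
  "link_diagram D \<longleftrightarrow>
     (\<forall>i<ncomp D.
        (\<forall>t. curve D i (t + 1) = curve D i t) \<and>
        (\<forall>t. curve D i differentiable (at t) \<and> velocity D i t \<noteq> 0) \<and>
        continuous_on UNIV (velocity D i)) \<and>
     finite {curve D i s | i s j t. crosses D i s j t} \<and>
     (\<forall>i s j t k u. crosses D i s j t \<and> crosses D i s k u \<longrightarrow> j = k \<and> t - u \<in> \<int>) \<and>
     (\<forall>i s j t. crosses D i s j t \<longrightarrow> det2 (velocity D i s) (velocity D j t) \<noteq> 0) \<and>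
     (\<forall>i<ncomp D. \<forall>t. t + 1 \<in> over D i \<longleftrightarrow> t \<in> over D i) \<and>
     (\<forall>i<ncomp D. \<forall>s. s \<in> over D i \<longrightarrow> (\<exists>j t. crosses D i s j t \<and> t \<notin> over D j))"

section \<open>Virtual equivalence\<close>

text \<open>A diagram does not depend on the numbering of its circles or on how these are parametrised.\<close>

definition reparametrized :: "vdiagram \<Rightarrow> vdiagram \<Rightarrow> bool" where
  "reparametrized D D' \<longleftrightarrow>
     ncomp D' = ncomp D \<and>
     (\<exists>\<pi> h h'. \<pi> permutes {..<ncomp D} \<and>
        (\<forall>i<ncomp D.
           (\<forall>t. (h i has_real_derivative h' i t) (at t) \<and> h' i t > 0 \<and> h i (t + 1) = h i t + 1) \<and>
           continuous_on UNIV (h' i) \<and>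
           (\<forall>t. curve D' i t = curve D (\<pi> i) (h i t)) \<and>
           over D' i = {t. h i t \<in> over D (\<pi> i)}))"

definition plane_isotopy :: "(real \<Rightarrow> complex \<Rightarrow> complex) \<Rightarrow> bool" where
  "plane_isotopy H \<longleftrightarrow>
     H 0 = id \<and>
     continuous_on ({0..1} \<times> UNIV) (\<lambda>(s, z). H s z) \<and>
     (\<exists>H'. (\<forall>s\<in>{0..1}. bij (H s) \<and> (\<forall>z. (H s has_derivative H' s z) (at z) \<and> bij (H' s z))) \<and>
           (\<forall>w. continuous_on ({0..1} \<times> UNIV) (\<lambda>(s, z). H' s z w)))"

definition planar_isotopic :: "vdiagram \<Rightarrow> vdiagram \<Rightarrow> bool" where
  "planar_isotopic D D' \<longleftrightarrow>
     ncomp D' = ncomp D \<and>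
     (\<exists>H. plane_isotopy H \<and>
        (\<forall>i<ncomp D. (\<forall>t. curve D' i t = H 1 (curve D i t)) \<and> over D' i = over D i))"

text \<open>
  A Reidemeister move exchanges two tangles inside a disc. The disc is the image of the square
  \<open>[-1,1]\<^sup>2\<close> under a \<open>C\<^sup>1\<close>-diffeomorphism of the plane, and the two tangles are the images of explicit
  model tangles in the square. Each model strand is parametrised by \<open>[-1,1]\<close>. Corresponding strands
  of the two models have the same endpoints and the same velocities there, so that the outer part
  of the diagram, which is left untouched, fits both of them. Orientation reversing diffeomorphisms
  are allowed: they provide the mirror images of the models (with over and under unchanged).
\<close>

definition C1_diffeo :: "(complex \<Rightarrow> complex) \<Rightarrow> bool" where
  "C1_diffeo \<phi> \<longleftrightarrow>
     bij \<phi> \<and>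
     (\<exists>\<phi>'. (\<forall>z. (\<phi> has_derivative \<phi>' z) (at z) \<and> bij (\<phi>' z)) \<and>
           (\<forall>w. continuous_on UNIV (\<lambda>z. \<phi>' z w)))"

definition square :: "complex set" where
  "square = cbox (Complex (-1) (-1)) (Complex 1 1)"

type_synonym tangle = "(real \<Rightarrow> complex) list"

text \<open>\<open>W (k, u) (l, v)\<close> says that, if strand \<open>k\<close> at time \<open>u\<close> crosses strand \<open>l\<close> at time \<open>v\<close>,
  then the crossing is classical and strand \<open>k\<close> is the over-strand.\<close>

type_synonym over_rule = "nat \<times> real \<Rightarrow> nat \<times> real \<Rightarrow> bool"

text \<open>A placement \<open>(c, a, b)\<close> puts a model strand on the parameter interval \<open>[a, b]\<close> of component \<open>c\<close>.\<close>

type_synonym placement = "nat \<times> real \<times> real"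

fun strand_comp :: "placement \<Rightarrow> nat" where
  "strand_comp (c, a, b) = c"

fun strand_time :: "placement \<Rightarrow> real \<Rightarrow> real" where
  "strand_time (c, a, b) u = (a + b) / 2 + u * (b - a) / 2"

definition on_strands :: "placement list \<Rightarrow> nat \<Rightarrow> real \<Rightarrow> bool" where
  "on_strands P i t \<longleftrightarrow> (\<exists>(c, a, b)\<in>set P. i = c \<and> frac t \<in> {a..b})"

definition shows_tangle ::
  "(complex \<Rightarrow> complex) \<Rightarrow> placement list \<Rightarrow> over_rule \<Rightarrow> tangle \<Rightarrow> vdiagram \<Rightarrow> bool" where
  "shows_tangle \<phi> P W T D \<longleftrightarrow>
     length P = length T \<and>
     (\<forall>(c, a, b)\<in>set P. c < ncomp D \<and> 0 < a \<and> a < b \<and> b < 1) \<and>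
     (\<forall>i<ncomp D. \<forall>t. curve D i t \<in> \<phi> ` square \<longleftrightarrow> on_strands P i t) \<and>
     (\<forall>k<length T. \<forall>u\<in>{-1..1}.
        curve D (strand_comp (P ! k)) (strand_time (P ! k) u) = \<phi> ((T ! k) u)) \<and>
     (\<forall>k<length T. \<forall>u\<in>{-1..1}.
        strand_time (P ! k) u \<in> over D (strand_comp (P ! k)) \<longleftrightarrow>
          (\<exists>l<length T. \<exists>v\<in>{-1..1}.
             (k, u) \<noteq> (l, v) \<and> (T ! k) u = (T ! l) v \<and> W (k, u) (l, v)))"

definition local_move :: "over_rule \<Rightarrow> tangle \<Rightarrow> tangle \<Rightarrow> vdiagram \<Rightarrow> vdiagram \<Rightarrow> bool" where
  "local_move W T T' D D' \<longleftrightarrow>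
     ncomp D' = ncomp D \<and>
     (\<exists>\<phi> P. C1_diffeo \<phi> \<and> shows_tangle \<phi> P W T D \<and> shows_tangle \<phi> P W T' D' \<and>
        (\<forall>i<ncomp D. \<forall>t. \<not> on_strands P i t \<longrightarrow>
           curve D' i t = curve D i t \<and> (t \<in> over D' i \<longleftrightarrow> t \<in> over D i)))"

definition bump :: "real \<Rightarrow> real" where
  "bump u = (1 - u\<^sup>2)\<^sup>2"

text \<open>
  First move: a straight strand and a strand with a kink. The only double point of the kink is
  attained at the times \<open>- 1 / sqrt 2\<close> and \<open>1 / sqrt 2\<close>.
\<close>

definition R1_flat :: tangle where
  "R1_flat = [\<lambda>u. Complex u 0]"

definition R1_kink :: tangle where
  "R1_kink = [\<lambda>u. Complex (u * (1 - 4 * bump u)) (bump u / 2)]"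

text \<open>
  Second move: strand 0 lies above strand 1 or has a finger dipping across it. The sign \<open>\<sigma>\<close> is the
  direction of strand 1.
\<close>

definition R2_apart :: "real \<Rightarrow> tangle" where
  "R2_apart \<sigma> = [\<lambda>u. Complex u (1 / 2), \<lambda>u. Complex (\<sigma> * u) 0]"

definition R2_crossed :: "real \<Rightarrow> tangle" where
  "R2_crossed \<sigma> = [\<lambda>u. Complex u (1 / 2 - bump u), \<lambda>u. Complex (\<sigma> * u) 0]"

text \<open>
  Third move: strands 1 and 2 are straight and cross at 0, and strand 0 passes above 0 for
  \<open>\<epsilon> = 1\<close> and below 0 for \<open>\<epsilon> = -1\<close>. The signs \<open>\<sigma>\<close> and \<open>\<tau>\<close> are the directions of strands 1 and 2.
\<close>

definition R3_tangle :: "real \<Rightarrow> real \<Rightarrow> real \<Rightarrow> tangle" where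
  "R3_tangle \<epsilon> \<sigma> \<tau> =
     [\<lambda>u. Complex u (\<epsilon> * bump u / 2),
      \<lambda>u. Complex (\<sigma> * u / 2) (\<sigma> * u),
      \<lambda>u. Complex (\<tau> * u / 2) (- \<tau> * u)]"

abbreviation virtual_rule :: over_rule where
  "virtual_rule \<equiv> \<lambda>_ _. False"

definition classical_R1 :: "vdiagram \<Rightarrow> vdiagram \<Rightarrow> bool" where
  "classical_R1 D D' \<longleftrightarrow>
     (\<exists>W \<in> {\<lambda>(k, u) (l, v). u < v, \<lambda>(k, u) (l, v). v < u}. local_move W R1_flat R1_kink D D')"

definition classical_R2 :: "vdiagram \<Rightarrow> vdiagram \<Rightarrow> bool" where
  "classical_R2 D D' \<longleftrightarrow>
     (\<exists>\<sigma>\<in>{1, -1}. \<exists>W \<in> {\<lambda>(k, u) (l, v). k < l, \<lambda>(k, u) (l, v). l < k}.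
        local_move W (R2_apart \<sigma>) (R2_crossed \<sigma>) D D')"

text \<open>The function \<open>h\<close> gives the heights of the three strands.\<close>

definition classical_R3 :: "vdiagram \<Rightarrow> vdiagram \<Rightarrow> bool" where
  "classical_R3 D D' \<longleftrightarrow>
     (\<exists>\<sigma>\<in>{1, -1}. \<exists>\<tau>\<in>{1, -1}. \<exists>h :: nat \<Rightarrow> nat. inj h \<and>
        local_move (\<lambda>(k, u) (l, v). h l < h k) (R3_tangle 1 \<sigma> \<tau>) (R3_tangle (-1) \<sigma> \<tau>) D D')"

definition virtual_R1 :: "vdiagram \<Rightarrow> vdiagram \<Rightarrow> bool" where
  "virtual_R1 D D' \<longleftrightarrow> local_move virtual_rule R1_flat R1_kink D D'"

definition virtual_R2 :: "vdiagram \<Rightarrow> vdiagram \<Rightarrow> bool" where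
  "virtual_R2 D D' \<longleftrightarrow>
     (\<exists>\<sigma>\<in>{1, -1}. local_move virtual_rule (R2_apart \<sigma>) (R2_crossed \<sigma>) D D')"

definition virtual_R3 :: "vdiagram \<Rightarrow> vdiagram \<Rightarrow> bool" where
  "virtual_R3 D D' \<longleftrightarrow>
     (\<exists>\<sigma>\<in>{1, -1}. \<exists>\<tau>\<in>{1, -1}.
        local_move virtual_rule (R3_tangle 1 \<sigma> \<tau>) (R3_tangle (-1) \<sigma> \<tau>) D D')"

definition mixed_move :: "vdiagram \<Rightarrow> vdiagram \<Rightarrow> bool" where
  "mixed_move D D' \<longleftrightarrow>
     (\<exists>\<sigma>\<in>{1, -1}. \<exists>\<tau>\<in>{1, -1}.
        \<exists>W \<in> {\<lambda>(k, u) (l, v). k = 1 \<and> l = 2, \<lambda>(k, u) (l, v). k = 2 \<and> l = 1}.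
        local_move W (R3_tangle 1 \<sigma> \<tau>) (R3_tangle (-1) \<sigma> \<tau>) D D')"

definition virtual_step :: "vdiagram \<Rightarrow> vdiagram \<Rightarrow> bool" where
  "virtual_step D D' \<longleftrightarrow>
     link_diagram D \<and> link_diagram D' \<and>
     (reparametrized D D' \<or> planar_isotopic D D' \<or>
      classical_R1 D D' \<or> classical_R2 D D' \<or> classical_R3 D D' \<or>
      virtual_R1 D D' \<or> virtual_R2 D D' \<or> virtual_R3 D D' \<or> mixed_move D D')"

definition virtually_equivalent :: "vdiagram \<Rightarrow> vdiagram \<Rightarrow> bool" where
  "virtually_equivalent = equivclp virtual_step"

section \<open>Biquandles\<close>

locale biquandle =
  fixes X :: "'a set"
    and under_op :: "'a \<Rightarrow> 'a \<Rightarrow> 'a" (infixl \<open>\<triangleright>\<^sub>u\<close> 70)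
    and over_op :: "'a \<Rightarrow> 'a \<Rightarrow> 'a" (infixl \<open>\<triangleright>\<^sub>o\<close> 70)
  assumes under_closed: "\<lbrakk>x \<in> X; y \<in> X\<rbrakk> \<Longrightarrow> x \<triangleright>\<^sub>u y \<in> X"
    and over_closed: "\<lbrakk>x \<in> X; y \<in> X\<rbrakk> \<Longrightarrow> x \<triangleright>\<^sub>o y \<in> X"
    and diagonal: "x \<in> X \<Longrightarrow> x \<triangleright>\<^sub>u x = x \<triangleright>\<^sub>o x"
    and over_bij: "y \<in> X \<Longrightarrow> bij_betw (\<lambda>x. x \<triangleright>\<^sub>o y) X X"
    and under_bij: "y \<in> X \<Longrightarrow> bij_betw (\<lambda>x. x \<triangleright>\<^sub>u y) X X"
    and sideways_bij: "bij_betw (\<lambda>(x, y). (y \<triangleright>\<^sub>o x, x \<triangleright>\<^sub>u y)) (X \<times> X) (X \<times> X)"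
    and exchange_uu: "\<lbrakk>x \<in> X; y \<in> X; z \<in> X\<rbrakk> \<Longrightarrow>
      (x \<triangleright>\<^sub>u y) \<triangleright>\<^sub>u (z \<triangleright>\<^sub>u y) = (x \<triangleright>\<^sub>u z) \<triangleright>\<^sub>u (y \<triangleright>\<^sub>o z)"
    and exchange_uo: "\<lbrakk>x \<in> X; y \<in> X; z \<in> X\<rbrakk> \<Longrightarrow>
      (x \<triangleright>\<^sub>u y) \<triangleright>\<^sub>o (z \<triangleright>\<^sub>u y) = (x \<triangleright>\<^sub>o z) \<triangleright>\<^sub>u (y \<triangleright>\<^sub>o z)"
    and exchange_oo: "\<lbrakk>x \<in> X; y \<in> X; z \<in> X\<rbrakk> \<Longrightarrow>
      (x \<triangleright>\<^sub>o y) \<triangleright>\<^sub>o (z \<triangleright>\<^sub>o y) = (x \<triangleright>\<^sub>o z) \<triangleright>\<^sub>o (y \<triangleright>\<^sub>u z)"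

text \<open>Maps out of \<open>X\<close> are extensional functions, so that different elements are different maps.\<close>

definition biquandle_End :: "'a set \<Rightarrow> ('a \<Rightarrow> 'a \<Rightarrow> 'a) \<Rightarrow> ('a \<Rightarrow> 'a \<Rightarrow> 'a) \<Rightarrow> ('a \<Rightarrow> 'a) set" where
  "biquandle_End X ut ot =
     {\<alpha> \<in> X \<rightarrow>\<^sub>E X. \<forall>x\<in>X. \<forall>y\<in>X. \<alpha> (ut x y) = ut (\<alpha> x) (\<alpha> y) \<and> \<alpha> (ot x y) = ot (\<alpha> x) (\<alpha> y)}"

section \<open>Colorings\<close>

definition classical_pass :: "vdiagram \<Rightarrow> nat \<Rightarrow> real \<Rightarrow> bool" where
  "classical_pass D i s \<longleftrightarrow> (\<exists>j t. crosses D i s j t \<and> (s \<in> over D i \<or> t \<in> over D j))"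

text \<open>
  The semi-arc through the point with parameter \<open>(i, s)\<close>, as the set of the parameters of its points:
  those that can be reached from \<open>s\<close> along the circle without meeting a classical crossing.
\<close>

definition semi_arc :: "vdiagram \<Rightarrow> nat \<Rightarrow> real \<Rightarrow> (nat \<times> real) set" where
  "semi_arc D i s =
     {(i, t) | t. \<exists>n::int. \<forall>u\<in>closed_segment s (t + of_int n). \<not> classical_pass D i u}"

definition semi_arcs :: "vdiagram \<Rightarrow> (nat \<times> real) set set" where
  "semi_arcs D = {semi_arc D i s | i s. i < ncomp D \<and> \<not> classical_pass D i s}"

definition arc_before :: "vdiagram \<Rightarrow> nat \<Rightarrow> real \<Rightarrow> (nat \<times> real) set" where
  "arc_before D i s = (THE a. a \<in> semi_arcs D \<and> (\<forall>\<^sub>F t in at_left s. (i, t) \<in> a))"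

definition arc_after :: "vdiagram \<Rightarrow> nat \<Rightarrow> real \<Rightarrow> (nat \<times> real) set" where
  "arc_after D i s = (THE a. a \<in> semi_arcs D \<and> (\<forall>\<^sub>F t in at_right s. (i, t) \<in> a))"

text \<open>
  The semi-arcs at a classical crossing through which component \<open>i\<close> passes at time \<open>s\<close>, lying to the
  right and to the left of the other strand, which has direction \<open>d\<close>.
\<close>

definition arc_right :: "vdiagram \<Rightarrow> complex \<Rightarrow> nat \<Rightarrow> real \<Rightarrow> (nat \<times> real) set" where
  "arc_right D d i s = (if det2 d (velocity D i s) > 0 then arc_before D i s else arc_after D i s)"

definition arc_left :: "vdiagram \<Rightarrow> complex \<Rightarrow> nat \<Rightarrow> real \<Rightarrow> (nat \<times> real) set" where
  "arc_left D d i s = (if det2 d (velocity D i s) > 0 then arc_after D i s else arc_before D i s)"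

definition colorings ::
  "'a set \<Rightarrow> ('a \<Rightarrow> 'a \<Rightarrow> 'a) \<Rightarrow> ('a \<Rightarrow> 'a \<Rightarrow> 'a) \<Rightarrow> vdiagram \<Rightarrow> ((nat \<times> real) set \<Rightarrow> 'a) set" where
  "colorings X ut ot D =
     {f \<in> semi_arcs D \<rightarrow>\<^sub>E X.
        \<forall>i s j t. crosses D i s j t \<and> s \<in> over D i \<longrightarrow>
          (let x = f (arc_right D (velocity D i s) j t);
               y = f (arc_right D (velocity D j t) i s)
           in f (arc_left D (velocity D i s) j t) = ut x y \<and>
              f (arc_left D (velocity D j t) i s) = ot y x)}"

section \<open>Quivers and directed clique homology\<close>

definition edge_count :: "('v, 'e) pre_digraph \<Rightarrow> 'v \<Rightarrow> 'v \<Rightarrow> nat" where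
  "edge_count Q u v = card {e \<in> arcs Q. tail Q e = u \<and> head Q e = v}"

definition coloring_quiver ::
  "'a set \<Rightarrow> ('a \<Rightarrow> 'a \<Rightarrow> 'a) \<Rightarrow> ('a \<Rightarrow> 'a \<Rightarrow> 'a) \<Rightarrow> ('a \<Rightarrow> 'a) set \<Rightarrow> vdiagram \<Rightarrow>
   ((nat \<times> real) set \<Rightarrow> 'a, ((nat \<times> real) set \<Rightarrow> 'a) \<times> ('a \<Rightarrow> 'a)) pre_digraph" where
  "coloring_quiver X ut ot S D =
     \<lparr>verts = colorings X ut ot D,
      arcs = colorings X ut ot D \<times> S,
      tail = fst,
      head = (\<lambda>(f, \<alpha>). compose (semi_arcs D) \<alpha> f)\<rparr>"

text \<open>Ordered simplicial complexes: \<open>K n\<close> is the set of \<open>n\<close>-simplices, which are lists of length \<open>n + 1\<close>.\<close>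

type_synonym 'v ordered_complex = "nat \<Rightarrow> 'v list set"

definition clique_complex :: "nat \<Rightarrow> ('v, 'e) pre_digraph \<Rightarrow> 'v ordered_complex" where
  "clique_complex N Q n =
     {vs. length vs = Suc n \<and> set vs \<subseteq> verts Q \<and>
          (\<forall>i j. i < j \<and> j < length vs \<longrightarrow> vs ! i \<noteq> vs ! j \<and> N \<le> edge_count Q (vs ! i) (vs ! j))}"

definition chain_group :: "'v ordered_complex \<Rightarrow> nat \<Rightarrow> ('v list \<Rightarrow>\<^sub>0 int) monoid" where
  "chain_group K n = free_Abelian_group (K n)"

definition boundary_map :: "nat \<Rightarrow> ('v list \<Rightarrow>\<^sub>0 int) \<Rightarrow> ('v list \<Rightarrow>\<^sub>0 int)" where
  "boundary_map n c =
     (if n = 0 then 0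
      else frag_extend
        (\<lambda>vs. \<Sum>i\<le>n. frag_cmul ((-1) ^ i) (frag_of (take i vs @ drop (Suc i) vs))) c)"

definition cycles :: "'v ordered_complex \<Rightarrow> nat \<Rightarrow> ('v list \<Rightarrow>\<^sub>0 int) set" where
  "cycles K n = {c \<in> carrier (chain_group K n). boundary_map n c = 0}"

definition boundaries :: "'v ordered_complex \<Rightarrow> nat \<Rightarrow> ('v list \<Rightarrow>\<^sub>0 int) set" where
  "boundaries K n = boundary_map (Suc n) ` carrier (chain_group K (Suc n))"

definition homology :: "'v ordered_complex \<Rightarrow> nat \<Rightarrow> ('v list \<Rightarrow>\<^sub>0 int) set monoid" where
  "homology K n = subgroup_generated (chain_group K n) (cycles K n) Mod boundaries K n"

text \<open>
  The map induced on homology by an inclusion \<open>K \<subseteq> K'\<close>: a coset of the boundaries of \<open>K\<close> is sent to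
  the coset of the boundaries of \<open>K'\<close> that contains it.
\<close>

definition inclusion_induced ::
  "'v ordered_complex \<Rightarrow> nat \<Rightarrow> ('v list \<Rightarrow>\<^sub>0 int) set \<Rightarrow> ('v list \<Rightarrow>\<^sub>0 int) set" where
  "inclusion_induced K' n C = (\<Union>c\<in>C. boundaries K' n #>\<^bsub>chain_group K' n\<^esub> c)"

section \<open>Barcode and stillborn matrix\<close>

text \<open>
  The rank of an abelian group: the largest size of a linearly independent set over the integers.
  (The value is meaningless if these sizes are unbounded, which does not happen for finitely
  generated groups.)
\<close>

definition Z_independent :: "('g, 'b) monoid_scheme \<Rightarrow> 'g set \<Rightarrow> bool" where
  "Z_independent G A \<longleftrightarrow>
     finite A \<and> A \<subseteq> carrier G \<and>
     (\<forall>c :: 'g \<Rightarrow> int. finprod G (\<lambda>a. a [^]\<^bsub>G\<^esub> c a) A = \<one>\<^bsub>G\<^esub> \<longrightarrow> (\<forall>a\<in>A. c a = 0))"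

definition group_rank :: "('g, 'b) monoid_scheme \<Rightarrow> nat" where
  "group_rank G = Sup {card A | A. Z_independent G A}"

text \<open>Below, \<open>K j\<close> is the complex at stage \<open>j\<close> of a filtration.\<close>

definition persistent_homology ::
  "(nat \<Rightarrow> 'v ordered_complex) \<Rightarrow> nat \<Rightarrow> nat \<Rightarrow> nat \<Rightarrow> ('v list \<Rightarrow>\<^sub>0 int) set monoid" where
  "persistent_homology K n i j =
     subgroup_generated (homology (K j) n)
       (inclusion_induced (K j) n ` carrier (homology (K i) n))"

text \<open>The birth index is an integer because of the convention that the value at \<open>i = -1\<close> is 0.\<close>

definition persistent_betti ::
  "(nat \<Rightarrow> 'v ordered_complex) \<Rightarrow> nat \<Rightarrow> int \<Rightarrow> nat \<Rightarrow> int" where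
  "persistent_betti K n i j =
     (if i < 0 then 0 else int (group_rank (persistent_homology K n (nat i) j)))"

text \<open>An interval \<open>[i, j)\<close> is the pair \<open>(i, j)\<close>. The integers under \<open>nat\<close> are nonnegative.\<close>

definition barcode ::
  "(nat \<Rightarrow> 'v ordered_complex) \<Rightarrow> nat \<Rightarrow> nat \<Rightarrow> (nat \<times> enat) multiset" where
  "barcode K m n =
     (let \<beta> = persistent_betti K n in
      (\<Sum>i\<in>{..m}. \<Sum>j\<in>{i<..m}.
         replicate_mset
           (nat (\<beta> (int i) (j - 1) - \<beta> (int i) j - \<beta> (int i - 1) (j - 1) + \<beta> (int i - 1) j))
           (i, enat j)) +
      (\<Sum>i\<in>{..m}. replicate_mset (nat (\<beta> (int i) m - \<beta> (int i - 1) m)) (i, \<infinity>)))"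

text \<open>Only the columns \<open>j \<le> m\<close> of the matrix are defined.\<close>

definition stillborn_matrix :: "(nat \<Rightarrow> 'v ordered_complex) \<Rightarrow> nat \<Rightarrow> nat \<Rightarrow> nat \<Rightarrow> nat" where
  "stillborn_matrix K m i =
     (\<lambda>j\<in>{..m}.
        let B = boundaries (K j) i;
            Z = (if j = 0 then {0} else cycles (K (j - 1)) i)
        in group_rank (subgroup_generated (chain_group (K j) i) B Mod (B \<inter> Z)))"

definition persistence_pair ::
  "nat \<Rightarrow> 'a set \<Rightarrow> ('a \<Rightarrow> 'a \<Rightarrow> 'a) \<Rightarrow> ('a \<Rightarrow> 'a \<Rightarrow> 'a) \<Rightarrow> nat \<Rightarrow> (nat \<Rightarrow> ('a \<Rightarrow> 'a) set) \<Rightarrow>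
   vdiagram \<Rightarrow> (nat \<Rightarrow> (nat \<times> enat) multiset) \<times> (nat \<Rightarrow> nat \<Rightarrow> nat)" where
  "persistence_pair N X ut ot m S D =
     (let K = (\<lambda>j. clique_complex N (coloring_quiver X ut ot (S j) D))
      in (barcode K m, stillborn_matrix K m))"

definition End_filtration ::
  "'a set \<Rightarrow> ('a \<Rightarrow> 'a \<Rightarrow> 'a) \<Rightarrow> ('a \<Rightarrow> 'a \<Rightarrow> 'a) \<Rightarrow> nat \<Rightarrow> (nat \<Rightarrow> ('a \<Rightarrow> 'a) set) \<Rightarrow> bool" where
  "End_filtration X ut ot m S \<longleftrightarrow>
     (\<forall>j<m. S j \<subseteq> S (Suc j)) \<and> (\<forall>j\<le>m. S j \<subseteq> biquandle_End X ut ot)"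

end

theory Submission
  imports Defs
begin

text \<open>
  A coloring is a function of the parameters of the diagram that is constant between classical
  crossings and obeys the crossing rule; the crossings enter only through their parameters and
  signs. This makes reparametrisations and plane isotopies (whose Jacobian determinant has constant
  sign) harmless. A Reidemeister move changes such a function only on the strands inside the disc,
  where it amounts to a finite statement about labels: the values at the ends of the strands extend
  over one tangle if and only if they extend over the other, and then uniquely. For the third move
  the labels before and after sit on the edges of a cube of exchange laws. The three edges at any
  vertex of the cube determine all labels, and since \<open>X\<close> is finite, they can be prescribed
  arbitrarily; this covers all orientations of the move. The resulting bijection of colorings
  commutes with \<open>End(X)\<close>, so it is an isomorphism of quivers, which carries chains, cycles
  and boundaries along at every stage of the filtration.
\<close>

section \<open>Homology and renaming of vertices\<close>

text \<open>A semi-arc is a set of parameters, and one that enters the disc of a move changes as a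
  set although its part outside is untouched. Colorings of two diagrams therefore have no common
  domain, whereas functions of time do, and being equal outside the disc makes sense for them. The
  value \<open>undefined\<close> at crossing times makes equality of functions the same as equality
  of colorings; the labels at a crossing are then one-sided values. Isomorphic homology stage by
  stage would not be enough: a barcode is made of images of one stage in another, and the stillborn
  matrix intersects the boundaries of one stage with the cycles of the previous one. One bijection
  of colorings has to serve all stages, so that the chain isomorphisms commute with the inclusions.
  Since the vertices of the quivers are the same at all stages, commuting with every endomorphism is
  exactly the condition that provides this. The axioms of a biquandle state the third move for one
  arrangement of orientations only; the others have to be deduced, and this is where the cube comes
  from.\<close>

lemma hom_finprod_comm_group:
  assumes "comm_group G" "comm_group H" "h \<in> hom G H" "f \<in> A \<rightarrow> carrier G"
  shows "h (finprod G f A) = finprod H (\<lambda>a. h (f a)) A"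
proof -
  interpret G: comm_group G by fact
  interpret H: comm_group H by fact
  have one: "h \<one>\<^bsub>G\<^esub> = \<one>\<^bsub>H\<^esub>"
    using assms(3) G.is_group H.is_group hom_one by blast
  show ?thesis
    using assms(4)
  proof (induction A rule: infinite_finite_induct)
    case (insert x F)
    have f: "f \<in> F \<rightarrow> carrier G" "f x \<in> carrier G" and hf: "(\<lambda>a. h (f a)) \<in> F \<rightarrow> carrier H" "h (f x) \<in> carrier H"
      using insert.prems assms(3) by (auto simp: hom_def)
    show ?case
      using insert f hf assms(3) by (simp add: hom_mult)
  qed (use one in auto)
qed

text \<open>A relation with coefficients \<open>c\<close> among the images pulls back to the
  relation with coefficients \<open>c (h a)\<close>, because \<open>h\<close> is injective and
  respects products and integer powers.\<close>

lemma Z_independent_image: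
  assumes "comm_group G" "comm_group H" "h \<in> iso G H" "Z_independent G A"
  shows "Z_independent H (h ` A)"
  unfolding Z_independent_def
proof (intro conjI allI impI)
  interpret G: comm_group G by fact
  interpret H: comm_group H by fact
  interpret group_hom G H h
    using assms(3) by unfold_locales (auto simp: iso_def)
  have A: "finite A" "A \<subseteq> carrier G"
    using assms(4) by (auto simp: Z_independent_def)
  have inj: "inj_on h (carrier G)" and hom: "h \<in> hom G H"
    using assms(3) by (auto simp: iso_def bij_betw_def)
  show "finite (h ` A)" "h ` A \<subseteq> carrier H"
    using A by auto
  fix c :: "_ \<Rightarrow> int"
  assume *: "finprod H (\<lambda>b. b [^]\<^bsub>H\<^esub> c b) (h ` A) = \<one>\<^bsub>H\<^esub>"
  have "h (finprod G (\<lambda>a. a [^]\<^bsub>G\<^esub> c (h a)) A) = finprod H (\<lambda>a. h (a [^]\<^bsub>G\<^esub> c (h a))) A"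
    using A by (intro hom_finprod_comm_group assms hom) auto
  also have "\<dots> = finprod H (\<lambda>a. h a [^]\<^bsub>H\<^esub> c (h a)) A"
    using A by (intro H.finprod_cong') (auto simp: subset_iff hom_int_pow)
  also have "\<dots> = \<one>\<^bsub>H\<^esub>"
    using * A inj_on_subset[OF inj] by (subst (asm) H.finprod_reindex) auto
  finally have "h (finprod G (\<lambda>a. a [^]\<^bsub>G\<^esub> c (h a)) A) = h \<one>\<^bsub>G\<^esub>"
    by simp
  moreover have "finprod G (\<lambda>a. a [^]\<^bsub>G\<^esub> c (h a)) A \<in> carrier G"
    using A by (intro G.finprod_closed) auto
  ultimately have "finprod G (\<lambda>a. a [^]\<^bsub>G\<^esub> c (h a)) A = \<one>\<^bsub>G\<^esub>"
    using inj by (simp add: inj_on_def)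
  then show "\<forall>b\<in>h ` A. c b = 0"
    using assms(4) by (auto simp: Z_independent_def)
qed

text \<open>An isomorphism and its inverse carry independent sets to independent sets of the same
  size. Both suprema thus range over the same set of numbers, which settles the equality even where
  that set is unbounded.\<close>

lemma group_rank_iso:
  assumes "comm_group G" "comm_group H" "h \<in> iso G H"
  shows "group_rank G = group_rank H"
proof -
  interpret G: comm_group G by fact
  have sub: "{card A | A. Z_independent G A} \<subseteq> {card A | A. Z_independent H A}"
    if "comm_group G" "comm_group H" "h \<in> iso G H" for G :: "('x, 'y) monoid_scheme" and H :: "('z, 'w) monoid_scheme" and h
  proof clarify
    fix A assume A: "Z_independent G A"
    have "card (h ` A) = card A"
      using that(3) A by (intro card_image) (auto simp: iso_def bij_betw_def Z_independent_def intro: inj_on_subset)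
    then show "\<exists>B. card A = card B \<and> Z_independent H B"
      using Z_independent_image[OF that A] by metis
  qed
  have "inv_into (carrier G) h \<in> iso H G"
    using assms(3) by (rule G.iso_set_sym)
  then have "{card A | A. Z_independent G A} = {card A | A. Z_independent H A}"
    using sub[OF assms] sub[OF assms(2,1)] by blast
  then show ?thesis
    by (simp add: group_rank_def)
qed

text \<open>The elements of a factor group are cosets, that is sets, so the map induced by
  \<open>h\<close> is literally the image operation and no representatives are chosen.\<close>

lemma FactGroup_image_iso:
  assumes "comm_group G" "comm_group H" "h \<in> iso G H" "subgroup N G"
  shows "(`) h \<in> iso (G Mod N) (H Mod (h ` N))"
proof -
  interpret G: comm_group G by fact
  interpret H: comm_group H by fact
  have hm: "h (x \<otimes>\<^bsub>G\<^esub> y) = h x \<otimes>\<^bsub>H\<^esub> h y" if "x \<in> carrier G" "y \<in> carrier G" for x y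
    using assms(3) that by (auto simp: iso_def hom_def)
  have inj: "inj_on h (carrier G)" and onto: "h ` carrier G = carrier H"
    using assms(3) by (auto simp: iso_def bij_betw_def)
  have N: "N \<subseteq> carrier G"
    using assms(4) subgroup.subset by blast
  have coset: "h ` (N #>\<^bsub>G\<^esub> x) = (h ` N) #>\<^bsub>H\<^esub> h x" if "x \<in> carrier G" for x
  proof -
    have "h (a \<otimes>\<^bsub>G\<^esub> x) = h a \<otimes>\<^bsub>H\<^esub> h x" if "a \<in> N" for a
      using N that \<open>x \<in> carrier G\<close> by (auto simp: hm)
    then show ?thesis
      by (simp add: r_coset_def image_UN cong: SUP_cong)
  qed
  have carr: "(`) h ` carrier (G Mod N) = carrier (H Mod (h ` N))"
    unfolding carrier_FactGroup onto[symmetric] image_image by (rule image_cong) (simp_all add: coset)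
  have sub: "A \<subseteq> carrier G" if "A \<in> carrier (G Mod N)" for A
    using that N by (auto simp: carrier_FactGroup r_coset_def)
  have "inj_on ((`) h) (carrier (G Mod N))"
    by (meson inj inj_on_image_eq_iff inj_onI sub)
  moreover have "(`) h \<in> hom (G Mod N) (H Mod (h ` N))"
  proof (rule homI)
    fix A B assume "A \<in> carrier (G Mod N)" "B \<in> carrier (G Mod N)"
    then have "A \<subseteq> carrier G" "B \<subseteq> carrier G"
      using sub by auto
    then have "h (a \<otimes>\<^bsub>G\<^esub> b) = h a \<otimes>\<^bsub>H\<^esub> h b" if "a \<in> A" "b \<in> B" for a b
      using that by (meson hm subsetD)
    then show "h ` (A \<otimes>\<^bsub>G Mod N\<^esub> B) = h ` A \<otimes>\<^bsub>H Mod h ` N\<^esub> h ` B"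
      by (simp add: set_mult_def image_UN cong: SUP_cong)
  qed (use carr in auto)
  ultimately show ?thesis
    using carr by (simp add: iso_def bij_betw_def)
qed

section \<open>The boundary operator of ordered complexes, cycles, boundaries and homology
  groups\<close>

definition face :: "nat \<Rightarrow> 'v list \<Rightarrow> 'v list" where
  "face i vs = take i vs @ drop (Suc i) vs"

lemma boundary_map_add: "boundary_map n (a + b) = boundary_map n a + boundary_map n b"
  by (simp add: boundary_map_def frag_extend_add)

lemma boundary_map_diff: "boundary_map n (a - b) = boundary_map n a - boundary_map n b"
  by (simp add: boundary_map_def frag_extend_diff)

lemma boundary_map_0 [simp]: "boundary_map n 0 = 0"
  by (simp add: boundary_map_def)

lemma boundary_map_sum: "finite I \<Longrightarrow> boundary_map n (\<Sum>i\<in>I. g i) = (\<Sum>i\<in>I. boundary_map n (g i))"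
  by (induction I rule: finite_induct) (simp_all add: boundary_map_add)

lemma boundary_map_cmul: "boundary_map n (frag_cmul k c) = frag_cmul k (boundary_map n c)"
  by (simp add: boundary_map_def frag_extend_cmul)

lemma boundary_map_of:
  "boundary_map (Suc n) (frag_of vs) = (\<Sum>i\<le>Suc n. frag_cmul ((-1) ^ i) (frag_of (face i vs)))"
  by (simp add: boundary_map_def face_def)

lemma length_face [simp]: "i < length vs \<Longrightarrow> length (face i vs) = length vs - 1"
  by (auto simp: face_def)

lemma nth_face: "i < length vs \<Longrightarrow> k < length vs - 1 \<Longrightarrow> face i vs ! k = vs ! (if k < i then k else Suc k)"
  by (auto simp: face_def nth_append)

text \<open>The simplicial identity: once the earlier entry \<open>j\<close> is gone, the later
  entry \<open>i\<close> sits one place further down.\<close>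

lemma face_face:
  assumes "j < i" "i < length vs"
  shows "face j (face i vs) = face (i - 1) (face j vs)"
  by (rule nth_equalityI) (use assms in \<open>auto simp: nth_face\<close>)

lemma boundary_boundary_of:
  assumes "length vs = Suc (Suc (Suc n))"
  shows "boundary_map (Suc n) (boundary_map (Suc (Suc n)) (frag_of vs)) = 0"
proof -
  define t where "t = (\<lambda>(i, j). frag_cmul ((-1) ^ (i + j)) (frag_of (face j (face i vs))))"
  let ?L = "{(i, j). j < i \<and> i \<le> Suc (Suc n)}" and ?U = "{(i, j). i \<le> j \<and> j \<le> Suc n}"
  have fin: "finite ?L" "finite ?U"
    by (rule finite_subset[of _ "{..Suc (Suc n)} \<times> {..Suc (Suc n)}"]; auto)+
  have "boundary_map (Suc n) (boundary_map (Suc (Suc n)) (frag_of vs))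
        = (\<Sum>i\<le>Suc (Suc n). \<Sum>j\<le>Suc n. t (i, j))"
    by (simp only: boundary_map_of boundary_map_sum finite_atMost boundary_map_cmul frag_cmul_sum
        frag_cmul_cmul t_def power_add prod.case)
  also have "\<dots> = sum t ({..Suc (Suc n)} \<times> {..Suc n})"
    by (simp only: sum.cartesian_product split_def prod.collapse)
  also have "{..Suc (Suc n)} \<times> {..Suc n} = ?L \<union> ?U"
    by auto
  also have "sum t (?L \<union> ?U) = sum t ?L + sum t ?U"
    by (rule sum.union_disjoint[OF fin]) auto
  \<comment> \<open>The cancelling bijection sends (i, j) with j < i to (j, i - 1). Both pairs
    delete the same two entries, and the sum of the indices changes by one, so the signs are
    opposite.\<close>
  also have "sum t ?L = sum (\<lambda>x. - t x) ?U"
  proof (rule sum.reindex_bij_witness[where i = "\<lambda>(j, i). (Suc i, j)" and j = "\<lambda>(i, j). (j, i - 1)"])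
    fix a assume "a \<in> ?L"
    then obtain i j where a: "a = (i, j)" "j < i" "i \<le> Suc (Suc n)"
      by auto
    then obtain k where i: "i = Suc k"
      by (cases i) auto
    have "face j (face i vs) = face k (face j vs)"
      using face_face[of j i vs] a i assms by simp
    then show "- t (case a of (i, j) \<Rightarrow> (j, i - 1)) = t a"
      by (simp add: a i t_def add.commute)
  qed auto
  finally show ?thesis
    by (simp add: sum_negf)
qed

lemma boundary_boundary:
  assumes "Poly_Mapping.keys c \<subseteq> {vs. length vs = Suc (Suc n)}"
  shows "boundary_map n (boundary_map (Suc n) c) = 0"
proof (cases n)
  case (Suc k)
  show ?thesis
    using assms unfolding Suc
    by (induction rule: frag_induction) (auto simp: boundary_map_diff boundary_boundary_of)
qed (simp add: boundary_map_def)

text \<open>The facts about clique complexes on which the homology groups rely; sublists of a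
  simplex arise by repeatedly deleting one entry.\<close>

locale face_closed =
  fixes K :: "'v ordered_complex"
  assumes length_simplex: "vs \<in> K n \<Longrightarrow> length vs = Suc n"
    and face_simplex: "vs \<in> K (Suc n) \<Longrightarrow> i \<le> Suc n \<Longrightarrow> face i vs \<in> K n"
begin

lemma comm_group_chain: "comm_group (chain_group K n)"
  by (simp add: chain_group_def abelian_free_Abelian_group)

lemma boundary_closed:
  assumes "c \<in> carrier (chain_group K (Suc n))"
  shows "boundary_map (Suc n) c \<in> carrier (chain_group K n)"
proof -
  have *: "Poly_Mapping.keys (boundary_map (Suc n) (frag_of vs)) \<subseteq> K n" if "vs \<in> K (Suc n)" for vs
    unfolding boundary_map_of
    by (rule order_trans[OF keys_sum]) (use face_simplex[OF that] in auto)
  have "Poly_Mapping.keys (boundary_map (Suc n) c) \<subseteq> K n" if "Poly_Mapping.keys c \<subseteq> K (Suc n)"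
    using that
  proof (induction rule: frag_induction)
    case (diff a b)
    then show ?case
      using keys_diff[of "boundary_map (Suc n) a" "boundary_map (Suc n) b"]
      by (auto simp: boundary_map_diff)
  qed (use * in auto)
  then show ?thesis
    using assms by (simp add: chain_group_def)
qed

lemma subgroup_chainI:
  assumes "A \<subseteq> carrier (chain_group K n)" "0 \<in> A" "\<And>a b. a \<in> A \<Longrightarrow> b \<in> A \<Longrightarrow> a - b \<in> A"
  shows "subgroup A (chain_group K n)"
proof
  have neg: "- a \<in> A" if "a \<in> A" for a
    using assms(3)[OF assms(2) that] by simp
  show "a \<otimes>\<^bsub>chain_group K n\<^esub> b \<in> A" if "a \<in> A" "b \<in> A" for a b
    using assms(3)[OF that(1) neg[OF that(2)]] by (simp add: chain_group_def)
  show "inv\<^bsub>chain_group K n\<^esub> a \<in> A" if "a \<in> A" for a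
    using neg[OF that] subsetD[OF assms(1) that] by (simp add: chain_group_def)
qed (use assms in \<open>auto simp: chain_group_def\<close>)

lemma chain_diff_closed:
  "a \<in> carrier (chain_group K n) \<Longrightarrow> b \<in> carrier (chain_group K n) \<Longrightarrow> a - b \<in> carrier (chain_group K n)"
  using keys_diff[of a b] by (auto simp: chain_group_def)

lemma zero_chain: "0 \<in> carrier (chain_group K n)"
  by (simp add: chain_group_def)

lemma subgroup_cycles: "subgroup (cycles K n) (chain_group K n)"
  by (rule subgroup_chainI) (auto simp: cycles_def boundary_map_diff chain_diff_closed zero_chain)

lemma subgroup_boundaries: "subgroup (boundaries K n) (chain_group K n)"
proof (rule subgroup_chainI)
  show "0 \<in> boundaries K n"
    using zero_chain[of "Suc n"] by (auto simp: boundaries_def image_iff intro!: bexI[of _ 0])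
  fix a b assume "a \<in> boundaries K n" "b \<in> boundaries K n"
  then show "a - b \<in> boundaries K n"
    by (auto simp: boundaries_def simp flip: boundary_map_diff intro!: imageI chain_diff_closed)
qed (auto simp: boundaries_def boundary_closed)

lemma boundaries_subset_cycles: "boundaries K n \<subseteq> cycles K n"
proof -
  have "boundary_map n (boundary_map (Suc n) c) = 0" if "c \<in> carrier (chain_group K (Suc n))" for c
    using that length_simplex by (intro boundary_boundary) (auto simp: chain_group_def)
  then show ?thesis
    by (auto simp: boundaries_def cycles_def boundary_closed)
qed

lemma carrier_cycle_group: "carrier (subgroup_generated (chain_group K n) (cycles K n)) = cycles K n"
  by (rule subgroup.carrier_subgroup_generated_subgroup[OF subgroup_cycles])

lemma comm_group_cycles: "comm_group (subgroup_generated (chain_group K n) (cycles K n))"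
  by (intro group.abelian_subgroup_generated comm_group_chain comm_group.axioms(2))

lemma subgroup_boundaries_cycles:
  "subgroup (boundaries K n) (subgroup_generated (chain_group K n) (cycles K n))"
  by (intro group.subgroup_of_subgroup_generated boundaries_subset_cycles subgroup_boundaries
      comm_group.axioms(2) comm_group_chain)

lemma comm_group_homology: "comm_group (homology K n)"
  unfolding homology_def
  by (intro comm_group.abelian_FactGroup comm_group_cycles subgroup_boundaries_cycles)

text \<open>Cosets as explicit translates, the form in which the map induced by an inclusion can be
  computed.\<close>

lemma carrier_homology: "carrier (homology K n) = (\<lambda>z. (\<lambda>b. b + z) ` boundaries K n) ` cycles K n"
  unfolding homology_def carrier_FactGroup carrier_cycle_group
  by (rule image_cong) (auto simp: r_coset_def chain_group_def)

end

section \<open>The chain isomorphism induced by renaming vertices\<close>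

definition push :: "('v \<Rightarrow> 'w) \<Rightarrow> ('v list \<Rightarrow>\<^sub>0 int) \<Rightarrow> ('w list \<Rightarrow>\<^sub>0 int)" where
  "push \<phi> = frag_extend (frag_of \<circ> map \<phi>)"

definition rename :: "('v \<Rightarrow> 'w) \<Rightarrow> 'v ordered_complex \<Rightarrow> 'w ordered_complex" where
  "rename \<phi> K n = map \<phi> ` K n"

lemma push_0 [simp]: "push \<phi> 0 = 0"
  by (simp add: push_def)

lemma push_add: "push \<phi> (a + b) = push \<phi> a + push \<phi> b"
  by (simp add: push_def frag_extend_add)

lemma push_diff: "push \<phi> (a - b) = push \<phi> a - push \<phi> b"
  by (simp add: push_def frag_extend_diff)

lemma push_of [simp]: "push \<phi> (frag_of vs) = frag_of (map \<phi> vs)"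
  by (simp add: push_def)

text \<open>Deleting an entry commutes with \<open>map\<close>, which gives the identity on
  generators; linearity does the rest.\<close>

lemma push_boundary: "push \<phi> (boundary_map n c) = boundary_map n (push \<phi> c)"
proof (cases n)
  case (Suc k)
  have "face i (map \<phi> vs) = map \<phi> (face i vs)" for i vs
    by (simp add: face_def take_map drop_map)
  then have "push \<phi> (boundary_map n (frag_of vs)) = boundary_map n (push \<phi> (frag_of vs))" for vs
    by (simp add: Suc boundary_map_of push_def frag_extend_sum o_def frag_extend_cmul del: sum.atMost_Suc)
  note of = this
  show ?thesis
    using subset_UNIV[of "Poly_Mapping.keys c"]
    by (induction rule: frag_induction) (use of in \<open>simp_all add: push_diff boundary_map_diff\<close>)
qed (simp add: boundary_map_def)

lemma keys_push: "Poly_Mapping.keys (push \<phi> c) \<subseteq> map \<phi> ` Poly_Mapping.keys c"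
  using keys_frag_extend[of "frag_of \<circ> map \<phi>" c] by (auto simp: push_def)

lemma push_push_inverse:
  assumes "Poly_Mapping.keys c \<subseteq> lists V" "\<And>v. v \<in> V \<Longrightarrow> \<psi> (\<phi> v) = v"
  shows "push \<psi> (push \<phi> c) = c"
  using assms(1)
proof (induction rule: frag_induction)
  case (one vs)
  then have "map \<psi> (map \<phi> vs) = vs"
    using assms(2) by (auto intro!: map_idI simp: subset_iff)
  then show ?case
    by (simp del: map_map)
qed (simp_all add: push_diff)

text \<open>\<open>V\<close> bounds the vertices in all degrees, so that
  \<open>inv_into V \<phi>\<close> renames back and yields an inverse of \<open>push \<phi>\<close>
  on chains.\<close>

locale renaming = face_closed K for K :: "'v ordered_complex" +
  fixes \<phi> :: "'v \<Rightarrow> 'w" and V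
  assumes inj_vertices: "inj_on \<phi> V"
    and vertices: "vs \<in> K n \<Longrightarrow> set vs \<subseteq> V"
begin

sublocale renamed: face_closed "rename \<phi> K"
proof
  have "face i (map \<phi> vs) = map \<phi> (face i vs)" for i vs
    by (simp add: face_def take_map drop_map)
  then show "vs \<in> rename \<phi> K (Suc n) \<Longrightarrow> i \<le> Suc n \<Longrightarrow> face i vs \<in> rename \<phi> K n" for vs n i
    by (auto simp: rename_def face_simplex)
qed (auto simp: rename_def length_simplex)

lemma chain_keys: "c \<in> carrier (chain_group K n) \<Longrightarrow> Poly_Mapping.keys c \<subseteq> lists V"
  using vertices by (fastforce simp: chain_group_def)

lemma push_inverse: "c \<in> carrier (chain_group K n) \<Longrightarrow> push (inv_into V \<phi>) (push \<phi> c) = c"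
  by (rule push_push_inverse[OF chain_keys]) (auto simp: inj_vertices)

lemma push_closed: "c \<in> carrier (chain_group K n) \<Longrightarrow> push \<phi> c \<in> carrier (chain_group (rename \<phi> K) n)"
  using keys_push[of \<phi> c] by (fastforce simp: chain_group_def rename_def)

lemma map_inverse: "vs \<in> K n \<Longrightarrow> map (inv_into V \<phi>) (map \<phi> vs) = vs"
  using vertices[of vs n] by (auto intro!: map_idI simp: inj_vertices subset_iff)

lemma pull_closed:
  assumes "c \<in> carrier (chain_group (rename \<phi> K) n)"
  shows "push (inv_into V \<phi>) c \<in> carrier (chain_group K n)" "push \<phi> (push (inv_into V \<phi>) c) = c"
proof -
  have "Poly_Mapping.keys (push (inv_into V \<phi>) c) \<subseteq> map (inv_into V \<phi>) ` rename \<phi> K n"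
    using keys_push[of "inv_into V \<phi>" c] assms by (auto simp: chain_group_def)
  also have "\<dots> \<subseteq> K n"
    using map_inverse by (auto simp: rename_def simp del: map_map)
  finally show "push (inv_into V \<phi>) c \<in> carrier (chain_group K n)"
    by (simp add: chain_group_def)
  have "Poly_Mapping.keys c \<subseteq> lists (\<phi> ` V)"
    using assms vertices by (fastforce simp: chain_group_def rename_def)
  then show "push \<phi> (push (inv_into V \<phi>) c) = c"
    by (rule push_push_inverse) (auto simp: inj_vertices)
qed

lemma push_iso: "push \<phi> \<in> iso (chain_group K n) (chain_group (rename \<phi> K) n)"
proof (rule isoI)
  show "push \<phi> \<in> hom (chain_group K n) (chain_group (rename \<phi> K) n)"
    using push_closed by (intro homI) (auto simp: push_add chain_group_def)
  show "bij_betw (push \<phi>) (carrier (chain_group K n)) (carrier (chain_group (rename \<phi> K) n))"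
    by (rule bij_betw_byWitness[where f' = "push (inv_into V \<phi>)"])
      (use push_inverse push_closed pull_closed in auto)
qed

lemma push_chains: "push \<phi> ` carrier (chain_group K n) = carrier (chain_group (rename \<phi> K) n)"
  using push_iso[of n] by (auto simp: iso_def bij_betw_def)

text \<open>The inverse renaming commutes with the boundary as well, hence pulls cycles back to
  cycles.\<close>

lemma push_cycles: "push \<phi> ` cycles K n = cycles (rename \<phi> K) n"
proof
  show "push \<phi> ` cycles K n \<subseteq> cycles (rename \<phi> K) n"
    by (auto simp: cycles_def push_closed simp flip: push_boundary)
  show "cycles (rename \<phi> K) n \<subseteq> push \<phi> ` cycles K n"
  proof
    fix c assume c: "c \<in> cycles (rename \<phi> K) n"
    then have "push (inv_into V \<phi>) c \<in> cycles K n"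
      by (auto simp: cycles_def pull_closed simp flip: push_boundary)
    moreover have "c = push \<phi> (push (inv_into V \<phi>) c)"
      using c pull_closed(2)[of c n] by (simp add: cycles_def)
    ultimately show "c \<in> push \<phi> ` cycles K n"
      by blast
  qed
qed

lemma push_boundaries: "push \<phi> ` boundaries K n = boundaries (rename \<phi> K) n"
  unfolding boundaries_def push_chains[symmetric] image_image push_boundary ..

lemma push_cycle_iso:
  "push \<phi> \<in> iso (subgroup_generated (chain_group K n) (cycles K n))
     (subgroup_generated (chain_group (rename \<phi> K) n) (cycles (rename \<phi> K) n))"
proof (rule group_hom.iso_between_subgroups)
  show "group_hom (chain_group K n) (chain_group (rename \<phi> K) n) (push \<phi>)"
    using push_iso[of n] comm_group_chain renamed.comm_group_chain
    by (auto simp: group_hom_def group_hom_axioms_def iso_def comm_group.axioms)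
qed (use push_iso push_cycles in \<open>auto simp: cycles_def\<close>)

lemma push_homology: "(`) (push \<phi>) \<in> iso (homology K n) (homology (rename \<phi> K) n)"
  unfolding homology_def push_boundaries[symmetric]
  by (intro FactGroup_image_iso comm_group_cycles renamed.comm_group_cycles push_cycle_iso
      subgroup_boundaries_cycles)

end

section \<open>Barcode and stillborn matrix of a filtration whose stages are renamed by one
  map\<close>

locale filtration_renaming =
  fixes K :: "nat \<Rightarrow> 'v ordered_complex" and K' :: "nat \<Rightarrow> 'w ordered_complex"
    and m :: nat and \<phi> :: "'v \<Rightarrow> 'w" and V
  assumes renamed: "j \<le> m \<Longrightarrow> K' j = rename \<phi> (K j)"
    and renaming: "j \<le> m \<Longrightarrow> renaming (K j) \<phi> V"
    and mono: "i \<le> j \<Longrightarrow> j \<le> m \<Longrightarrow> K i n \<subseteq> K j n"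
begin

lemma chain_mono: "i \<le> j \<Longrightarrow> j \<le> m \<Longrightarrow> carrier (chain_group (K i) n) \<subseteq> carrier (chain_group (K j) n)"
  using mono by (fastforce simp: chain_group_def)

lemma cycles_mono: "i \<le> j \<Longrightarrow> j \<le> m \<Longrightarrow> cycles (K i) n \<subseteq> cycles (K j) n"
  using chain_mono by (fastforce simp: cycles_def)

lemma boundaries_mono: "i \<le> j \<Longrightarrow> j \<le> m \<Longrightarrow> boundaries (K i) n \<subseteq> boundaries (K j) n"
  using chain_mono by (fastforce simp: boundaries_def)

lemma inclusion_induced_closed:
  assumes "i \<le> j" "j \<le> m" "C \<in> carrier (homology (K i) n)"
  shows "inclusion_induced (K j) n C \<in> carrier (homology (K j) n)"
proof -
  interpret Ki: renaming "K i" \<phi> V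
    using assms by (auto intro: renaming)
  interpret Kj: renaming "K j" \<phi> V
    using assms by (auto intro: renaming)
  obtain z where z: "z \<in> cycles (K i) n" "C = (\<lambda>b. b + z) ` boundaries (K i) n"
    using assms(3) by (auto simp: Ki.carrier_homology)
  have sub: "b - b' \<in> boundaries (K j) n" if "b \<in> boundaries (K j) n" "b' \<in> boundaries (K j) n" for b b'
    using that by (auto simp: boundaries_def simp flip: boundary_map_diff intro!: imageI Kj.chain_diff_closed)
  have zero: "0 \<in> boundaries (K i) n"
    using subgroup.one_closed[OF Ki.subgroup_boundaries[of n]] by (simp add: chain_group_def)
  have add: "b + b' \<in> boundaries (K j) n" if "b \<in> boundaries (K j) n" "b' \<in> boundaries (K j) n" for b b'
    using subgroup.m_closed[OF Kj.subgroup_boundaries that] by (simp add: chain_group_def)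
  \<comment> \<open>The definition takes a union of cosets, one for each element of
    \<open>C\<close>. They all coincide, since boundaries of the smaller complex are boundaries of
    the larger one.\<close>
  have "inclusion_induced (K j) n C = (\<lambda>b. b + z) ` boundaries (K j) n"
  proof
    show "inclusion_induced (K j) n C \<subseteq> (\<lambda>b. b + z) ` boundaries (K j) n"
      using add boundaries_mono[OF assms(1,2), of n]
      by (force simp: z inclusion_induced_def r_coset_def chain_group_def add.assoc[symmetric])
    show "(\<lambda>b. b + z) ` boundaries (K j) n \<subseteq> inclusion_induced (K j) n C"
      using zero by (force simp: z inclusion_induced_def r_coset_def chain_group_def)
  qed
  then show ?thesis
    using z cycles_mono[OF assms(1,2), of n] by (auto simp: Kj.carrier_homology)
qed

text \<open>The same \<open>\<phi>\<close> renames both stages, so renaming commutes with the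
  inclusion. This is what transports the images of homology groups and not only the groups
  themselves.\<close>

lemma push_inclusion_induced:
  assumes "j \<le> m"
  shows "push \<phi> ` inclusion_induced (K j) n C = inclusion_induced (rename \<phi> (K j)) n (push \<phi> ` C)"
proof -
  interpret Kj: renaming "K j" \<phi> V
    using assms by (auto intro: renaming)
  show ?thesis
    by (simp add: inclusion_induced_def r_coset_def chain_group_def image_UN push_add
        flip: Kj.push_boundaries)
qed

lemma persistent_homology_rank:
  assumes "i \<le> j" "j \<le> m"
  shows "group_rank (persistent_homology K n i j) = group_rank (persistent_homology K' n i j)"
proof -
  interpret Ki: renaming "K i" \<phi> V
    using assms by (auto intro: renaming)
  interpret Kj: renaming "K j" \<phi> V
    using assms by (auto intro: renaming)
  let ?I = "inclusion_induced (K j) n ` carrier (homology (K i) n)"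
  have I: "?I \<subseteq> carrier (homology (K j) n)"
    using inclusion_induced_closed[OF assms] by blast
  have "carrier (homology (rename \<phi> (K i)) n) = (`) (push \<phi>) ` carrier (homology (K i) n)"
    using Ki.push_homology[of n] by (auto simp: iso_def bij_betw_def)
  then have *: "(`) (push \<phi>) ` ?I
     = inclusion_induced (rename \<phi> (K j)) n ` carrier (homology (rename \<phi> (K i)) n)"
    by (simp add: image_image push_inclusion_induced[OF assms(2)])
  have eq: "K' i = rename \<phi> (K i)" "K' j = rename \<phi> (K j)"
    using assms by (auto simp: renamed)
  have "(`) (push \<phi>) \<in> iso (persistent_homology K n i j) (persistent_homology K' n i j)"
    unfolding persistent_homology_def eq
  proof (rule group_hom.iso_between_subgroups[OF _ Kj.push_homology I *])
    show "group_hom (homology (K j) n) (homology (rename \<phi> (K j)) n) ((`) (push \<phi>))"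
      using Kj.push_homology[of n] Kj.comm_group_homology Kj.renamed.comm_group_homology
      by (auto simp: group_hom_def group_hom_axioms_def iso_def comm_group.axioms)
  qed
  then show ?thesis
    by (rule group_rank_iso[rotated 2])
      (auto simp: persistent_homology_def eq intro!: group.abelian_subgroup_generated
        Kj.comm_group_homology Kj.renamed.comm_group_homology comm_group.axioms(2))
qed

lemma persistent_betti_rename:
  assumes "i \<le> int j" "j \<le> m"
  shows "persistent_betti K' n i j = persistent_betti K n i j"
  using assms by (auto simp: persistent_betti_def persistent_homology_rank nat_le_iff)

lemma barcode_rename: "barcode K' m n = barcode K m n"
proof -
  \<comment> \<open>The sums are compared for arbitrary functions that agree where the birth index
    is at most the stage. The barcode reads the Betti numbers only there, since \<open>i < j\<close>
    gives \<open>i \<le> j - 1\<close>.\<close>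
  have "(\<Sum>i\<in>{..m}. \<Sum>j\<in>{i<..m}. replicate_mset (nat (g (int i) (j - 1) - g (int i) j - g (int i - 1) (j - 1) + g (int i - 1) j)) (i, enat j))
      = (\<Sum>i\<in>{..m}. \<Sum>j\<in>{i<..m}. replicate_mset (nat (h (int i) (j - 1) - h (int i) j - h (int i - 1) (j - 1) + h (int i - 1) j)) (i, enat j))"
    if "\<And>i j. i \<le> int j \<Longrightarrow> j \<le> m \<Longrightarrow> g i j = h i j" for g h :: "int \<Rightarrow> nat \<Rightarrow> int"
    by (intro sum.cong refl) (use that in auto)
  note 1 = this
  have "(\<Sum>i\<in>{..m}. replicate_mset (nat (g (int i) m - g (int i - 1) m)) (i, \<infinity> :: enat))
      = (\<Sum>i\<in>{..m}. replicate_mset (nat (h (int i) m - h (int i - 1) m)) (i, \<infinity> :: enat))"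
    if "\<And>i j. i \<le> int j \<Longrightarrow> j \<le> m \<Longrightarrow> g i j = h i j" for g h :: "int \<Rightarrow> nat \<Rightarrow> int"
    by (intro sum.cong refl) (use that in auto)
  note 2 = this
  show ?thesis
    unfolding barcode_def Let_def
    by (intro arg_cong2[where f = "(+)"] 1 2 persistent_betti_rename)
qed

lemma stillborn_matrix_rename: "stillborn_matrix K' m n = stillborn_matrix K m n"
  unfolding stillborn_matrix_def
proof (rule restrict_ext)
  fix j assume "j \<in> {..m}"
  then have j: "j \<le> m" by simp
  interpret Kj: renaming "K j" \<phi> V
    using j by (auto intro: renaming)
  \<comment> \<open>Truncated subtraction gives \<open>p = 0\<close> for \<open>j = 0\<close>, so
    \<open>p\<close> is a stage of the filtration in all cases. The convention that only 0 is a
    cycle before the first stage goes into \<open>Z\<close>.\<close>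
  define p where "p = j - 1"
  have p: "p \<le> j" "p \<le> m"
    using j by (auto simp: p_def)
  interpret Kp: renaming "K p" \<phi> V
    using p by (auto intro: renaming)
  let ?B = "boundaries (K j) n" and ?G = "chain_group (K j) n" and ?G' = "chain_group (rename \<phi> (K j)) n"
  define Z where "Z = (if j = 0 then {0} else cycles (K p) n)"
  have Zsub: "subgroup Z (chain_group (K p) n)"
    using Kp.subgroup_cycles[of n] Kp.subgroup_chainI[of "{0}" n]
    by (auto simp: Z_def Kp.zero_chain)
  have Z: "subgroup Z ?G"
  proof (rule Kj.subgroup_chainI)
    show "Z \<subseteq> carrier ?G"
      using subgroup.subset[OF Zsub] chain_mono[of p j n] j p by auto
    show "0 \<in> Z"
      using subgroup.one_closed[OF Zsub] by (simp add: chain_group_def)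
    show "a - b \<in> Z" if "a \<in> Z" "b \<in> Z" for a b
      using that by (auto simp: Z_def cycles_def boundary_map_diff Kp.chain_diff_closed split: if_splits)
  qed
  have pushZ: "push \<phi> ` Z = (if j = 0 then {0} else cycles (rename \<phi> (K p)) n)"
    by (simp add: Z_def Kp.push_cycles)
  \<comment> \<open>Injectivity of \<open>push \<phi>\<close> makes the image of the intersection
    the intersection of the images.\<close>
  have BZ: "push \<phi> ` (?B \<inter> Z) = push \<phi> ` ?B \<inter> push \<phi> ` Z"
    using subgroup.subset[OF Z] subgroup.subset[OF Kj.subgroup_boundaries[of n]] Kj.push_iso[of n]
    by (intro inj_on_image_Int[of _ "carrier ?G"]) (auto simp: iso_def bij_betw_def)
  have iso: "push \<phi> \<in> iso (subgroup_generated ?G ?B) (subgroup_generated ?G' (push \<phi> ` ?B))"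
  proof (rule group_hom.iso_between_subgroups)
    show "group_hom ?G ?G' (push \<phi>)"
      using Kj.push_iso[of n] Kj.comm_group_chain Kj.renamed.comm_group_chain
      by (auto simp: group_hom_def group_hom_axioms_def iso_def comm_group.axioms)
  qed (use Kj.push_iso subgroup.subset[OF Kj.subgroup_boundaries[of n]] in auto)
  have cg: "comm_group (subgroup_generated ?G ?B)" "comm_group (subgroup_generated ?G' A)" for A
    by (intro group.abelian_subgroup_generated Kj.comm_group_chain Kj.renamed.comm_group_chain
        comm_group.axioms(2))+
  have sub: "subgroup (?B \<inter> Z) (subgroup_generated ?G ?B)"
    by (intro group.subgroup_of_subgroup_generated group.subgroups_Inter_pair Kj.subgroup_boundaries Z
        comm_group.axioms(2) Kj.comm_group_chain) auto
  have "group_rank (subgroup_generated ?G ?B Mod (?B \<inter> Z))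
      = group_rank (subgroup_generated ?G' (push \<phi> ` ?B) Mod (push \<phi> ` (?B \<inter> Z)))"
  proof (rule group_rank_iso[OF _ _ FactGroup_image_iso[OF cg(1) cg(2) iso sub]])
    show "comm_group (subgroup_generated ?G ?B Mod (?B \<inter> Z))"
      by (rule comm_group.abelian_FactGroup[OF cg(1) sub])
    have "subgroup (push \<phi> ` (?B \<inter> Z)) (subgroup_generated ?G' (push \<phi> ` ?B))"
      using iso cg sub by (intro group_hom.subgroup_img_is_subgroup[of "subgroup_generated ?G ?B"])
        (auto simp: group_hom_def group_hom_axioms_def iso_def comm_group.axioms)
    then show "comm_group (subgroup_generated ?G' (push \<phi> ` ?B) Mod push \<phi> ` (?B \<inter> Z))"
      by (rule comm_group.abelian_FactGroup[OF cg(2)])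
  qed
  moreover have "(if j = 0 then {0} else cycles (K' (j - 1)) n) = push \<phi> ` Z"
    using pushZ p by (simp add: renamed p_def)
  moreover have "(if j = 0 then {0} else cycles (K (j - 1)) n) = Z"
    by (simp add: Z_def p_def)
  ultimately show "(let B = boundaries (K' j) n;
            Z = if j = 0 then {0} else cycles (K' (j - 1)) n
        in group_rank (subgroup_generated (chain_group (K' j) n) B Mod B \<inter> Z)) =
      (let B = ?B; Z = if j = 0 then {0} else cycles (K (j - 1)) n
        in group_rank (subgroup_generated ?G B Mod B \<inter> Z))"
    by (simp only: Let_def renamed[OF j] BZ flip: Kj.push_boundaries)
qed

end

section \<open>Colourings determine the persistence pair\<close>

text \<open>What the persistence pair can see of a diagram. All of \<open>biquandle_End\<close> is
  quantified over, rather than one subset, so that a single \<open>\<Phi>\<close> serves every stage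
  of a filtration.\<close>

definition same_colorings ::
  "'a set \<Rightarrow> ('a \<Rightarrow> 'a \<Rightarrow> 'a) \<Rightarrow> ('a \<Rightarrow> 'a \<Rightarrow> 'a) \<Rightarrow> vdiagram \<Rightarrow> vdiagram \<Rightarrow> bool" where
  "same_colorings X ut ot D D' \<longleftrightarrow>
     (\<exists>\<Phi>. bij_betw \<Phi> (colorings X ut ot D) (colorings X ut ot D') \<and>
        (\<forall>f\<in>colorings X ut ot D. \<forall>\<alpha>\<in>biquandle_End X ut ot.
           compose (semi_arcs D) \<alpha> f \<in> colorings X ut ot D \<and>
           \<Phi> (compose (semi_arcs D) \<alpha> f) = compose (semi_arcs D') \<alpha> (\<Phi> f)))"

lemma face_closed_clique_complex: "face_closed (clique_complex N Q)"
proof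
  fix vs and n i :: nat
  assume vs: "vs \<in> clique_complex N Q (Suc n)" and i: "i \<le> Suc n"
  have len: "length vs = Suc (Suc n)"
    using vs by (simp add: clique_complex_def)
  have "set (face i vs) \<subseteq> set vs"
    using set_take_subset[of i vs] set_drop_subset[of "Suc i" vs] by (auto simp: face_def)
  then show "face i vs \<in> clique_complex N Q n"
    using vs i len by (auto simp: clique_complex_def nth_face)
qed (simp add: clique_complex_def)

lemma verts_coloring_quiver [simp]: "verts (coloring_quiver X ut ot S D) = colorings X ut ot D"
  by (simp add: coloring_quiver_def)

lemma edge_count_coloring_quiver:
  assumes "u \<in> colorings X ut ot D"
  shows "edge_count (coloring_quiver X ut ot S D) u v = card {\<alpha> \<in> S. compose (semi_arcs D) \<alpha> u = v}"
proof -
  have "{e \<in> arcs (coloring_quiver X ut ot S D). tail (coloring_quiver X ut ot S D) e = u \<and>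
          head (coloring_quiver X ut ot S D) e = v} = Pair u ` {\<alpha> \<in> S. compose (semi_arcs D) \<alpha> u = v}"
    using assms by (auto simp: coloring_quiver_def)
  then show ?thesis
    by (simp add: edge_count_def card_image inj_on_def)
qed

lemma finite_biquandle_End:
  assumes "finite X"
  shows "finite (biquandle_End X ut ot)"
  by (rule finite_subset[OF _ finite_PiE[OF assms, of "\<lambda>_. X"]]) (auto simp: biquandle_End_def assms)

text \<open>More endomorphisms give more edges between the same vertices. Finiteness makes
  \<open>card\<close> monotone: an infinite set of edges would be counted as 0.\<close>

lemma clique_complex_mono:
  assumes "finite T" "S \<subseteq> T"
  shows "clique_complex N (coloring_quiver X ut ot S D) n \<subseteq> clique_complex N (coloring_quiver X ut ot T D) n"
proof
  fix vs assume vs: "vs \<in> clique_complex N (coloring_quiver X ut ot S D) n"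
  then have V: "vs ! i \<in> colorings X ut ot D" if "i < length vs" for i
    using that by (auto simp: clique_complex_def)
  have "edge_count (coloring_quiver X ut ot S D) (vs ! i) (vs ! j)
      \<le> edge_count (coloring_quiver X ut ot T D) (vs ! i) (vs ! j)" if "i < j" "j < length vs" for i j
    unfolding edge_count_coloring_quiver[OF V[OF less_trans[OF that]]]
    by (rule card_mono) (use assms in auto)
  then show "vs \<in> clique_complex N (coloring_quiver X ut ot T D) n"
    using vs by (fastforce simp: clique_complex_def intro: order_trans)
qed

lemma clique_complex_rename:
  assumes "bij_betw \<Phi> (colorings X ut ot D) (colorings X ut ot D')"
    and eq: "\<And>f \<alpha>. f \<in> colorings X ut ot D \<Longrightarrow> \<alpha> \<in> S \<Longrightarrow>
           compose (semi_arcs D) \<alpha> f \<in> colorings X ut ot D \<and>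
           \<Phi> (compose (semi_arcs D) \<alpha> f) = compose (semi_arcs D') \<alpha> (\<Phi> f)"
  shows "clique_complex N (coloring_quiver X ut ot S D')
         = rename \<Phi> (clique_complex N (coloring_quiver X ut ot S D))"
proof (rule ext)
  fix n
  let ?C = "colorings X ut ot D" and ?C' = "colorings X ut ot D'"
  let ?Q = "coloring_quiver X ut ot S D" and ?Q' = "coloring_quiver X ut ot S D'"
  have inj: "inj_on \<Phi> ?C" and im: "\<Phi> ` ?C = ?C'"
    using assms(1) by (auto simp: bij_betw_def)
  have edges: "edge_count ?Q' (\<Phi> u) (\<Phi> v) = edge_count ?Q u v" if "u \<in> ?C" "v \<in> ?C" for u v
  proof -
    \<comment> \<open>Injectivity of \<open>\<Phi>\<close> shows that the same endomorphisms carry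
      \<open>u\<close> to \<open>v\<close> and \<open>\<Phi> u\<close> to \<open>\<Phi> v\<close>,
      so the sets of edges agree and not only their sizes.\<close>
    have "compose (semi_arcs D') \<alpha> (\<Phi> u) = \<Phi> v \<longleftrightarrow> compose (semi_arcs D) \<alpha> u = v" if "\<alpha> \<in> S" for \<alpha>
      using eq[OF \<open>u \<in> ?C\<close> that] \<open>v \<in> ?C\<close> inj by (metis inj_onD)
    then have "{\<alpha> \<in> S. compose (semi_arcs D') \<alpha> (\<Phi> u) = \<Phi> v} = {\<alpha> \<in> S. compose (semi_arcs D) \<alpha> u = v}"
      by blast
    then show ?thesis
      using that im by (subst (1 2) edge_count_coloring_quiver) auto
  qed
  have iff: "map \<Phi> vs \<in> clique_complex N ?Q' n \<longleftrightarrow> vs \<in> clique_complex N ?Q n" if "set vs \<subseteq> ?C" for vs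
  proof -
    have "\<Phi> (vs ! i) = \<Phi> (vs ! j) \<longleftrightarrow> vs ! i = vs ! j"
      "edge_count ?Q' (\<Phi> (vs ! i)) (\<Phi> (vs ! j)) = edge_count ?Q (vs ! i) (vs ! j)"
      if "i < length vs" "j < length vs" for i j
      using that \<open>set vs \<subseteq> ?C\<close> inj by (auto simp: edges inj_on_eq_iff subset_iff)
    moreover have "\<Phi> ` set vs \<subseteq> ?C'"
      using that im by blast
    ultimately show ?thesis
      using that by (auto simp: clique_complex_def)
  qed
  show "clique_complex N ?Q' n = rename \<Phi> (clique_complex N ?Q) n"
  proof
    show "rename \<Phi> (clique_complex N ?Q) n \<subseteq> clique_complex N ?Q' n"
      using iff by (fastforce simp: rename_def clique_complex_def[of _ ?Q])
    show "clique_complex N ?Q' n \<subseteq> rename \<Phi> (clique_complex N ?Q) n"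
    proof
      fix ws assume ws: "ws \<in> clique_complex N ?Q' n"
      then have "ws \<in> lists (\<Phi> ` ?C)"
        by (auto simp: clique_complex_def im)
      then obtain vs where "set vs \<subseteq> ?C" "ws = map \<Phi> vs"
        unfolding lists_image by auto
      then show "ws \<in> rename \<Phi> (clique_complex N ?Q) n"
        using ws iff by (auto simp: rename_def)
    qed
  qed
qed

theorem persistence_pair_eq:
  assumes "finite X" "End_filtration X ut ot m S" "same_colorings X ut ot D D'"
  shows "persistence_pair N X ut ot m S D = persistence_pair N X ut ot m S D'"
proof -
  let ?C = "colorings X ut ot D"
  let ?K = "\<lambda>j. clique_complex N (coloring_quiver X ut ot (S j) D)"
  let ?K' = "\<lambda>j. clique_complex N (coloring_quiver X ut ot (S j) D')"
  obtain \<Phi> where bij: "bij_betw \<Phi> ?C (colorings X ut ot D')"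
    and eq: "\<And>f \<alpha>. f \<in> ?C \<Longrightarrow> \<alpha> \<in> biquandle_End X ut ot \<Longrightarrow>
      compose (semi_arcs D) \<alpha> f \<in> ?C \<and> \<Phi> (compose (semi_arcs D) \<alpha> f) = compose (semi_arcs D') \<alpha> (\<Phi> f)"
    using assms(3) by (auto simp: same_colorings_def)
  have End: "S j \<subseteq> biquandle_End X ut ot" if "j \<le> m" for j
    using assms(2) that by (auto simp: End_filtration_def)
  have mono: "i \<le> j \<Longrightarrow> j \<le> m \<Longrightarrow> S i \<subseteq> S j" for i j
  proof (induction j rule: dec_induct)
    case (step k)
    then have "S i \<subseteq> S k" "S k \<subseteq> S (Suc k)"
      using assms(2) by (auto simp: End_filtration_def)
    then show ?case
      by blast
  qed auto
  interpret filtration_renaming ?K ?K' m \<Phi> ?C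
  proof (rule filtration_renaming.intro)
    fix j assume j: "j \<le> m"
    show "?K' j = rename \<Phi> (?K j)"
      using End[OF j] eq by (intro clique_complex_rename bij) blast
    show "renaming (?K j) \<Phi> ?C"
      using face_closed_clique_complex[of N "coloring_quiver X ut ot (S j) D"] bij
      by (auto simp: renaming_def renaming_axioms_def bij_betw_def clique_complex_def)
    show "?K i n \<subseteq> ?K j n" if "i \<le> j" for i n
      using mono[OF that j] End[OF j] finite_subset[OF _ finite_biquandle_End[OF assms(1)]]
      by (intro clique_complex_mono) auto
  qed
  show ?thesis
    unfolding persistence_pair_def Let_def
    by (intro arg_cong2[where f = Pair] ext) (simp_all add: barcode_rename stillborn_matrix_rename)
qed

section \<open>Colourings as locally constant functions of the parameters\<close>

text \<open>In \<open>(i, s, j, t, p)\<close> the over-strand is component \<open>i\<close> at time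
  \<open>s\<close> and the under-strand is component \<open>j\<close> at time \<open>t\<close>;
  \<open>p\<close> says that the under-strand runs from the right to the left of the over-strand. In
  a diagram times are not reduced modulo 1, so a crossing occurs with all integer shifts of both
  times. In a model tangle \<open>i\<close> and \<open>j\<close> number the strands.\<close>

type_synonym crossing = "nat \<times> real \<times> nat \<times> real \<times> bool"

definition passes :: "crossing set \<Rightarrow> nat \<Rightarrow> real \<Rightarrow> bool" where
  "passes R i s \<longleftrightarrow> (\<exists>j t p. (i, s, j, t, p) \<in> R \<or> (j, t, i, s, p) \<in> R)"

text \<open>The label of the semi-arc arriving at time \<open>s\<close>: a limit for the discrete
  topology on labels, since a coloring has no label at the crossing time itself.\<close>

definition left_value :: "(real \<Rightarrow> 'a) \<Rightarrow> real \<Rightarrow> 'a" where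
  "left_value h s = (THE v. \<forall>\<^sub>F t in at_left s. h t = v)"

definition right_value :: "(real \<Rightarrow> 'a) \<Rightarrow> real \<Rightarrow> 'a" where
  "right_value h s = (THE v. \<forall>\<^sub>F t in at_right s. h t = v)"

lemma left_value_eq:
  assumes "\<forall>\<^sub>F t in at_left s. h t = v"
  shows "left_value h s = v"
  unfolding left_value_def
proof (rule the_equality, rule assms)
  fix w assume "\<forall>\<^sub>F t in at_left s. h t = w"
  then have "\<forall>\<^sub>F t in at_left s. v = w"
    using assms by eventually_elim simp
  then show "w = v"
    by simp
qed

lemma right_value_eq:
  assumes "\<forall>\<^sub>F t in at_right s. h t = v"
  shows "right_value h s = v"
  unfolding right_value_def
proof (rule the_equality, rule assms)
  fix w assume "\<forall>\<^sub>F t in at_right s. h t = w"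
  then have "\<forall>\<^sub>F t in at_right s. v = w"
    using assms by eventually_elim simp
  then show "w = v"
    by simp
qed

lemma left_value_cong:
  assumes "\<forall>\<^sub>F t in at_left s. h t = h' t"
  shows "left_value h s = left_value h' s"
proof -
  have "(\<forall>\<^sub>F t in at_left s. h t = v) \<longleftrightarrow> (\<forall>\<^sub>F t in at_left s. h' t = v)" for v
    by (rule eventually_cong[OF assms]) simp
  then show ?thesis
    by (simp add: left_value_def)
qed

lemma right_value_cong:
  assumes "\<forall>\<^sub>F t in at_right s. h t = h' t"
  shows "right_value h s = right_value h' s"
proof -
  have "(\<forall>\<^sub>F t in at_right s. h t = v) \<longleftrightarrow> (\<forall>\<^sub>F t in at_right s. h' t = v)" for v
    by (rule eventually_cong[OF assms]) simp
  then show ?thesis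
    by (simp add: right_value_def)
qed

text \<open>The labels are those of the over-strand before and after the crossing, then those of the
  under-strand. The semi-arcs on the right of the other strand are \<open>ub\<close> and
  \<open>oa\<close> if \<open>p\<close> holds and \<open>ua\<close> and \<open>ob\<close> otherwise;
  in these terms both cases are the one coloring rule.\<close>

definition crossing_rule ::
  "('a \<Rightarrow> 'a \<Rightarrow> 'a) \<Rightarrow> ('a \<Rightarrow> 'a \<Rightarrow> 'a) \<Rightarrow> bool \<Rightarrow> 'a \<Rightarrow> 'a \<Rightarrow> 'a \<Rightarrow> 'a \<Rightarrow> bool" where
  "crossing_rule ut ot p ob oa ub ua \<longleftrightarrow>
     (if p then ua = ut ub oa \<and> ob = ot oa ub else ub = ut ua ob \<and> oa = ot ob ua)"

lemma crossing_rule_hom: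
  assumes "\<alpha> \<in> biquandle_End X ut ot" "ob \<in> X" "oa \<in> X" "ub \<in> X" "ua \<in> X"
    and "crossing_rule ut ot p ob oa ub ua"
  shows "crossing_rule ut ot p (\<alpha> ob) (\<alpha> oa) (\<alpha> ub) (\<alpha> ua)"
  using assms by (cases p) (simp_all add: crossing_rule_def biquandle_End_def)

text \<open>The value \<open>undefined\<close> at crossing times and at components beyond
  \<open>n\<close> normalises the functions, so that different functions are different
  colorings.\<close>

definition time_colorings ::
  "'a set \<Rightarrow> ('a \<Rightarrow> 'a \<Rightarrow> 'a) \<Rightarrow> ('a \<Rightarrow> 'a \<Rightarrow> 'a) \<Rightarrow> nat \<Rightarrow> crossing set \<Rightarrow> (nat \<Rightarrow> real \<Rightarrow> 'a) set" where
  "time_colorings X ut ot n R =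
     {g. (\<forall>i t. if i < n \<and> \<not> passes R i t then g i t \<in> X else g i t = undefined) \<and>
         (\<forall>i<n. \<forall>t. g i (t + 1) = g i t) \<and>
         (\<forall>i<n. \<forall>t. \<not> passes R i t \<longrightarrow> (\<forall>\<^sub>F u in at t. g i u = g i t)) \<and>
         (\<forall>i s j t p. (i, s, j, t, p) \<in> R \<longrightarrow>
            crossing_rule ut ot p (left_value (g i) s) (right_value (g i) s)
              (left_value (g j) t) (right_value (g j) t))}"

text \<open>Plain composition would yield \<open>\<alpha> undefined\<close> at the crossing times
  and leave the normal form of \<open>time_colorings\<close>.\<close>

definition act :: "nat \<Rightarrow> crossing set \<Rightarrow> ('a \<Rightarrow> 'a) \<Rightarrow> (nat \<Rightarrow> real \<Rightarrow> 'a) \<Rightarrow> nat \<Rightarrow> real \<Rightarrow> 'a" where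
  "act n R \<alpha> g = (\<lambda>i t. if i < n \<and> \<not> passes R i t then \<alpha> (g i t) else undefined)"

lemma time_coloring_in:
  assumes "g \<in> time_colorings X ut ot n R" "i < n" "\<not> passes R i t"
  shows "g i t \<in> X"
proof -
  have "if i < n \<and> \<not> passes R i t then g i t \<in> X else g i t = undefined"
    using assms(1) unfolding time_colorings_def by blast
  then show ?thesis
    using assms by simp
qed

lemma time_coloring_undefined:
  assumes "g \<in> time_colorings X ut ot n R" "\<not> (i < n \<and> \<not> passes R i t)"
  shows "g i t = undefined"
proof -
  have "if i < n \<and> \<not> passes R i t then g i t \<in> X else g i t = undefined"
    using assms(1) unfolding time_colorings_def by blast
  then show ?thesis
    using assms(2) by presburger
qed

lemma time_coloring_local:
  "g \<in> time_colorings X ut ot n R \<Longrightarrow> i < n \<Longrightarrow> \<not> passes R i t \<Longrightarrow> \<forall>\<^sub>F u in at t. g i u = g i t"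
  unfolding time_colorings_def by blast

lemma time_coloring_rule:
  "g \<in> time_colorings X ut ot n R \<Longrightarrow> (i, s, j, t, p) \<in> R \<Longrightarrow>
     crossing_rule ut ot p (left_value (g i) s) (right_value (g i) s)
       (left_value (g j) t) (right_value (g j) t)"
  unfolding time_colorings_def by blast

lemma periodic_int_shift:
  fixes h :: "real \<Rightarrow> 'b"
  assumes "\<And>t. h (t + 1) = h t"
  shows "h (t + of_int k) = h t"
proof -
  have nat: "h (t + of_nat n) = h t" for t n
  proof (induction n)
    case (Suc n)
    then show ?case
      using assms[of "t + of_nat n"] by (simp add: add.assoc add.commute[of 1])
  qed simp
  show ?thesis
  proof (cases "k \<ge> 0")
    case True
    then show ?thesis
      using nat[of t "nat k"] by simp
  next
    case False
    then show ?thesis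
      using nat[of "t + of_int k" "nat (- k)"] by simp
  qed
qed

lemma time_coloring_shift:
  "g \<in> time_colorings X ut ot n R \<Longrightarrow> i < n \<Longrightarrow> g i (t + of_int k) = g i t"
  by (rule periodic_int_shift) (auto simp: time_colorings_def)

lemma time_coloring_constant:
  assumes g: "g \<in> time_colorings X ut ot n R" and "i < n" "connected T"
    and "\<And>t. t \<in> T \<Longrightarrow> \<not> passes R i t" "s \<in> T" "t \<in> T"
  shows "g i s = g i t"
proof (rule connected_local_const[OF assms(3,5,6)], rule ballI)
  fix x assume "x \<in> T"
  then have "\<forall>\<^sub>F u in at x. g i u = g i x"
    using assms by (intro time_coloring_local) auto
  then have "\<forall>\<^sub>F u in at x within T. g i u = g i x"
    by (rule filter_leD[OF at_le, rotated]) simp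
  then show "\<forall>\<^sub>F u in at x within T. g i x = g i u"
    by eventually_elim simp
qed

text \<open>Isolated crossing times guarantee that colorings have one-sided values in
  \<open>X\<close>; together with periodicity this keeps the results of \<open>act\<close> among the
  colorings.\<close>

locale crossing_pattern =
  fixes n :: nat and R :: "crossing set"
  assumes components: "(i, s, j, t, p) \<in> R \<Longrightarrow> i < n \<and> j < n"
    and isolated: "i < n \<Longrightarrow> \<forall>\<^sub>F u in at t. \<not> passes R i u"
    and periodic: "i < n \<Longrightarrow> passes R i (t + 1) \<longleftrightarrow> passes R i t"
begin

lemma left_value_exists:
  assumes g: "g \<in> time_colorings X ut ot n R" and i: "i < n"
  obtains v where "v \<in> X" "\<forall>\<^sub>F u in at_left s. g i u = v \<and> \<not> passes R i u"
proof -
  have "\<forall>\<^sub>F u in at_left s. \<not> passes R i u"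
    using isolated[OF i, of s] by (simp add: eventually_at_split)
  then obtain b where b: "b < s" "\<And>u. b < u \<Longrightarrow> u < s \<Longrightarrow> \<not> passes R i u"
    by (auto simp: eventually_at_left_field)
  define c where "c = (b + s) / 2"
  have c: "b < c" "c < s"
    using b by (auto simp: c_def)
  have "g i u = g i c" if "b < u" "u < s" for u
    by (rule time_coloring_constant[OF g i, of "{b<..<s}"]) (use that b c in auto)
  then have "\<forall>\<^sub>F u in at_left s. g i u = g i c \<and> \<not> passes R i u"
    using b by (auto simp: eventually_at_left_field)
  then show thesis
    using that[of "g i c"] time_coloring_in[OF g i] b c by blast
qed

lemma right_value_exists:
  assumes g: "g \<in> time_colorings X ut ot n R" and i: "i < n"
  obtains v where "v \<in> X" "\<forall>\<^sub>F u in at_right s. g i u = v \<and> \<not> passes R i u"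
proof -
  have "\<forall>\<^sub>F u in at_right s. \<not> passes R i u"
    using isolated[OF i, of s] by (simp add: eventually_at_split)
  then obtain b where b: "b > s" "\<And>u. s < u \<Longrightarrow> u < b \<Longrightarrow> \<not> passes R i u"
    by (auto simp: eventually_at_right_field)
  define c where "c = (b + s) / 2"
  have c: "c < b" "s < c"
    using b by (auto simp: c_def)
  have "g i u = g i c" if "u < b" "s < u" for u
    by (rule time_coloring_constant[OF g i, of "{s<..<b}"]) (use that b c in auto)
  then have "\<forall>\<^sub>F u in at_right s. g i u = g i c \<and> \<not> passes R i u"
    using b by (auto simp: eventually_at_right_field)
  then show thesis
    using that[of "g i c"] time_coloring_in[OF g i] b c by blast
qed

lemma left_value_act:
  assumes g: "g \<in> time_colorings X ut ot n R" and i: "i < n"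
  shows "left_value (act n R \<alpha> g i) s = \<alpha> (left_value (g i) s) \<and> left_value (g i) s \<in> X"
proof -
  obtain v where v: "v \<in> X" "\<forall>\<^sub>F u in at_left s. g i u = v \<and> \<not> passes R i u"
    using left_value_exists[OF g i] .
  have "\<forall>\<^sub>F u in at_left s. g i u = v"
    using v(2) by eventually_elim simp
  moreover have "\<forall>\<^sub>F u in at_left s. act n R \<alpha> g i u = \<alpha> v"
    using v(2) by eventually_elim (simp add: act_def i)
  ultimately show ?thesis
    using v(1) by (simp add: left_value_eq)
qed

lemma right_value_act:
  assumes g: "g \<in> time_colorings X ut ot n R" and i: "i < n"
  shows "right_value (act n R \<alpha> g i) s = \<alpha> (right_value (g i) s) \<and> right_value (g i) s \<in> X"
proof -
  obtain v where v: "v \<in> X" "\<forall>\<^sub>F u in at_right s. g i u = v \<and> \<not> passes R i u"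
    using right_value_exists[OF g i] .
  have "\<forall>\<^sub>F u in at_right s. g i u = v"
    using v(2) by eventually_elim simp
  moreover have "\<forall>\<^sub>F u in at_right s. act n R \<alpha> g i u = \<alpha> v"
    using v(2) by eventually_elim (simp add: act_def i)
  ultimately show ?thesis
    using v(1) by (simp add: right_value_eq)
qed

lemma not_passes_near:
  assumes "i < n" "\<not> passes R i t"
  shows "\<forall>\<^sub>F u in nhds t. \<not> passes R i u"
proof -
  have "\<forall>\<^sub>F u in nhds t. u \<noteq> t \<longrightarrow> \<not> passes R i u"
    using isolated[OF assms(1), of t] by (simp add: eventually_at_filter)
  then show ?thesis
    by eventually_elim (use assms(2) in auto)
qed

lemma act_closed:
  assumes g: "g \<in> time_colorings X ut ot n R" and \<alpha>: "\<alpha> \<in> biquandle_End X ut ot"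
  shows "act n R \<alpha> g \<in> time_colorings X ut ot n R"
  unfolding time_colorings_def
proof (rule CollectI, intro conjI allI impI)
  have \<alpha>X: "\<alpha> x \<in> X" if "x \<in> X" for x
    using \<alpha> that by (auto simp: biquandle_End_def)
  show "if i < n \<and> \<not> passes R i t then act n R \<alpha> g i t \<in> X else act n R \<alpha> g i t = undefined" for i t
    using time_coloring_in[OF g] \<alpha>X by (simp add: act_def)
  show "act n R \<alpha> g i (t + 1) = act n R \<alpha> g i t" if "i < n" for i t
    using time_coloring_shift[OF g that, of t 1] that by (simp add: act_def periodic)
  show "\<forall>\<^sub>F u in at t. act n R \<alpha> g i u = act n R \<alpha> g i t" if "i < n" "\<not> passes R i t" for i t
    using time_coloring_local[OF g that] isolated[OF that(1), of t]
    by eventually_elim (simp add: act_def that)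
  show "crossing_rule ut ot p (left_value (act n R \<alpha> g i) s) (right_value (act n R \<alpha> g i) s)
         (left_value (act n R \<alpha> g j) t) (right_value (act n R \<alpha> g j) t)" if "(i, s, j, t, p) \<in> R" for i s j t p
  proof -
    have ij: "i < n" "j < n"
      using components[OF that] by auto
    show ?thesis
      using crossing_rule_hom[OF \<alpha> _ _ _ _ time_coloring_rule[OF g that]]
        left_value_act[OF g ij(1)] left_value_act[OF g ij(2)]
        right_value_act[OF g ij(1)] right_value_act[OF g ij(2)]
      by simp
  qed
qed

end

definition same_time_colorings ::
  "'a set \<Rightarrow> ('a \<Rightarrow> 'a \<Rightarrow> 'a) \<Rightarrow> ('a \<Rightarrow> 'a \<Rightarrow> 'a) \<Rightarrow> nat \<Rightarrow> crossing set \<Rightarrow> nat \<Rightarrow> crossing set \<Rightarrow> bool" where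
  "same_time_colorings X ut ot n R n' R' \<longleftrightarrow>
     (\<exists>\<Phi>. bij_betw \<Phi> (time_colorings X ut ot n R) (time_colorings X ut ot n' R') \<and>
        (\<forall>f\<in>time_colorings X ut ot n R. \<forall>\<alpha>\<in>biquandle_End X ut ot.
           \<Phi> (act n R \<alpha> f) = act n' R' \<alpha> (\<Phi> f)))"

text \<open>A move provides a correspondence of colorings rather than a formula, so
  \<open>\<Phi>\<close> is chosen from a relation that is total, onto and one-to-one. Equivariance
  then follows from uniqueness: \<open>\<Phi> (act n R \<alpha> f)\<close> and
  \<open>act n' R' \<alpha> (\<Phi> f)\<close> are both partners of
  \<open>act n R \<alpha> f\<close>.\<close>

lemma same_time_coloringsI:
  fixes X :: "'a set"
  assumes "crossing_pattern n R" "crossing_pattern n' R'"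
    and total: "\<And>f. f \<in> time_colorings X ut ot n R \<Longrightarrow> \<exists>g\<in>time_colorings X ut ot n' R'. r f g"
    and onto: "\<And>g. g \<in> time_colorings X ut ot n' R' \<Longrightarrow> \<exists>f\<in>time_colorings X ut ot n R. r f g"
    and unique: "\<And>f g g'. f \<in> time_colorings X ut ot n R \<Longrightarrow> g \<in> time_colorings X ut ot n' R' \<Longrightarrow>
        g' \<in> time_colorings X ut ot n' R' \<Longrightarrow> r f g \<Longrightarrow> r f g' \<Longrightarrow> g = g'"
    and inj: "\<And>f f' g. f \<in> time_colorings X ut ot n R \<Longrightarrow> f' \<in> time_colorings X ut ot n R \<Longrightarrow>
        g \<in> time_colorings X ut ot n' R' \<Longrightarrow> r f g \<Longrightarrow> r f' g \<Longrightarrow> f = f'"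
    and act: "\<And>f g \<alpha>. f \<in> time_colorings X ut ot n R \<Longrightarrow> g \<in> time_colorings X ut ot n' R' \<Longrightarrow>
        r f g \<Longrightarrow> r (act n R \<alpha> f) (act n' R' \<alpha> g)"
  shows "same_time_colorings X ut ot n R n' R'"
proof -
  let ?C = "time_colorings X ut ot n R" and ?C' = "time_colorings X ut ot n' R'"
  interpret R: crossing_pattern n R by fact
  interpret R': crossing_pattern n' R' by fact
  define \<Phi> where "\<Phi> f = (SOME g. g \<in> ?C' \<and> r f g)" for f
  have \<Phi>: "\<Phi> f \<in> ?C'" "r f (\<Phi> f)" if "f \<in> ?C" for f
    using someI_ex[of "\<lambda>g. g \<in> ?C' \<and> r f g"] total[OF that] by (auto simp: \<Phi>_def)
  have "bij_betw \<Phi> ?C ?C'"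
    unfolding bij_betw_def
  proof
    show "inj_on \<Phi> ?C"
      using \<Phi> inj by (intro inj_onI) metis
    show "\<Phi> ` ?C = ?C'"
    proof
      show "?C' \<subseteq> \<Phi> ` ?C"
      proof
        fix g assume g: "g \<in> ?C'"
        then obtain f where f: "f \<in> ?C" "r f g"
          using onto by blast
        then have "\<Phi> f = g"
          using unique \<Phi> g by blast
        then show "g \<in> \<Phi> ` ?C"
          using f by blast
      qed
    qed (use \<Phi> in auto)
  qed
  moreover have "\<Phi> (act n R \<alpha> f) = act n' R' \<alpha> (\<Phi> f)"
    if f: "f \<in> ?C" and \<alpha>: "\<alpha> \<in> biquandle_End X ut ot" for f \<alpha>
    by (rule unique[of "act n R \<alpha> f"]) (intro \<Phi> act R.act_closed R'.act_closed f \<alpha>)+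
  ultimately show ?thesis
    by (auto simp: same_time_colorings_def)
qed

section \<open>Semi-arcs of a diagram and the times that they contain\<close>

definition classical_crossings :: "vdiagram \<Rightarrow> crossing set" where
  "classical_crossings D =
     {(i, s, j, t, p). crosses D i s j t \<and> s \<in> over D i \<and>
        (p \<longleftrightarrow> det2 (velocity D i s) (velocity D j t) > 0)}"

lemma Ints_diff_commute: "x - y \<in> \<int> \<longleftrightarrow> y - (x :: real) \<in> \<int>"
  by (metis minus_diff_eq minus_in_Ints_iff)

lemma crosses_sym: "crosses D i s j t \<longleftrightarrow> crosses D j t i s"
  using Ints_diff_commute[of s t] by (auto simp: crosses_def)

lemma passes_classical_crossings: "passes (classical_crossings D) i s \<longleftrightarrow> classical_pass D i s"
  by (auto simp: passes_def classical_crossings_def classical_pass_def crosses_sym)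

context
  fixes D assumes D: "link_diagram D"
begin

lemma curve_shift: "i < ncomp D \<Longrightarrow> curve D i (t + of_int k) = curve D i t"
  using D by (intro periodic_int_shift) (auto simp: link_diagram_def)

lemma over_shift: "i < ncomp D \<Longrightarrow> t + of_int k \<in> over D i \<longleftrightarrow> t \<in> over D i"
  using D periodic_int_shift[of "\<lambda>t. t \<in> over D i" t k] by (auto simp: link_diagram_def)

lemma curve_has_velocity:
  "i < ncomp D \<Longrightarrow> (curve D i has_vector_derivative velocity D i t) (at t)"
  using D by (auto simp: link_diagram_def velocity_def vector_derivative_works[symmetric])

lemma velocity_eqI:
  "(curve D i has_vector_derivative v) (at t) \<Longrightarrow> velocity D i t = v"
  unfolding velocity_def by (rule vector_derivative_at)

lemma crosses_shift:
  "crosses D i (s + of_int k) j t \<longleftrightarrow> crosses D i s j t"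
proof -
  have "s + of_int k - t \<in> \<int> \<longleftrightarrow> s - t \<in> \<int>"
  proof -
    have "s + of_int k - t = of_int k + (s - t)"
      by simp
    then show ?thesis
      by (simp only: add_in_Ints_iff_left Ints_of_int)
  qed
  then show ?thesis
    using curve_shift[of i s k] by (auto simp: crosses_def)
qed

lemma classical_pass_shift: "classical_pass D i (s + of_int k) \<longleftrightarrow> classical_pass D i s"
proof -
  have "crosses D i s j t \<Longrightarrow> s + of_int k \<in> over D i \<longleftrightarrow> s \<in> over D i" for j t
    by (rule over_shift) (simp add: crosses_def)
  then show ?thesis
    unfolding classical_pass_def crosses_shift by blast
qed

lemma finite_Ints_translate: "finite {x::real. x - c \<in> \<int> \<and> a \<le> x \<and> x \<le> b}"
proof (rule finite_subset)
  show "{x. x - c \<in> \<int> \<and> a \<le> x \<and> x \<le> b} \<subseteq> (\<lambda>k. of_int k + c) ` {\<lfloor>a - c\<rfloor>..\<lceil>b - c\<rceil>}"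
  proof
    fix x assume "x \<in> {x. x - c \<in> \<int> \<and> a \<le> x \<and> x \<le> b}"
    then obtain k where "x - c = of_int k" "a \<le> x" "x \<le> b"
      by (auto elim: Ints_cases)
    then have "x = of_int k + c" "\<lfloor>a - c\<rfloor> \<le> k" "k \<le> \<lceil>b - c\<rceil>"
      by (simp_all add: floor_le_iff le_ceiling_iff)
    then show "x \<in> (\<lambda>k. of_int k + c) ` {\<lfloor>a - c\<rfloor>..\<lceil>b - c\<rceil>}"
      by auto
  qed
qed simp

text \<open>There are finitely many double points and each has two preimages modulo 1, so a bounded
  interval contains finitely many of their times.\<close>

lemma finite_double_times: "finite {s. a \<le> s \<and> s \<le> b \<and> (\<exists>j t. crosses D i s j t)}"
proof -
  have fibre: "finite {s. a \<le> s \<and> s \<le> b \<and> (\<exists>j t. crosses D i s j t) \<and> curve D i s = z}" (is "finite ?F") for z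
  proof (cases "?F = {}")
    case False
    then obtain s0 j t0 where s0: "crosses D i s0 j t0" "curve D i s0 = z"
      by blast
    have "?F \<subseteq> {x. x - s0 \<in> \<int> \<and> a \<le> x \<and> x \<le> b} \<union> {x. x - t0 \<in> \<int> \<and> a \<le> x \<and> x \<le> b}"
    proof
      fix s assume s: "s \<in> ?F"
      \<comment> \<open>Absence of triple points: \<open>t0\<close> and \<open>s\<close> would both
        be second preimages of the point at \<open>s0\<close>, so they agree modulo 1.\<close>
      have "t0 - s \<in> \<int>" if "s - s0 \<notin> \<int>"
      proof -
        have "crosses D i s0 i s"
          using s s0 that Ints_diff_commute[of s s0] unfolding crosses_def by simp
        then show ?thesis
          using D s0 by (auto simp: link_diagram_def)
      qed
      then have "s - s0 \<in> \<int> \<or> s - t0 \<in> \<int>"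
        using Ints_diff_commute[of s t0] by blast
      then show "s \<in> {x. x - s0 \<in> \<int> \<and> a \<le> x \<and> x \<le> b} \<union> {x. x - t0 \<in> \<int> \<and> a \<le> x \<and> x \<le> b}"
        using s by blast
    qed
    then show ?thesis
      by (rule finite_subset) (simp add: finite_Ints_translate)
  next
    case True
    then show ?thesis
      by (simp only: finite.emptyI)
  qed
  have "finite {curve D i s | i s j t. crosses D i s j t}"
    using D by (simp add: link_diagram_def)
  with fibre have "finite (\<Union>z\<in>{curve D i s | i s j t. crosses D i s j t}. {s. a \<le> s \<and> s \<le> b \<and> (\<exists>j t. crosses D i s j t) \<and> curve D i s = z})"
    by blast
  then show ?thesis
    by (rule rev_finite_subset) blast
qed

lemma isolated_classical_pass: "\<forall>\<^sub>F u in at t. \<not> classical_pass D i u"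
proof -
  let ?F = "{s. t - 1 \<le> s \<and> s \<le> t + 1 \<and> (\<exists>j u. crosses D i s j u)}"
  have "\<not> t islimpt ?F"
    by (rule islimpt_finite[OF finite_double_times])
  then have "\<forall>\<^sub>F u in at t. u \<notin> ?F"
    by (simp add: islimpt_iff_eventually)
  moreover have "\<forall>\<^sub>F u in at t. u \<in> {t - 1<..<t + 1}"
    by (intro eventually_at_in_open') auto
  ultimately show ?thesis
    by eventually_elim (auto simp: classical_pass_def)
qed

lemma crossing_pattern_diagram: "crossing_pattern (ncomp D) (classical_crossings D)"
proof
  show "i < ncomp D \<and> j < ncomp D" if "(i, s, j, t, p) \<in> classical_crossings D" for i s j t p
    using that by (auto simp: classical_crossings_def crosses_def)
  show "passes (classical_crossings D) i (t + 1) = passes (classical_crossings D) i t" for i t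
    using classical_pass_shift[of i t 1] by (simp add: passes_classical_crossings)
qed (simp add: passes_classical_crossings isolated_classical_pass)

lemma semi_arc_refl: "\<not> classical_pass D i s \<Longrightarrow> (i, s) \<in> semi_arc D i s"
  by (auto simp: semi_arc_def intro!: exI[of _ 0])

lemma semi_arc_sym:
  assumes "(j, t) \<in> semi_arc D i s"
  shows "j = i \<and> (i, s) \<in> semi_arc D i t"
proof -
  obtain n :: int where n: "\<forall>u\<in>closed_segment s (t + of_int n). \<not> classical_pass D i u" and "j = i"
    using assms by (auto simp: semi_arc_def)
  have "\<not> classical_pass D i u" if "u \<in> closed_segment t (s + of_int (- n))" for u
  proof -
    have "u + of_int n \<in> closed_segment s (t + of_int n)"
      using that by (auto simp: closed_segment_eq_real_ivl split: if_splits)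
    then show ?thesis
      using n classical_pass_shift by blast
  qed
  then show ?thesis
    using \<open>j = i\<close> by (auto simp: semi_arc_def intro!: exI[of _ "- n"])
qed

lemma semi_arc_trans:
  assumes "(i, t) \<in> semi_arc D i s" "(i, r) \<in> semi_arc D i t"
  shows "(i, r) \<in> semi_arc D i s"
proof -
  obtain n :: int where n: "\<forall>u\<in>closed_segment s (t + of_int n). \<not> classical_pass D i u"
    using assms(1) by (auto simp: semi_arc_def)
  obtain k :: int where k: "\<forall>u\<in>closed_segment t (r + of_int k). \<not> classical_pass D i u"
    using assms(2) by (auto simp: semi_arc_def)
  have "\<not> classical_pass D i u" if "u \<in> closed_segment s (r + of_int (n + k))" for u
  proof -
    have "u \<in> closed_segment s (t + of_int n) \<or> u + of_int (- n) \<in> closed_segment t (r + of_int k)"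
      using that by (auto simp: closed_segment_eq_real_ivl split: if_splits)
    then show ?thesis
      using n k classical_pass_shift by blast
  qed
  then show ?thesis
    by (auto simp: semi_arc_def intro!: exI[of _ "n + k"])
qed

text \<open>Symmetry and transitivity, which hold up to integer shifts of the times, make semi-arcs
  the classes of an equivalence relation.\<close>

lemma semi_arc_eqI:
  assumes "(j, t) \<in> semi_arc D i s"
  shows "semi_arc D j t = semi_arc D i s"
proof -
  have *: "semi_arc D i t' \<subseteq> semi_arc D i s'" if "(i, t') \<in> semi_arc D i s'" for s' t'
  proof
    fix x assume x: "x \<in> semi_arc D i t'"
    then obtain r where "x = (i, r)"
      by (auto simp: semi_arc_def)
    then show "x \<in> semi_arc D i s'"
      using x semi_arc_trans[OF that] by simp
  qed
  have "j = i" "(i, s) \<in> semi_arc D i t"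
    using semi_arc_sym[OF assms] by auto
  then show ?thesis
    using *[of s t] *[of t s] assms by blast
qed

text \<open>Shortly before \<open>s\<close> there is no classical crossing, so these times all lie
  on one semi-arc; as different semi-arcs are disjoint, no other one fits the definite
  description.\<close>

lemma arc_before_eq:
  assumes "i < ncomp D" shows "\<forall>\<^sub>F t in at_left s. arc_before D i s = semi_arc D i t \<and> \<not> classical_pass D i t"
proof -
  have "\<forall>\<^sub>F u in at_left s. \<not> classical_pass D i u"
    using isolated_classical_pass[of i s] by (simp add: eventually_at_split)
  then obtain b where b: "b < s" "\<And>u. b < u \<Longrightarrow> u < s \<Longrightarrow> \<not> classical_pass D i u"
    by (auto simp: eventually_at_left_field)
  have near: "(i, u) \<in> semi_arc D i t" if "b < u" "u < s" "b < t" "t < s" for t u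
  proof -
    have "\<forall>v\<in>closed_segment t u. \<not> classical_pass D i v"
      using that b by (auto simp: closed_segment_eq_real_ivl split: if_splits)
    then show ?thesis
      by (auto simp: semi_arc_def intro!: exI[of _ 0])
  qed
  have "arc_before D i s = semi_arc D i t" if t: "b < t" "t < s" for t
    unfolding arc_before_def
  proof (rule the_equality)
    show "semi_arc D i t \<in> semi_arcs D \<and> (\<forall>\<^sub>F u in at_left s. (i, u) \<in> semi_arc D i t)"
      using t b assms near by (auto simp: semi_arcs_def eventually_at_left_field)
    fix a assume a: "a \<in> semi_arcs D \<and> (\<forall>\<^sub>F u in at_left s. (i, u) \<in> a)"
    have "\<forall>\<^sub>F u in at_left s. b < u \<and> u < s"
      using b by (auto simp: eventually_at_left_field)
    then have "\<forall>\<^sub>F u in at_left s. (b < u \<and> u < s) \<and> (i, u) \<in> a"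
      using a by (auto elim: eventually_elim2)
    then obtain u where u: "b < u" "u < s" "(i, u) \<in> a"
      using eventually_happens[of _ "at_left s"] by auto
    obtain j r where "a = semi_arc D j r"
      using a by (auto simp: semi_arcs_def)
    then have "a = semi_arc D i u"
      using u semi_arc_eqI by blast
    then show "a = semi_arc D i t"
      using near[OF u(1,2) t] semi_arc_eqI by blast
  qed
  then show ?thesis
    using b by (auto simp: eventually_at_left_field)
qed

lemma arc_after_eq:
  assumes "i < ncomp D" shows "\<forall>\<^sub>F t in at_right s. arc_after D i s = semi_arc D i t \<and> \<not> classical_pass D i t"
proof -
  have "\<forall>\<^sub>F u in at_right s. \<not> classical_pass D i u"
    using isolated_classical_pass[of i s] by (simp add: eventually_at_split)
  then obtain b where b: "b > s" "\<And>u. s < u \<Longrightarrow> u < b \<Longrightarrow> \<not> classical_pass D i u"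
    by (auto simp: eventually_at_right_field)
  have near: "(i, u) \<in> semi_arc D i t" if "u < b" "s < u" "t < b" "s < t" for t u
  proof -
    have "\<forall>v\<in>closed_segment t u. \<not> classical_pass D i v"
      using that b by (auto simp: closed_segment_eq_real_ivl split: if_splits)
    then show ?thesis
      by (auto simp: semi_arc_def intro!: exI[of _ 0])
  qed
  have "arc_after D i s = semi_arc D i t" if t: "t < b" "s < t" for t
    unfolding arc_after_def
  proof (rule the_equality)
    show "semi_arc D i t \<in> semi_arcs D \<and> (\<forall>\<^sub>F u in at_right s. (i, u) \<in> semi_arc D i t)"
      using t b assms near by (auto simp: semi_arcs_def eventually_at_right_field)
    fix a assume a: "a \<in> semi_arcs D \<and> (\<forall>\<^sub>F u in at_right s. (i, u) \<in> a)"
    have "\<forall>\<^sub>F u in at_right s. s < u \<and> u < b"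
      using b by (auto simp: eventually_at_right_field)
    then have "\<forall>\<^sub>F u in at_right s. (s < u \<and> u < b) \<and> (i, u) \<in> a"
      using a by (auto elim: eventually_elim2)
    then obtain u where u: "s < u" "u < b" "(i, u) \<in> a"
      using eventually_happens[of _ "at_right s"] by auto
    obtain j r where "a = semi_arc D j r"
      using a by (auto simp: semi_arcs_def)
    then have "a = semi_arc D i u"
      using u semi_arc_eqI by blast
    then show "a = semi_arc D i t"
      using near[OF u(2,1) t] semi_arc_eqI by blast
  qed
  then show ?thesis
    using b by (auto simp: eventually_at_right_field)
qed

definition unroll :: "((nat \<times> real) set \<Rightarrow> 'a) \<Rightarrow> nat \<Rightarrow> real \<Rightarrow> 'a" where
  "unroll f = (\<lambda>i t. if i < ncomp D \<and> \<not> classical_pass D i t then f (semi_arc D i t) else undefined)"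

lemma left_value_unroll:
  assumes "i < ncomp D" shows "left_value (unroll f i) s = f (arc_before D i s)"
proof (rule left_value_eq)
  show "\<forall>\<^sub>F t in at_left s. unroll f i t = f (arc_before D i s)"
    using arc_before_eq[OF assms, of s] by eventually_elim (simp add: unroll_def assms)
qed

lemma right_value_unroll:
  assumes "i < ncomp D" shows "right_value (unroll f i) s = f (arc_after D i s)"
proof (rule right_value_eq)
  show "\<forall>\<^sub>F t in at_right s. unroll f i t = f (arc_after D i s)"
    using arc_after_eq[OF assms, of s] by eventually_elim (simp add: unroll_def assms)
qed

end

lemma det2_commute: "det2 v u = - det2 u v"
  by (simp add: det2_def)

text \<open>A strand starts on the right of the other one exactly if it crosses towards the left. By
  antisymmetry of \<open>det2\<close> this is true of just one of the two strands, so a single sign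
  translates right and left into before and after.\<close>

lemma coloring_rule_iff:
  assumes D: "link_diagram D" and cr: "crosses D i s j t"
  shows "(let x = f (arc_right D (velocity D i s) j t); y = f (arc_right D (velocity D j t) i s)
           in f (arc_left D (velocity D i s) j t) = ut x y \<and>
              f (arc_left D (velocity D j t) i s) = ot y x) \<longleftrightarrow>
    crossing_rule ut ot (det2 (velocity D i s) (velocity D j t) > 0)
      (f (arc_before D i s)) (f (arc_after D i s)) (f (arc_before D j t)) (f (arc_after D j t))"
proof -
  have "det2 (velocity D i s) (velocity D j t) \<noteq> 0"
    using D cr by (auto simp: link_diagram_def)
  then show ?thesis
    by (cases "det2 (velocity D i s) (velocity D j t) > 0")
      (auto simp: arc_right_def arc_left_def crossing_rule_def Let_def det2_commute[of "velocity D j t"])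
qed

context
  fixes D assumes D: "link_diagram D"
begin

lemma unroll_closed:
  assumes f: "f \<in> colorings X ut ot D"
  shows "unroll D f \<in> time_colorings X ut ot (ncomp D) (classical_crossings D)"
  unfolding time_colorings_def passes_classical_crossings
proof (rule CollectI, intro conjI allI impI)
  have in_arcs: "semi_arc D i t \<in> semi_arcs D" if "i < ncomp D" "\<not> classical_pass D i t" for i t
    using that by (auto simp: semi_arcs_def)
  have fX: "f \<in> semi_arcs D \<rightarrow>\<^sub>E X"
    using f by (simp add: colorings_def)
  show "if i < ncomp D \<and> \<not> classical_pass D i t then unroll D f i t \<in> X else unroll D f i t = undefined" for i t
  proof (cases "i < ncomp D \<and> \<not> classical_pass D i t")
    case True
    then show ?thesis
      using in_arcs PiE_mem[OF fX] by (simp add: unroll_def[OF D])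
  next
    case False
    then show ?thesis
      unfolding unroll_def[OF D] by presburger
  qed
  have arc_eq: "semi_arc D i u = semi_arc D i t" if "\<forall>v\<in>closed_segment t u. \<not> classical_pass D i v" for i t u
    using that by (intro semi_arc_eqI[OF D]) (auto simp: semi_arc_def intro!: exI[of _ 0])
  show "unroll D f i (t + 1) = unroll D f i t" if "i < ncomp D" for i t
  proof -
    have cp: "classical_pass D i (t + 1) \<longleftrightarrow> classical_pass D i t"
      using classical_pass_shift[OF D, of i t 1] by simp
    have "semi_arc D i (t + 1) = semi_arc D i t" if "\<not> classical_pass D i t"
    proof (rule semi_arc_eqI[OF D])
      show "(i, t + 1) \<in> semi_arc D i t"
        using that by (auto simp: semi_arc_def intro!: exI[of _ "-1"])
    qed
    then show ?thesis
      using cp by (simp add: unroll_def[OF D])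
  qed
  show "\<forall>\<^sub>F u in at t. unroll D f i u = unroll D f i t"
    if "i < ncomp D" "\<not> classical_pass D i t" for i t
  proof -
    have "\<forall>\<^sub>F u in nhds t. \<not> classical_pass D i u"
      using crossing_pattern.not_passes_near[OF crossing_pattern_diagram[OF D], of i t] that
      by (simp add: passes_classical_crossings)
    then obtain e where e: "e > 0" "\<And>u. dist u t < e \<Longrightarrow> \<not> classical_pass D i u"
      unfolding eventually_nhds_metric by blast
    have "unroll D f i u = unroll D f i t" if u: "dist u t < e" for u
    proof -
      have "\<forall>v\<in>closed_segment t u. \<not> classical_pass D i v"
        using u e by (auto simp: closed_segment_eq_real_ivl dist_real_def split: if_splits)
      then show ?thesis
        using arc_eq[of t u i] that e(2)[OF u] by (simp add: unroll_def[OF D])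
    qed
    then show ?thesis
      unfolding eventually_at using e(1) by blast
  qed
  show "crossing_rule ut ot p (left_value (unroll D f i) s) (right_value (unroll D f i) s)
         (left_value (unroll D f j) t) (right_value (unroll D f j) t)"
    if "(i, s, j, t, p) \<in> classical_crossings D" for i s j t p
  proof -
    have cr: "crosses D i s j t" "s \<in> over D i" "p \<longleftrightarrow> det2 (velocity D i s) (velocity D j t) > 0"
      using that by (auto simp: classical_crossings_def)
    have ij: "i < ncomp D" "j < ncomp D"
      using cr by (auto simp: crosses_def)
    have "crossing_rule ut ot (det2 (velocity D i s) (velocity D j t) > 0)
      (f (arc_before D i s)) (f (arc_after D i s)) (f (arc_before D j t)) (f (arc_after D j t))"
      unfolding coloring_rule_iff[OF D cr(1), symmetric] using f cr by (simp add: colorings_def)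
    then show ?thesis
      unfolding cr(3) by (simp add: left_value_unroll[OF D] right_value_unroll[OF D] ij)
  qed
qed

lemma unroll_inj:
  assumes "f \<in> semi_arcs D \<rightarrow>\<^sub>E X" "g \<in> semi_arcs D \<rightarrow>\<^sub>E X" "unroll D f = unroll D g"
  shows "f = g"
proof (rule PiE_ext[OF assms(1,2)])
  fix a assume "a \<in> semi_arcs D"
  then obtain i s where "a = semi_arc D i s" "i < ncomp D" "\<not> classical_pass D i s"
    by (auto simp: semi_arcs_def)
  then show "f a = g a"
    using fun_cong[OF fun_cong[OF assms(3)], of i s] by (simp add: unroll_def[OF D])
qed

lemma unroll_onto:
  assumes g: "g \<in> time_colorings X ut ot (ncomp D) (classical_crossings D)"
  obtains f where "f \<in> colorings X ut ot D" "unroll D f = g"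
proof -
  \<comment> \<open>Any parameter on the semi-arc may be chosen: two of them are joined, up to an
    integer shift, by a segment without crossings, on which \<open>g\<close> is constant, and
    \<open>g\<close> has period 1.\<close>
  define f where "f = (\<lambda>a\<in>semi_arcs D. let (i, s) = (SOME (i, s). a = semi_arc D i s \<and> i < ncomp D \<and> \<not> classical_pass D i s)
     in g i s)"
  have f: "f (semi_arc D i s) = g i s" if "i < ncomp D" "\<not> classical_pass D i s" for i s
  proof -
    let ?P = "\<lambda>(j, t). semi_arc D i s = semi_arc D j t \<and> j < ncomp D \<and> \<not> classical_pass D j t"
    obtain j t where jt: "(SOME jt. ?P jt) = (j, t)"
      by fastforce
    have "?P (SOME jt. ?P jt)"
      by (rule someI[of ?P "(i, s)"]) (use that in auto)
    then have P: "semi_arc D i s = semi_arc D j t" "j < ncomp D" "\<not> classical_pass D j t"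
      by (auto simp: jt)
    have "(i, s) \<in> semi_arc D j t"
      using semi_arc_refl[OF D that(2)] P(1) by simp
    then obtain k :: int where "i = j" and k: "\<forall>u\<in>closed_segment t (s + of_int k). \<not> classical_pass D j u"
      by (auto simp: semi_arc_def)
    then have "g i s = g j t"
      using time_coloring_constant[OF g P(2), of "closed_segment t (s + of_int k)" t "s + of_int k"]
        time_coloring_shift[OF g P(2), of s k]
      by (simp add: passes_classical_crossings)
    then show ?thesis
      using that jt by (auto simp: f_def semi_arcs_def)
  qed
  have eq: "unroll D f = g"
  proof (intro ext)
    fix i t
    show "unroll D f i t = g i t"
    proof (cases "i < ncomp D \<and> \<not> classical_pass D i t")
      case True
      then show ?thesis
        by (simp add: unroll_def[OF D] f)
    next
      case False
      then have "unroll D f i t = undefined"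
        unfolding unroll_def[OF D] by presburger
      moreover have "g i t = undefined"
        by (rule time_coloring_undefined[OF g]) (use False in \<open>simp add: passes_classical_crossings\<close>)
      ultimately show ?thesis
        by simp
    qed
  qed
  have "f \<in> semi_arcs D \<rightarrow>\<^sub>E X"
  proof (rule PiE_I)
    fix a assume "a \<in> semi_arcs D"
    then obtain i s where "a = semi_arc D i s" "i < ncomp D" "\<not> classical_pass D i s"
      by (auto simp: semi_arcs_def)
    then show "f a \<in> X"
      using time_coloring_in[OF g] by (simp add: f passes_classical_crossings)
  qed (simp add: f_def)
  moreover have "(let x = f (arc_right D (velocity D i s) j t); y = f (arc_right D (velocity D j t) i s)
           in f (arc_left D (velocity D i s) j t) = ut x y \<and>
              f (arc_left D (velocity D j t) i s) = ot y x)"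
    if cr: "crosses D i s j t" "s \<in> over D i" for i s j t
  proof -
    have ij: "i < ncomp D" "j < ncomp D"
      using cr by (auto simp: crosses_def)
    have "(i, s, j, t, det2 (velocity D i s) (velocity D j t) > 0) \<in> classical_crossings D"
      using cr by (simp add: classical_crossings_def)
    from time_coloring_rule[OF g this] show ?thesis
      unfolding coloring_rule_iff[OF D cr(1)] eq[symmetric]
      by (simp add: left_value_unroll[OF D] right_value_unroll[OF D] ij)
  qed
  ultimately have "f \<in> colorings X ut ot D"
    by (auto simp: colorings_def)
  then show thesis
    using that eq by blast
qed

lemma bij_unroll:
  "bij_betw (unroll D) (colorings X ut ot D) (time_colorings X ut ot (ncomp D) (classical_crossings D))"
  unfolding bij_betw_def
proof
  show "inj_on (unroll D) (colorings X ut ot D)"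
    by (rule inj_onI) (rule unroll_inj, auto simp: colorings_def)
  show "unroll D ` colorings X ut ot D = time_colorings X ut ot (ncomp D) (classical_crossings D)"
  proof
    show "time_colorings X ut ot (ncomp D) (classical_crossings D) \<subseteq> unroll D ` colorings X ut ot D"
    proof
      fix g assume "g \<in> time_colorings X ut ot (ncomp D) (classical_crossings D)"
      then obtain f where "f \<in> colorings X ut ot D" "unroll D f = g"
        by (rule unroll_onto)
      then show "g \<in> unroll D ` colorings X ut ot D"
        by blast
    qed
  qed (use unroll_closed in blast)
qed

lemma unroll_compose:
  "unroll D (compose (semi_arcs D) \<alpha> f) = act (ncomp D) (classical_crossings D) \<alpha> (unroll D f)"
  by (auto simp: unroll_def[OF D] act_def fun_eq_iff passes_classical_crossings compose_def semi_arcs_def)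

text \<open>Closure is known for functions of time, so the composite is identified with the coloring
  that unrolls to the same function.\<close>

lemma compose_closed:
  assumes f: "f \<in> colorings X ut ot D" and \<alpha>: "\<alpha> \<in> biquandle_End X ut ot"
  shows "compose (semi_arcs D) \<alpha> f \<in> colorings X ut ot D"
proof -
  have "unroll D (compose (semi_arcs D) \<alpha> f) \<in> time_colorings X ut ot (ncomp D) (classical_crossings D)"
    unfolding unroll_compose
    by (intro crossing_pattern.act_closed crossing_pattern_diagram[OF D] unroll_closed f \<alpha>)
  then obtain h where h: "h \<in> colorings X ut ot D" "unroll D h = unroll D (compose (semi_arcs D) \<alpha> f)"
    using unroll_onto by metis
  have "compose (semi_arcs D) \<alpha> f \<in> semi_arcs D \<rightarrow>\<^sub>E X"
    using f \<alpha> by (fastforce simp: colorings_def compose_def biquandle_End_def)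
  then have "h = compose (semi_arcs D) \<alpha> f"
    using h by (intro unroll_inj[of _ X]) (auto simp: colorings_def)
  then show ?thesis
    using h by simp
qed

end

lemma same_coloringsI:
  assumes D: "link_diagram D" "link_diagram D'"
    and "same_time_colorings X ut ot (ncomp D) (classical_crossings D) (ncomp D') (classical_crossings D')"
  shows "same_colorings X ut ot D D'"
proof -
  let ?T = "time_colorings X ut ot (ncomp D) (classical_crossings D)"
  let ?T' = "time_colorings X ut ot (ncomp D') (classical_crossings D')"
  let ?C' = "colorings X ut ot D'"
  obtain \<Phi> where \<Phi>: "bij_betw \<Phi> ?T ?T'"
    "\<And>f \<alpha>. f \<in> ?T \<Longrightarrow> \<alpha> \<in> biquandle_End X ut ot \<Longrightarrow>
       \<Phi> (act (ncomp D) (classical_crossings D) \<alpha> f) = act (ncomp D') (classical_crossings D') \<alpha> (\<Phi> f)"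
    using assms(3) by (auto simp: same_time_colorings_def)
  define \<Psi> where "\<Psi> = inv_into ?C' (unroll D') \<circ> (\<Phi> \<circ> unroll D)"
  have "bij_betw \<Psi> (colorings X ut ot D) ?C'"
    unfolding \<Psi>_def
    by (rule bij_betw_trans[OF bij_betw_trans[OF bij_unroll[OF D(1)] \<Phi>(1)]
          bij_betw_inv_into[OF bij_unroll[OF D(2)]]])
  moreover have "\<Psi> (compose (semi_arcs D) \<alpha> f) = compose (semi_arcs D') \<alpha> (\<Psi> f)"
    if f: "f \<in> colorings X ut ot D" and \<alpha>: "\<alpha> \<in> biquandle_End X ut ot" for f \<alpha>
  proof -
    have u: "unroll D f \<in> ?T"
      by (rule unroll_closed[OF D(1) f])
    have "\<Phi> (unroll D f) \<in> unroll D' ` ?C'"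
      using \<Phi>(1) u bij_unroll[OF D(2), of X ut ot] by (auto simp: bij_betw_def)
    then have \<Psi>f: "\<Psi> f \<in> ?C'" "unroll D' (\<Psi> f) = \<Phi> (unroll D f)"
      by (auto simp: \<Psi>_def inv_into_into f_inv_into_f)
    have "\<Phi> (unroll D (compose (semi_arcs D) \<alpha> f)) = unroll D' (compose (semi_arcs D') \<alpha> (\<Psi> f))"
      by (simp add: unroll_compose D \<Phi>(2)[OF u \<alpha>] \<Psi>f)
    then show ?thesis
      using compose_closed[OF D(2) \<Psi>f(1) \<alpha>] bij_unroll[OF D(2), of X ut ot]
      by (simp add: \<Psi>_def bij_betw_def inv_into_f_f)
  qed
  ultimately show ?thesis
    using compose_closed[OF D(1)] unfolding same_colorings_def by blast
qed

text \<open>Curves influence colorings only through the number of components and the crossing set,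
  so the identity on functions of time is the bijection.\<close>

lemma same_colorings_if_same_crossings:
  assumes "link_diagram D" "link_diagram D'" "ncomp D' = ncomp D"
    and "classical_crossings D' = classical_crossings D"
  shows "same_colorings X ut ot D D'"
  by (rule same_coloringsI[OF assms(1,2)]) (auto simp: assms(3,4) same_time_colorings_def intro!: exI[of _ id])

section \<open>Transport of one-sided values along increasing bijections of the line, and change of
  parameters\<close>

lemma eventually_at_left_strict_mono:
  fixes h :: "real \<Rightarrow> real"
  assumes "strict_mono h" "surj h"
  shows "(\<forall>\<^sub>F u in at_left (h t). P u) \<longleftrightarrow> (\<forall>\<^sub>F u in at_left t. P (h u))"
proof
  assume "\<forall>\<^sub>F u in at_left (h t). P u"
  then obtain b where b: "b < h t" "\<And>u. b < u \<Longrightarrow> u < h t \<Longrightarrow> P u"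
    by (auto simp: eventually_at_left_field)
  obtain c where "b = h c"
    using assms(2) by blast
  then show "\<forall>\<^sub>F u in at_left t. P (h u)"
    using b strict_mono_less[OF assms(1)] by (auto simp: eventually_at_left_field)
next
  assume "\<forall>\<^sub>F u in at_left t. P (h u)"
  then obtain c where c: "c < t" "\<And>u. c < u \<Longrightarrow> u < t \<Longrightarrow> P (h u)"
    by (auto simp: eventually_at_left_field)
  have "P v" if v: "h c < v" "v < h t" for v
  proof -
    obtain u where "v = h u"
      using assms(2) by blast
    then show ?thesis
      using c(2)[of u] v strict_mono_less[OF assms(1)] by simp
  qed
  then show "\<forall>\<^sub>F u in at_left (h t). P u"
    using c(1) strict_mono_less[OF assms(1)] by (auto simp: eventually_at_left_field)
qed

lemma eventually_at_right_strict_mono: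
  fixes h :: "real \<Rightarrow> real"
  assumes "strict_mono h" "surj h"
  shows "(\<forall>\<^sub>F u in at_right (h t). P u) \<longleftrightarrow> (\<forall>\<^sub>F u in at_right t. P (h u))"
proof
  assume "\<forall>\<^sub>F u in at_right (h t). P u"
  then obtain b where b: "b > h t" "\<And>u. h t < u \<Longrightarrow> u < b \<Longrightarrow> P u"
    by (auto simp: eventually_at_right_field)
  obtain c where "b = h c"
    using assms(2) by blast
  then show "\<forall>\<^sub>F u in at_right t. P (h u)"
    using b strict_mono_less[OF assms(1)] by (auto simp: eventually_at_right_field)
next
  assume "\<forall>\<^sub>F u in at_right t. P (h u)"
  then obtain c where c: "c > t" "\<And>u. t < u \<Longrightarrow> u < c \<Longrightarrow> P (h u)"
    by (auto simp: eventually_at_right_field)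
  have "P v" if v: "h t < v" "v < h c" for v
  proof -
    obtain u where "v = h u"
      using assms(2) by blast
    then show ?thesis
      using c(2)[of u] v strict_mono_less[OF assms(1)] by simp
  qed
  then show "\<forall>\<^sub>F u in at_right (h t). P u"
    using c(1) strict_mono_less[OF assms(1)] by (auto simp: eventually_at_right_field)
qed

lemma eventually_at_strict_mono:
  fixes h :: "real \<Rightarrow> real"
  assumes "strict_mono h" "surj h"
  shows "(\<forall>\<^sub>F u in at (h t). P u) \<longleftrightarrow> (\<forall>\<^sub>F u in at t. P (h u))"
  by (simp add: eventually_at_split eventually_at_left_strict_mono[OF assms]
      eventually_at_right_strict_mono[OF assms])

lemma left_value_strict_mono:
  fixes h :: "real \<Rightarrow> real"
  assumes "strict_mono h" "surj h"
  shows "left_value g (h t) = left_value (\<lambda>u. g (h u)) t"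
  by (simp add: left_value_def eventually_at_left_strict_mono[OF assms])

lemma right_value_strict_mono:
  fixes h :: "real \<Rightarrow> real"
  assumes "strict_mono h" "surj h"
  shows "right_value g (h t) = right_value (\<lambda>u. g (h u)) t"
  by (simp add: right_value_def eventually_at_right_strict_mono[OF assms])

definition pull_back ::
  "nat \<Rightarrow> (nat \<Rightarrow> nat) \<Rightarrow> (nat \<Rightarrow> real \<Rightarrow> real) \<Rightarrow> (nat \<Rightarrow> real \<Rightarrow> 'a) \<Rightarrow> nat \<Rightarrow> real \<Rightarrow> 'a" where
  "pull_back n \<pi> h f = (\<lambda>i t. if i < n then f (\<pi> i) (h i t) else undefined)"

text \<open>A change of parameters in terms of crossing sets alone. The conditions are symmetric, so
  the inverse change is an instance too, and this provides preimages of colorings.\<close>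

locale reparametrization =
  fixes n :: nat and R R' :: "crossing set" and \<pi> :: "nat \<Rightarrow> nat" and h :: "nat \<Rightarrow> real \<Rightarrow> real"
  assumes perm: "\<pi> permutes {..<n}"
    and mono: "i < n \<Longrightarrow> strict_mono (h i)"
    and onto: "i < n \<Longrightarrow> surj (h i)"
    and shift: "i < n \<Longrightarrow> h i (t + 1) = h i t + 1"
    and components: "(i, s, j, t, p) \<in> R \<Longrightarrow> i < n \<and> j < n"
    and new: "R' = {(i, s, j, t, p). i < n \<and> j < n \<and> (\<pi> i, h i s, \<pi> j, h j t, p) \<in> R}"
begin

lemma perm_less: "\<pi> i < n \<longleftrightarrow> i < n"
  using permutes_in_image[OF perm, of i] by simp

lemma obtain_preimage:
  assumes "j < n" obtains i s where "i < n" "j = \<pi> i" "t = h i s"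
proof -
  obtain i where i: "j = \<pi> i"
    using permutes_surj[OF perm] by (metis surjD)
  then have "i < n"
    using assms perm_less by simp
  then obtain s where "t = h i s"
    using onto by (metis surjD)
  with i \<open>i < n\<close> show thesis
    using that by blast
qed

lemma passes_new:
  assumes "i < n"
  shows "passes R' i t \<longleftrightarrow> passes R (\<pi> i) (h i t)"
proof
  assume "passes R (\<pi> i) (h i t)"
  then obtain j s p where *: "(\<pi> i, h i t, j, s, p) \<in> R \<or> (j, s, \<pi> i, h i t, p) \<in> R"
    by (auto simp: passes_def)
  then have "j < n"
    using components by blast
  then obtain k r where "k < n" "j = \<pi> k" "s = h k r"
    by (rule obtain_preimage)
  then show "passes R' i t"
    using * assms by (auto simp: passes_def new)
qed (auto simp: passes_def new)

lemma pull_back_closed: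
  assumes f: "f \<in> time_colorings X ut ot n R"
  shows "pull_back n \<pi> h f \<in> time_colorings X ut ot n R'"
  unfolding time_colorings_def
proof (rule CollectI, intro conjI allI impI)
  show "if i < n \<and> \<not> passes R' i t then pull_back n \<pi> h f i t \<in> X else pull_back n \<pi> h f i t = undefined" for i t
  proof (cases "i < n")
    case True
    then show ?thesis
      using time_coloring_in[OF f, of "\<pi> i" "h i t"] time_coloring_undefined[OF f, of "\<pi> i" "h i t"]
      by (simp add: pull_back_def passes_new perm_less)
  qed (simp add: pull_back_def)
  show "pull_back n \<pi> h f i (t + 1) = pull_back n \<pi> h f i t" if "i < n" for i t
    using time_coloring_shift[OF f, of "\<pi> i" "h i t" 1] that by (simp add: pull_back_def shift perm_less)
  show "\<forall>\<^sub>F u in at t. pull_back n \<pi> h f i u = pull_back n \<pi> h f i t" if "i < n" "\<not> passes R' i t" for i t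
    using time_coloring_local[OF f, of "\<pi> i" "h i t"] that
    by (simp add: pull_back_def passes_new perm_less eventually_at_strict_mono mono onto)
  show "crossing_rule ut ot p (left_value (pull_back n \<pi> h f i) s) (right_value (pull_back n \<pi> h f i) s)
         (left_value (pull_back n \<pi> h f j) t) (right_value (pull_back n \<pi> h f j) t)"
    if "(i, s, j, t, p) \<in> R'" for i s j t p
  proof -
    have ij: "i < n" "j < n" and R: "(\<pi> i, h i s, \<pi> j, h j t, p) \<in> R"
      using that by (auto simp: new)
    show ?thesis
      using time_coloring_rule[OF f R] ij
      by (simp add: left_value_strict_mono right_value_strict_mono mono onto pull_back_def)
  qed
qed

lemma inverse_reparametrization: "reparametrization n R' R (inv_into UNIV \<pi>) (\<lambda>i. inv_into UNIV (h (inv_into UNIV \<pi> i)))"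
proof
  have inv_less: "inv_into UNIV \<pi> i < n" if "i < n" for i
    using permutes_in_image[OF permutes_inv[OF perm], of i] that by simp
  have inj: "inj (h i)" if "i < n" for i
    using mono[OF that] by (simp add: strict_mono_imp_inj_on)
  have hh: "h i (inv_into UNIV (h i) t) = t" if "i < n" for i t
    by (rule surj_f_inv_f[OF onto[OF that]])
  have hh': "inv_into UNIV (h i) (h i t) = t" if "i < n" for i t
    by (rule inv_f_f[OF inj[OF that]])
  show "inv_into UNIV \<pi> permutes {..<n}"
    by (rule permutes_inv[OF perm])
  show "strict_mono (inv_into UNIV (h (inv_into UNIV \<pi> i)))" if "i < n" for i
  proof (rule strict_monoI)
    fix x y :: real assume "x < y"
    then show "inv_into UNIV (h (inv_into UNIV \<pi> i)) x < inv_into UNIV (h (inv_into UNIV \<pi> i)) y"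
      using hh[OF inv_less[OF that]] strict_mono_less[OF mono[OF inv_less[OF that]]] by metis
  qed
  show "surj (inv_into UNIV (h (inv_into UNIV \<pi> i)))" if "i < n" for i
    by (rule surjI[of _ "h (inv_into UNIV \<pi> i)"]) (rule hh'[OF inv_less[OF that]])
  show "inv_into UNIV (h (inv_into UNIV \<pi> i)) (t + 1) = inv_into UNIV (h (inv_into UNIV \<pi> i)) t + 1" if "i < n" for i t
  proof -
    have "h (inv_into UNIV \<pi> i) (inv_into UNIV (h (inv_into UNIV \<pi> i)) t + 1) = t + 1"
      using shift[OF inv_less[OF that]] hh[OF inv_less[OF that]] by simp
    then show ?thesis
      using hh'[OF inv_less[OF that]] by metis
  qed
  show "i < n \<and> j < n" if "(i, s, j, t, p) \<in> R'" for i s j t p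
    using that by (auto simp: new)
  show "R = {(i, s, j, t, p). i < n \<and> j < n \<and>
      (inv_into UNIV \<pi> i, inv_into UNIV (h (inv_into UNIV \<pi> i)) s,
       inv_into UNIV \<pi> j, inv_into UNIV (h (inv_into UNIV \<pi> j)) t, p) \<in> R'}" (is "R = ?Q")
  proof -
    have "(i, s, j, t, p) \<in> R \<longleftrightarrow> (i, s, j, t, p) \<in> ?Q" for i s j t p
      using components[of i s j t p] by (auto simp: new inv_less hh permutes_inverses[OF perm])
    then show ?thesis
      by (auto simp only: set_eq_iff split_paired_All)
  qed
qed

lemma pull_back_inverse:
  assumes "f \<in> time_colorings X ut ot n R"
  shows "pull_back n (inv_into UNIV \<pi>) (\<lambda>i. inv_into UNIV (h (inv_into UNIV \<pi> i))) (pull_back n \<pi> h f) = f"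
proof (intro ext)
  fix i t
  have inv_less: "inv_into UNIV \<pi> i < n" if "i < n"
    using permutes_in_image[OF permutes_inv[OF perm], of i] that by simp
  show "pull_back n (inv_into UNIV \<pi>) (\<lambda>i. inv_into UNIV (h (inv_into UNIV \<pi> i))) (pull_back n \<pi> h f) i t = f i t"
    using time_coloring_undefined[OF assms, of i t]
    by (simp add: pull_back_def inv_less permutes_inverses[OF perm] surj_f_inv_f onto)
qed

lemma same_time_colorings:
  assumes "crossing_pattern n R" "crossing_pattern n R'"
  shows "same_time_colorings X ut ot n R n R'"
proof (rule same_time_coloringsI[OF assms, where r = "\<lambda>f g. g = pull_back n \<pi> h f"])
  interpret inverse: reparametrization n R' R "inv_into UNIV \<pi>" "\<lambda>i. inv_into UNIV (h (inv_into UNIV \<pi> i))"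
    by (rule inverse_reparametrization)
  show "g = g'" if "g = pull_back n \<pi> h f" "g' = pull_back n \<pi> h f" for f g g'
    using that by simp
  fix f f' g \<alpha>
  show "\<exists>g\<in>time_colorings X ut ot n R'. g = pull_back n \<pi> h f" if "f \<in> time_colorings X ut ot n R"
    using pull_back_closed[OF that] by blast
  show "f = f'" if "f \<in> time_colorings X ut ot n R" "f' \<in> time_colorings X ut ot n R"
    "g = pull_back n \<pi> h f" "g = pull_back n \<pi> h f'"
    using that pull_back_inverse by metis
  show "act n R' \<alpha> g = pull_back n \<pi> h (act n R \<alpha> f)" if "g = pull_back n \<pi> h f"
    by (auto simp: that act_def pull_back_def passes_new perm_less fun_eq_iff)
  show "\<exists>f\<in>time_colorings X ut ot n R. g = pull_back n \<pi> h f" if "g \<in> time_colorings X ut ot n R'"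
  proof (rule bexI[OF _ inverse.pull_back_closed[OF that]], intro ext)
    fix i t
    have inj: "inj (h i)" if "i < n"
      using mono[OF that] by (simp add: strict_mono_imp_inj_on)
    show "g i t = pull_back n \<pi> h (pull_back n (inv_into UNIV \<pi>) (\<lambda>i. inv_into UNIV (h (inv_into UNIV \<pi> i))) g) i t"
      using time_coloring_undefined[OF that, of i t]
      by (simp add: pull_back_def perm_less permutes_inverses[OF perm] inv_f_f inj)
  qed
qed

end

lemma det2_scale: "det2 (a *\<^sub>R u) (b *\<^sub>R v) = a * b * det2 u v"
  by (simp add: det2_def algebra_simps)

lemma det2_scale_pos: "a > 0 \<Longrightarrow> b > 0 \<Longrightarrow> det2 (a *\<^sub>R u) (b *\<^sub>R v) > 0 \<longleftrightarrow> det2 u v > 0"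
  by (metis det2_scale mult_pos_pos zero_less_mult_pos)

lemma strict_mono_deriv_shift:
  assumes deriv: "\<And>t. (h has_real_derivative h' t) (at t)" and pos: "\<And>t. h' t > 0"
    and shift: "\<And>t. h (t + 1) = h t + (1 :: real)"
  shows "strict_mono h" "surj h"
proof -
  show "strict_mono h"
  proof (rule strict_monoI)
    fix x y :: real assume "x < y"
    then show "h x < h y"
      using deriv pos by (intro DERIV_pos_imp_increasing[of x y h]) blast+
  qed
  \<comment> \<open>\<open>h t - t\<close> has period 1, so integer shifts pass through
    \<open>h\<close>. This makes \<open>h\<close> unbounded in both directions, and the intermediate
    value theorem gives surjectivity.\<close>
  have int: "h (t + of_int k) = h t + of_int k" for t k
    using periodic_int_shift[of "\<lambda>t. h t - t" t k] shift by simp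
  have "\<exists>t. h t = y" for y
  proof -
    obtain k :: nat where k: "\<bar>y\<bar> + \<bar>h 0\<bar> \<le> real k"
      using real_arch_simple by blast
    have "h (- real k) = h 0 - real k"
      using int[of "- real k" "int k"] by simp
    moreover have "h (real k) = h 0 + real k"
      using int[of 0 "int k"] by simp
    ultimately have "h (- real k) \<le> y" "y \<le> h (real k)"
      using k by auto
    moreover have "continuous_on {- real k..real k} h"
      using deriv DERIV_isCont by (blast intro: continuous_at_imp_continuous_on)
    ultimately show ?thesis
      using IVT'[of h "- real k" y "real k"] by auto
  qed
  then show "surj h"
    by (metis surjI)
qed

lemma same_colorings_reparametrized:
  assumes D: "link_diagram D" "link_diagram D'" and "reparametrized D D'"
  shows "same_colorings X ut ot D D'"
proof -
  let ?n = "ncomp D"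
  obtain \<pi> h h' where n: "ncomp D' = ?n" and \<pi>: "\<pi> permutes {..<?n}"
    and h: "\<And>i t. i < ?n \<Longrightarrow> (h i has_real_derivative h' i t) (at t)" "\<And>i t. i < ?n \<Longrightarrow> h' i t > 0"
      "\<And>i t. i < ?n \<Longrightarrow> h i (t + 1) = h i t + 1"
    and curve: "\<And>i t. i < ?n \<Longrightarrow> curve D' i t = curve D (\<pi> i) (h i t)"
    and over: "\<And>i. i < ?n \<Longrightarrow> over D' i = {t. h i t \<in> over D (\<pi> i)}"
    using assms(3) unfolding reparametrized_def by metis
  have mono: "strict_mono (h i)" and surj: "surj (h i)" if "i < ?n" for i
    using strict_mono_deriv_shift[of "h i" "h' i"] h that by blast+
  have perm_less: "\<pi> i < ?n \<longleftrightarrow> i < ?n" for i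
    using permutes_in_image[OF \<pi>, of i] by simp
  have perm_inj: "\<pi> i = \<pi> j \<longleftrightarrow> i = j" for i j
    using permutes_inj[OF \<pi>] by (simp add: inj_eq)
  have shift: "h i (t + of_int k) = h i t + of_int k" if "i < ?n" for i t k
    using periodic_int_shift[of "\<lambda>t. h i t - t" t k] h(3)[OF that] by simp
  \<comment> \<open>A crossing requires two times of one component to differ modulo 1, so this
    relation has to be preserved; strict monotonicity recovers the integer.\<close>
  have Ints: "h i s - h i t \<in> \<int> \<longleftrightarrow> s - t \<in> \<int>" if i: "i < ?n" for i s t
  proof
    assume "h i s - h i t \<in> \<int>"
    then obtain k where "h i s = h i t + of_int k"
      by (metis Ints_cases add.commute diff_add_cancel)
    then have "h i s = h i (t + of_int k)"
      using shift[OF i] by simp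
    then have "s = t + of_int k"
      using strict_mono_eq[OF mono[OF i]] by blast
    then show "s - t \<in> \<int>"
      by simp
  next
    assume "s - t \<in> \<int>"
    then obtain k where "s = t + of_int k"
      by (metis Ints_cases add.commute diff_add_cancel)
    then show "h i s - h i t \<in> \<int>"
      by (simp add: shift[OF i])
  qed
  have crosses: "crosses D' i s j t \<longleftrightarrow> i < ?n \<and> j < ?n \<and> crosses D (\<pi> i) (h i s) (\<pi> j) (h j t)" for i s j t
    using Ints by (auto simp: crosses_def n curve perm_less perm_inj)
  \<comment> \<open>Velocities change by the positive factor \<open>h'\<close>, which does not
    affect the sign of their determinant.\<close>
  have velocity: "velocity D' i t = h' i t *\<^sub>R velocity D (\<pi> i) (h i t)" if i: "i < ?n" for i t
  proof (rule velocity_eqI)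
    have "(h i has_vector_derivative h' i t) (at t)"
      using h(1)[OF i, of t] by (simp add: has_real_derivative_iff_has_vector_derivative)
    then have "((curve D (\<pi> i) \<circ> h i) has_vector_derivative h' i t *\<^sub>R velocity D (\<pi> i) (h i t)) (at t)"
      by (rule vector_diff_chain_at) (rule curve_has_velocity[OF D(1)], simp add: perm_less i)
    moreover have "curve D' i = curve D (\<pi> i) \<circ> h i"
      using curve[OF i] by auto
    ultimately show "(curve D' i has_vector_derivative h' i t *\<^sub>R velocity D (\<pi> i) (h i t)) (at t)"
      by simp
  qed (rule D(2))
  have "classical_crossings D' = {(i, s, j, t, p). i < ?n \<and> j < ?n \<and>
      (\<pi> i, h i s, \<pi> j, h j t, p) \<in> classical_crossings D}"
    using h(2) by (auto simp: classical_crossings_def crosses over velocity det2_scale_pos)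
  then interpret reparametrization ?n "classical_crossings D" "classical_crossings D'" \<pi> h
    using \<pi> mono surj h(3) by unfold_locales (auto simp: classical_crossings_def crosses_def)
  show ?thesis
    using same_time_colorings crossing_pattern_diagram[OF D(1)] crossing_pattern_diagram[OF D(2)] n
    by (intro same_coloringsI[OF D]) simp
qed

section \<open>Reparametrisation and planar isotopy\<close>

text \<open>Multiplicativity of determinants: \<open>det2 (L 1) (L \<i>)\<close> is the determinant
  of \<open>L\<close> in the basis 1, \<i>.\<close>

lemma det2_linear:
  assumes "linear L"
  shows "det2 (L u) (L v) = det2 (L 1) (L \<i>) * det2 u v"
proof -
  have L: "L z = Re z *\<^sub>R L 1 + Im z *\<^sub>R L \<i>" for z
  proof -
    have "z = Re z *\<^sub>R 1 + Im z *\<^sub>R \<i>"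
      by (simp add: complex_eq_iff)
    then show ?thesis
      using linear_add[OF assms] linear_cmul[OF assms] by metis
  qed
  show ?thesis
    unfolding L[of u] L[of v] by (simp add: det2_def algebra_simps)
qed

lemma det2_linear_bij:
  assumes "linear L" "bij L"
  shows "det2 (L 1) (L \<i>) \<noteq> 0"
proof
  assume 0: "det2 (L 1) (L \<i>) = 0"
  obtain u v where "1 = L u" "\<i> = L v"
    using bij_is_surj[OF assms(2)] by (metis surjD)
  then have "det2 1 \<i> = 0"
    using det2_linear[OF assms(1), of u v] 0 by simp
  then show False
    by (simp add: det2_def)
qed

lemma pos_mult_iff: "0 < a \<Longrightarrow> 0 < a * b \<longleftrightarrow> 0 < (b :: real)"
  by (metis mult_pos_pos zero_less_mult_pos)

lemma velocity_image:
  assumes D: "link_diagram D" and i: "i < ncomp D"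
    and "(\<phi> has_derivative L) (at (curve D i t))" "\<And>u. curve D' i u = \<phi> (curve D i u)"
  shows "velocity D' i t = L (velocity D i t)"
proof -
  have "((\<phi> \<circ> curve D i) has_vector_derivative L (velocity D i t)) (at t)"
    using vector_derivative_diff_chain_within[OF curve_has_velocity[OF D i, of t], of \<phi> L]
      has_derivative_at_withinI[OF assms(3)] by simp
  moreover have "curve D' i = \<phi> \<circ> curve D i"
    using assms(4) by auto
  ultimately show ?thesis
    unfolding velocity_def by (simp add: vector_derivative_at)
qed

lemma continuous_on_det2 [continuous_intros]:
  "continuous_on S f \<Longrightarrow> continuous_on S g \<Longrightarrow> continuous_on S (\<lambda>x. det2 (f x) (g x))"
  unfolding det2_def by (intro continuous_intros)

lemma same_colorings_planar_isotopic:
  assumes D: "link_diagram D" "link_diagram D'" and "planar_isotopic D D'"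
  shows "same_colorings X ut ot D D'"
proof -
  obtain H where n: "ncomp D' = ncomp D" and H: "plane_isotopy H"
    and curve: "\<And>i t. i < ncomp D \<Longrightarrow> curve D' i t = H 1 (curve D i t)"
    and over: "\<And>i. i < ncomp D \<Longrightarrow> over D' i = over D i"
    using assms(3) unfolding planar_isotopic_def by blast
  obtain H' where H0: "H 0 = id"
    and H': "\<And>s. s \<in> {0..1} \<Longrightarrow> bij (H s)" "\<And>s z. s \<in> {0..1} \<Longrightarrow> (H s has_derivative H' s z) (at z)"
      "\<And>s z. s \<in> {0..1} \<Longrightarrow> bij (H' s z)"
    and cont: "\<And>w. continuous_on ({0..1} \<times> UNIV) (\<lambda>(s, z). H' s z w)"
    using H unfolding plane_isotopy_def by blast
  have lin: "linear (H' s z)" if "s \<in> {0..1}" for s z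
    using H'(2)[OF that] by (rule has_derivative_linear)
  \<comment> \<open>The Jacobian determinant is 1 at the start of the isotopy, depends continuously
    on \<open>s\<close> and never vanishes, so it is still positive at the end.\<close>
  have pos: "det2 (H' 1 z 1) (H' 1 z \<i>) > 0" for z
  proof (rule ccontr)
    let ?d = "\<lambda>s. det2 (H' s z 1) (H' s z \<i>)"
    assume "\<not> ?d 1 > 0"
    moreover have "H' 0 z = id"
      using H'(2)[of 0 z] unfolding H0 by (intro has_derivative_unique[of id _ z]) (auto simp: id_def)
    then have "?d 0 = 1"
      by (simp add: det2_def)
    moreover have "continuous_on {0..1} (\<lambda>s. H' s z w)" for w
      by (rule continuous_on_compose2[OF cont[of w], of _ "\<lambda>s. (s, z)", simplified])
        (auto intro!: continuous_intros)
    then have "continuous_on {0..1} ?d"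
      by (intro continuous_intros)
    ultimately obtain s where "0 \<le> s" "s \<le> 1" "?d s = 0"
      using IVT2'[of ?d 1 0 0] by auto
    then show False
      using det2_linear_bij[OF lin H'(3), of s z] by simp
  qed
  have inj: "H 1 z = H 1 w \<longleftrightarrow> z = w" for z w
    using H'(1)[of 1] by (auto simp: bij_def inj_eq)
  have crosses: "crosses D' i s j t \<longleftrightarrow> crosses D i s j t" for i s j t
    by (auto simp: crosses_def n curve inj)
  have "det2 (velocity D' i s) (velocity D' j t) > 0 \<longleftrightarrow> det2 (velocity D i s) (velocity D j t) > 0"
    if "crosses D i s j t" for i s j t
  proof -
    have ij: "i < ncomp D" "j < ncomp D" and eq: "curve D i s = curve D j t"
      using that by (auto simp: crosses_def)
    have "velocity D' i s = H' 1 (curve D i s) (velocity D i s)"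
      by (rule velocity_image[OF D(1) ij(1)]) (use H'(2) curve ij in auto)
    moreover have "velocity D' j t = H' 1 (curve D i s) (velocity D j t)"
      unfolding eq by (rule velocity_image[OF D(1) ij(2)]) (use H'(2) curve ij in auto)
    ultimately show ?thesis
      using pos det2_linear[OF lin[of 1], of "curve D i s" "velocity D i s" "velocity D j t"]
      by (simp add: pos_mult_iff)
  qed
  then have "classical_crossings D' = classical_crossings D"
    using over by (auto simp: classical_crossings_def crosses) (auto simp: crosses_def)+
  then show ?thesis
    by (intro same_colorings_if_same_crossings D n)
qed

section \<open>Biquandle labels around a third Reidemeister move\<close>

locale finite_biquandle = biquandle X under_op over_op
  for X :: "'a set" and under_op over_op +
  assumes finite_X: "finite X"
begin

text \<open>A crossing without orientations: \<open>x\<close> and \<open>y\<close> are the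
  right-hand labels of the under- and the over-strand, \<open>x'\<close> and \<open>y'\<close> their
  left-hand labels. Membership in \<open>X\<close> is included because the axioms speak about
  elements of \<open>X\<close> only.\<close>

definition cell :: "'a \<Rightarrow> 'a \<Rightarrow> 'a \<Rightarrow> 'a \<Rightarrow> bool" where
  "cell x y x' y' \<longleftrightarrow> x \<in> X \<and> y \<in> X \<and> x' = under_op x y \<and> y' = over_op y x"

lemma cell_closed: "cell x y x' y' \<Longrightarrow> x \<in> X \<and> y \<in> X \<and> x' \<in> X \<and> y' \<in> X"
  by (auto simp: cell_def under_closed over_closed)

text \<open>The Boolean argument says whether a label lies on the left. One label of each strand
  determines the rest: two right-hand labels by definition, one of each kind by invertibility of an
  operation in its first argument, two left-hand labels by invertibility of the sideways
  map.\<close>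

lemma cell_corner:
  assumes "cell (p False) (q False) (p True) (q True)" "cell (p' False) (q' False) (p' True) (q' True)"
    and "p b = p' b" "q c = q' c"
  shows "p = p'" "q = q'"
proof -
  have under: "x = x'" if "under_op x y = under_op x' y" "x \<in> X" "x' \<in> X" "y \<in> X" for x x' y
    using under_bij[OF that(4)] that by (auto simp: bij_betw_def dest: inj_onD)
  have over: "x = x'" if "over_op x y = over_op x' y" "x \<in> X" "x' \<in> X" "y \<in> X" for x x' y
    using over_bij[OF that(4)] that by (auto simp: bij_betw_def dest: inj_onD)
  have side: "x = x' \<and> y = y'" if "over_op y x = over_op y' x'" "under_op x y = under_op x' y'"
      "x \<in> X" "x' \<in> X" "y \<in> X" "y' \<in> X" for x x' y y'
    using inj_onD[OF bij_betw_imp_inj_on[OF sideways_bij], of "(x, y)" "(x', y')"] that by auto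
  have "p False = p' False \<and> q False = q' False"
    using assms under[of "p False" "q False" "p' False"] over[of "q False" "p False" "q' False"]
      side[of "q False" "p False" "q' False" "p' False"]
    by (cases b; cases c) (auto simp: cell_def)
  then have "p i = p' i \<and> q i = q' i" for i
    using assms by (cases i) (auto simp: cell_def)
  then show "p = p'" "q = q'"
    by auto
qed

text \<open>
  The twelve labels of the exchange laws sit on the edges of a cube, the six crossings being its
  faces. The arguments of an edge say on which side of the two other strands it lies.
\<close>

fun edge_x edge_y edge_z :: "'a \<times> 'a \<times> 'a \<Rightarrow> bool \<Rightarrow> bool \<Rightarrow> 'a" where
  "edge_x (x, y, z) by bz =
     (if by then if bz then under_op (under_op x z) (under_op y z) else under_op x y
      else if bz then under_op x z else x)"
| "edge_y (x, y, z) bx bz =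
     (if bx then if bz then over_op (under_op y z) (under_op x z) else over_op y x
      else if bz then under_op y z else y)"
| "edge_z (x, y, z) bx by =
     (if bx then if by then over_op (over_op z x) (over_op y x) else over_op z x
      else if by then over_op z y else z)"

text \<open>Strand x lies below y, and y below z. The edges at the vertex opposite to that of x, y,
  z each lie on two faces and receive an expression from both; the three exchange laws say that the
  two expressions agree.\<close>

lemma cube_faces:
  assumes "t \<in> X \<times> X \<times> X"
  shows "cell (edge_x t False bz) (edge_y t False bz) (edge_x t True bz) (edge_y t True bz)"
    and "cell (edge_x t by False) (edge_z t False by) (edge_x t by True) (edge_z t True by)"
    and "cell (edge_y t bx False) (edge_z t bx False) (edge_y t bx True) (edge_z t bx True)"
proof -
  obtain x y z where t: "t = (x, y, z)" "x \<in> X" "y \<in> X" "z \<in> X"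
    using assms by auto
  note closed = under_closed over_closed
  show "cell (edge_x t False bz) (edge_y t False bz) (edge_x t True bz) (edge_y t True bz)"
    using t by (auto simp: cell_def closed)
  show "cell (edge_x t by False) (edge_z t False by) (edge_x t by True) (edge_z t True by)"
    using t exchange_uu[of x z y] exchange_oo[of z x y] by (auto simp: cell_def closed)
  show "cell (edge_y t bx False) (edge_z t bx False) (edge_y t bx True) (edge_z t bx True)"
    using t exchange_uo[of y z x] by (auto simp: cell_def closed)
qed

text \<open>By \<open>cell_corner\<close> the two edges of a face that meet at a vertex determine
  the whole face. Passing from face to face leads to the vertex whose labels are x, y, z
  themselves.\<close>

lemma cube_vertex_inj:
  "inj_on (\<lambda>t. (edge_x t by bz, edge_y t bx bz, edge_z t bx by)) (X \<times> X \<times> X)"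
proof (rule inj_onI)
  fix t t' assume t: "t \<in> X \<times> X \<times> X" and t': "t' \<in> X \<times> X \<times> X"
    and "(edge_x t by bz, edge_y t bx bz, edge_z t bx by) = (edge_x t' by bz, edge_y t' bx bz, edge_z t' bx by)"
  then have eq: "edge_x t by bz = edge_x t' by bz" "edge_y t bx bz = edge_y t' bx bz"
    "edge_z t bx by = edge_z t' bx by"
    by auto
  have "(\<lambda>b. edge_x t by b) = (\<lambda>b. edge_x t' by b)" "(\<lambda>b. edge_y t bx b) = (\<lambda>b. edge_y t' bx b)"
    by (rule cell_corner[OF cube_faces(2)[OF t] cube_faces(2)[OF t']] cell_corner[OF cube_faces(3)[OF t] cube_faces(3)[OF t']];
        use eq in simp)+
  then have eq': "edge_x t by False = edge_x t' by False" "edge_y t bx False = edge_y t' bx False"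
    by (auto dest: fun_cong)
  have "(\<lambda>b. edge_x t b False) = (\<lambda>b. edge_x t' b False)" "(\<lambda>b. edge_y t b False) = (\<lambda>b. edge_y t' b False)"
    by (rule cell_corner[OF cube_faces(1)[OF t] cube_faces(1)[OF t']]; use eq' in simp)+
  then have xy: "edge_x t False False = edge_x t' False False" "edge_y t False False = edge_y t' False False"
    by (auto dest: fun_cong)
  have "(\<lambda>b. edge_z t b by) = (\<lambda>b. edge_z t' b by)"
    by (rule cell_corner[OF cube_faces(2)[OF t] cube_faces(2)[OF t']]; use eq in simp)
  then have "edge_z t False by = edge_z t' False by"
    by (auto dest: fun_cong)
  then have "(\<lambda>b. edge_z t False b) = (\<lambda>b. edge_z t' False b)"
    by (intro cell_corner(2)[OF cube_faces(3)[OF t, of False] cube_faces(3)[OF t', of False]]) (use xy in simp_all)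
  then have "edge_z t False False = edge_z t' False False"
    by (auto dest: fun_cong)
  with xy show "t = t'"
    by (cases t; cases t') simp
qed

text \<open>The three crossings of a triangle are the three faces at one vertex of the cube, and the
  triangle after the move consists of the three opposite faces. The two halves share six edges,
  which are the ends of the strands; hence the six equations.\<close>

lemma cell_flip:
  assumes xy: "cell (ex False bz) (ey False bz) (ex True bz) (ey True bz)"
    and xz: "cell (ex by False) (ez False by) (ex by True) (ez True by)"
    and yz: "cell (ey bx False) (ez bx False) (ey bx True) (ez bx True)"
  shows "\<exists>ex' ey' ez'.
    ex' by (\<not> bz) = ex by (\<not> bz) \<and> ex' (\<not> by) bz = ex (\<not> by) bz \<and>
    ey' bx (\<not> bz) = ey bx (\<not> bz) \<and> ey' (\<not> bx) bz = ey (\<not> bx) bz \<and>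
    ez' bx (\<not> by) = ez bx (\<not> by) \<and> ez' (\<not> bx) by = ez (\<not> bx) by \<and>
    cell (ex' False (\<not> bz)) (ey' False (\<not> bz)) (ex' True (\<not> bz)) (ey' True (\<not> bz)) \<and>
    cell (ex' (\<not> by) False) (ez' False (\<not> by)) (ex' (\<not> by) True) (ez' True (\<not> by)) \<and>
    cell (ey' (\<not> bx) False) (ez' (\<not> bx) False) (ey' (\<not> bx) True) (ez' (\<not> bx) True)"
proof -
  let ?f = "\<lambda>t. (edge_x t by bz, edge_y t bx bz, edge_z t bx by)"
  have faces: "?f t \<in> X \<times> X \<times> X" if "t \<in> X \<times> X \<times> X" for t
    using cell_closed[OF cube_faces(1)[OF that, of bz]] cell_closed[OF cube_faces(2)[OF that, of "by"]]
    by (cases bx; cases "by") auto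
  \<comment> \<open>An injective map of a finite set into itself is onto, so the three labels given
    at the vertex belong to some cube. \<open>cell_corner\<close> then identifies the given faces
    with faces of that cube.\<close>
  have "?f ` (X \<times> X \<times> X) = X \<times> X \<times> X"
    by (rule endo_inj_surj) (use faces cube_vertex_inj finite_X in auto)
  moreover have "(ex by bz, ey bx bz, ez bx by) \<in> X \<times> X \<times> X"
    using cell_closed[OF xy] cell_closed[OF xz] by (cases bx; cases "by") auto
  ultimately have "(ex by bz, ey bx bz, ez bx by) \<in> ?f ` (X \<times> X \<times> X)"
    by (simp only:)
  then obtain t where "(ex by bz, ey bx bz, ez bx by) = ?f t" and t: "t \<in> X \<times> X \<times> X"
    by (rule imageE)
  then have eq: "edge_x t by bz = ex by bz" "edge_y t bx bz = ey bx bz" "edge_z t bx by = ez bx by"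
    by auto
  have 1: "(\<lambda>b. edge_x t b bz) = (\<lambda>b. ex b bz)" "(\<lambda>b. edge_y t b bz) = (\<lambda>b. ey b bz)"
    by (rule cell_corner[OF cube_faces(1)[OF t] xy]; use eq in simp)+
  have 2: "(\<lambda>b. edge_x t by b) = (\<lambda>b. ex by b)" "(\<lambda>b. edge_z t b by) = (\<lambda>b. ez b by)"
    by (rule cell_corner[OF cube_faces(2)[OF t] xz]; use eq in simp)+
  have 3: "(\<lambda>b. edge_y t bx b) = (\<lambda>b. ey bx b)" "(\<lambda>b. edge_z t bx b) = (\<lambda>b. ez bx b)"
    by (rule cell_corner[OF cube_faces(3)[OF t] yz]; use eq in simp)+
  show ?thesis
    by (rule exI[of _ "edge_x t"], rule exI[of _ "edge_y t"], rule exI[of _ "edge_z t"])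
      (intro conjI fun_cong[OF 1(1)] fun_cong[OF 1(2)] fun_cong[OF 2(1)] fun_cong[OF 2(2)]
        fun_cong[OF 3(1)] fun_cong[OF 3(2)] cube_faces[OF t])
qed

end

section \<open>The third move on labels, for all orientations and heights\<close>

context finite_biquandle
begin

text \<open>In the eight instances of \<open>cell_flip\<close> below, the entry
  \<open>undefined\<close> stands for the edge at the opposite vertex, which lies on none of the
  three given faces.\<close>

definition labels :: "'a \<Rightarrow> 'a \<Rightarrow> 'a \<Rightarrow> 'a \<Rightarrow> bool \<Rightarrow> bool \<Rightarrow> 'a" where
  "labels a b c d i j = (if i then if j then d else b else if j then c else a)"

text \<open>The digits in the eight names are the values of \<open>bx\<close>, \<open>by\<close> and
  \<open>bz\<close>. In a label such as \<open>xz\<close> the first letter names the strand and the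
  others the strands to whose left it lies.\<close>

lemma cell_flip_000:
  assumes "cell x y xy yx" "cell x z xz zx" "cell y z yz zy"
  shows "\<exists>xyz yxz zxy. cell xz yz xyz yxz \<and> cell xy zy xyz zxy \<and> cell yx zx yxz zxy"
  using cell_flip[of "labels x xy xz undefined" False "labels y yx yz undefined" False
      "labels z zx zy undefined" False] assms
  by (simp add: labels_def) blast

lemma cell_flip_001:
  assumes "cell xz yz xyz yxz" "cell x z xz zx" "cell y z yz zy"
  shows "\<exists>xy yx zxy. cell x y xy yx \<and> cell xy zy xyz zxy \<and> cell yx zx yxz zxy"
  using cell_flip[of "labels x undefined xz xyz" True "labels y undefined yz yxz" False
      "labels z zx zy undefined" False] assms
  by (simp add: labels_def) blast

lemma cell_flip_010:
  assumes "cell x y xy yx" "cell xy zy xyz zxy" "cell y z yz zy"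
  shows "\<exists>xz yxz zx. cell xz yz xyz yxz \<and> cell x z xz zx \<and> cell yx zx yxz zxy"
  using cell_flip[of "labels x xy undefined xyz" False "labels y yx yz undefined" True
      "labels z undefined zy zxy" False] assms
  by (simp add: labels_def) blast

lemma cell_flip_011:
  assumes "cell xz yz xyz yxz" "cell xy zy xyz zxy" "cell y z yz zy"
  shows "\<exists>x yx zx. cell x y xy yx \<and> cell x z xz zx \<and> cell yx zx yxz zxy"
  using cell_flip[of "labels undefined xy xz xyz" True "labels y undefined yz yxz" True
      "labels z undefined zy zxy" False] assms
  by (simp add: labels_def) blast

lemma cell_flip_100:
  assumes "cell x y xy yx" "cell x z xz zx" "cell yx zx yxz zxy"
  shows "\<exists>xyz yz zy. cell xz yz xyz yxz \<and> cell xy zy xyz zxy \<and> cell y z yz zy"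
  using cell_flip[of "labels x xy xz undefined" False "labels y yx undefined yxz" False
      "labels z zx undefined zxy" True] assms
  by (simp add: labels_def) blast

lemma cell_flip_101:
  assumes "cell xz yz xyz yxz" "cell x z xz zx" "cell yx zx yxz zxy"
  shows "\<exists>xy y zy. cell x y xy yx \<and> cell xy zy xyz zxy \<and> cell y z yz zy"
  using cell_flip[of "labels x undefined xz xyz" True "labels undefined yx yz yxz" False
      "labels z zx undefined zxy" True] assms
  by (simp add: labels_def) blast

lemma cell_flip_110:
  assumes "cell x y xy yx" "cell xy zy xyz zxy" "cell yx zx yxz zxy"
  shows "\<exists>xz yz z. cell xz yz xyz yxz \<and> cell x z xz zx \<and> cell y z yz zy"
  using cell_flip[of "labels x xy undefined xyz" False "labels y yx undefined yxz" True
      "labels undefined zx zy zxy" True] assms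
  by (simp add: labels_def) blast

lemma cell_flip_111:
  assumes "cell xz yz xyz yxz" "cell xy zy xyz zxy" "cell yx zx yxz zxy"
  shows "\<exists>x y z. cell x y xy yx \<and> cell x z xz zx \<and> cell y z yz zy"
  using cell_flip[of "labels undefined xy xz xyz" True "labels undefined yx yz yxz" True
      "labels undefined zx zy zxy" True] assms
  by (simp add: labels_def) blast

lemmas cell_flips = cell_flip_000 cell_flip_001 cell_flip_010 cell_flip_011 cell_flip_100 cell_flip_101 cell_flip_110 cell_flip_111

text \<open>The pairs are the labels of strands \<open>k\<close> and \<open>l\<close> before and
  after their crossing. \<open>w\<close> says that \<open>k\<close> is the upper strand, and
  \<open>p\<close> that \<open>l\<close> runs from the right to the left of \<open>k\<close>, a
  condition that does not depend on the heights.\<close>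

definition pair_cell :: "bool \<Rightarrow> bool \<Rightarrow> 'a \<times> 'a \<Rightarrow> 'a \<times> 'a \<Rightarrow> bool" where
  "pair_cell w p k l =
    (if w then if p then cell (fst l) (snd k) (snd l) (fst k) else cell (snd l) (fst k) (fst l) (snd k)
     else if p then cell (snd k) (fst l) (fst k) (snd l) else cell (fst k) (snd l) (snd k) (fst l))"

text \<open>The Booleans \<open>e\<close>, \<open>s\<close>, \<open>t\<close>, \<open>c\<close> say
  that \<epsilon>, \<sigma>, \<tau>, \<kappa> equal 1, and \<open>w01\<close>, \<open>w02\<close>,
  \<open>w12\<close> that the strand named first is the upper one. A strand has label
  \<open>a\<close> before its two crossings, \<open>m\<close> between them and \<open>z\<close>
  after them; the conditionals tell which of its crossings comes first.\<close>

definition triangle where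
  "triangle e s t c w01 w02 w12 a0 a1 a2 m0 m1 m2 z0 z1 z2 \<longleftrightarrow>
     pair_cell w01 (c = s) (if e then (m0, z0) else (a0, m0)) (if s = e then (m1, z1) else (a1, m1)) \<and>
     pair_cell w02 (c \<noteq> t) (if e then (a0, m0) else (m0, z0)) (if t = e then (a2, m2) else (m2, z2)) \<and>
     pair_cell w12 (c \<noteq> (s = t)) (if s = e then (a1, m1) else (m1, z1)) (if t = e then (m2, z2) else (a2, m2))"

text \<open>The two conditions on \<open>w01\<close>, \<open>w02\<close>, \<open>w12\<close> exclude
  cyclic heights. In each remaining case the three crossings are the faces at some vertex of a cube,
  and one of the eight instances of \<open>cell_flip\<close> applies.\<close>

lemma triangle_move:
  assumes "triangle e s t c w01 w02 w12 a0 a1 a2 m0 m1 m2 z0 z1 z2"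
    and "w01 \<and> w12 \<longrightarrow> w02" "\<not> w01 \<and> \<not> w12 \<longrightarrow> \<not> w02"
  shows "\<exists>m0' m1' m2'. triangle (\<not> e) s t c w01 w02 w12 a0 a1 a2 m0' m1' m2' z0 z1 z2"
  by (insert assms, cases e; cases s; cases t; cases c; cases w01; cases w02; cases w12;
      simp only: triangle_def pair_cell_def if_True if_False fst_conv snd_conv simp_thms;
      elim conjE; drule cell_flips, assumption, assumption, blast)

lemma cell_determined:
  assumes "cell x y a b" "cell x' y' a' b'" "x = x' \<or> a = a'" "y = y' \<or> b = b'"
  shows "x = x' \<and> y = y' \<and> a = a' \<and> b = b'"
proof -
  define i j where "i \<longleftrightarrow> x \<noteq> x'" and "j \<longleftrightarrow> y \<noteq> y'"
  then have ij: "(if i then a else x) = (if i then a' else x')" "(if j then b else y) = (if j then b' else y')"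
    using assms(3,4) by auto
  define p p' q q' where "p = (\<lambda>i. if i then a else x)" "p' = (\<lambda>i. if i then a' else x')"
    "q = (\<lambda>i. if i then b else y)" "q' = (\<lambda>i. if i then b' else y')"
  have "p = p'" "q = q'"
    by (rule cell_corner[of p q p' q' i j]; use assms(1,2) ij in \<open>simp add: p_p'_q_q'_def\<close>)+
  then have "p False = p' False" "p True = p' True" "q False = q' False" "q True = q' True"
    by simp_all
  then show ?thesis
    by (simp add: p_p'_q_q'_def)
qed

lemma pair_cell_determined:
  assumes "pair_cell w p (k1, k2) (l1, l2)" "pair_cell w p (k1', k2') (l1', l2')"
    and "k1 = k1' \<or> k2 = k2'" "l1 = l1' \<or> l2 = l2'"
  shows "k1 = k1' \<and> k2 = k2' \<and> l1 = l1' \<and> l2 = l2'"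
proof (cases w; cases p)
  assume "w" "p"
  then have "cell l1 k2 l2 k1" "cell l1' k2' l2' k1'"
    using assms(1,2) by (simp_all add: pair_cell_def)
  from cell_determined[OF this] show ?thesis
    using assms(3,4) by blast
next
  assume "w" "\<not> p"
  then have "cell l2 k1 l1 k2" "cell l2' k1' l1' k2'"
    using assms(1,2) by (simp_all add: pair_cell_def)
  from cell_determined[OF this] show ?thesis
    using assms(3,4) by blast
next
  assume "\<not> w" "p"
  then have "cell k2 l1 k1 l2" "cell k2' l1' k1' l2'"
    using assms(1,2) by (simp_all add: pair_cell_def)
  from cell_determined[OF this] show ?thesis
    using assms(3,4) by blast
next
  assume "\<not> w" "\<not> p"
  then have "cell k1 l2 k2 l1" "cell k1' l2' k2' l1'"
    using assms(1,2) by (simp_all add: pair_cell_def)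
  from cell_determined[OF this] show ?thesis
    using assms(3,4) by blast
qed

text \<open>Both hypotheses contain the same outer label of either strand, and one label of each
  strand determines the crossing.\<close>

lemma pair_cell_middle:
  assumes "pair_cell w p (if b then (m, z) else (a, m)) (if b' then (m', z') else (a', m'))"
    and "pair_cell w p (if b then (n, z) else (a, n)) (if b' then (n', z') else (a', n'))"
  shows "m = n \<and> m' = n'"
proof -
  define k1 k2 l1 l2 where "k1 = (if b then m else a)" "k2 = (if b then z else m)"
    "l1 = (if b' then m' else a')" "l2 = (if b' then z' else m')"
  define i1 i2 j1 j2 where "i1 = (if b then n else a)" "i2 = (if b then z else n)"
    "j1 = (if b' then n' else a')" "j2 = (if b' then z' else n')"
  note defs = k1_k2_l1_l2_def i1_i2_j1_j2_def
  have "pair_cell w p (k1, k2) (l1, l2)" "pair_cell w p (i1, i2) (j1, j2)"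
    using assms by (simp_all add: defs split: if_splits)
  moreover have "k1 = i1 \<or> k2 = i2" "l1 = j1 \<or> l2 = j2"
    by (simp_all add: defs)
  ultimately have "k1 = i1 \<and> k2 = i2 \<and> l1 = j1 \<and> l2 = j2"
    by (rule pair_cell_determined)
  then show ?thesis
    by (simp add: defs split: if_splits)
qed

text \<open>The two crossings on strand 1 suffice: each carries a fixed outer label of both of its
  strands.\<close>

lemma triangle_unique:
  assumes "triangle e s t c w01 w02 w12 a0 a1 a2 m0 m1 m2 z0 z1 z2"
    and "triangle e s t c w01 w02 w12 a0 a1 a2 m0' m1' m2' z0 z1 z2"
  shows "m0 = m0' \<and> m1 = m1' \<and> m2 = m2'"
proof -
  note tri = assms[unfolded triangle_def]
  have "m0 = m0' \<and> m1 = m1'"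
    by (rule pair_cell_middle[OF conjunct1[OF tri(1)] conjunct1[OF tri(2)]])
  moreover have "m1 = m1' \<and> m2 = m2'"
  proof -
    \<comment> \<open>Brings the conditional into the shape of \<open>pair_cell_middle\<close>,
      where the first branch is the one with the middle label in front.\<close>
    have flip: "(if s = e then (a1, m) else (m, z1)) = (if s \<noteq> e then (m, z1) else (a1, m))" for m
      by simp
    show ?thesis
      by (rule pair_cell_middle[OF conjunct2[OF conjunct2[OF tri(1), unfolded flip]]
            conjunct2[OF conjunct2[OF tri(2), unfolded flip]]])
  qed
  ultimately show ?thesis
    by simp
qed

end

section \<open>Replacing a tangle\<close>

lemma strand_time_affine:
  "strand_time p u = (fst (snd p) + snd (snd p)) / 2 + u * (snd (snd p) - fst (snd p)) / 2"
  by (cases p) simp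

locale strands =
  fixes n :: nat and P :: "placement list"
  assumes bounds: "k < length P \<Longrightarrow> strand_comp (P ! k) < n \<and> 0 < fst (snd (P ! k)) \<and>
      fst (snd (P ! k)) < snd (snd (P ! k)) \<and> snd (snd (P ! k)) < 1"
    and strands_disjoint: "k < length P \<Longrightarrow> l < length P \<Longrightarrow> u \<in> {-1..1} \<Longrightarrow> v \<in> {-1..1} \<Longrightarrow>
      strand_comp (P ! k) = strand_comp (P ! l) \<Longrightarrow> strand_time (P ! k) u = strand_time (P ! l) v \<Longrightarrow>
      k = l \<and> u = v"
begin

text \<open>Time \<open>u\<close> of strand \<open>k\<close> within the period number
  \<open>m\<close> of its component; all periods occur because times are real numbers and not
  residues.\<close>

definition place :: "nat \<Rightarrow> int \<Rightarrow> real \<Rightarrow> real" where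
  "place k m u = strand_time (P ! k) u + of_int m"

lemma place_strict_mono:
  assumes "k < length P" shows "strict_mono (place k m)" "surj (place k m)"
proof -
  define a b where "a = fst (snd (P ! k))" "b = snd (snd (P ! k))"
  have ab: "b - a > 0"
    using bounds[OF assms] by (simp add: a_b_def)
  have eq: "place k m u = (a + b) / 2 + u * (b - a) / 2 + of_int m" for u
    by (simp add: place_def strand_time_affine a_b_def)
  show "strict_mono (place k m)"
    using ab by (intro strict_monoI) (simp add: eq)
  have "place k m ((2 * (y - of_int m) - a - b) / (b - a)) = y" for y
    using ab by (simp add: eq field_simps)
  then show "surj (place k m)"
    by (rule surjI)
qed

lemma strand_time_bounds:
  assumes "k < length P" "u \<in> {-1..1}"
  shows "fst (snd (P ! k)) \<le> strand_time (P ! k) u" "strand_time (P ! k) u \<le> snd (snd (P ! k))"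
proof -
  have "strict_mono (place k 0)"
    by (rule place_strict_mono(1)[OF assms(1)])
  then have "place k 0 (-1) \<le> place k 0 u" "place k 0 u \<le> place k 0 1"
    using assms(2) by (auto simp: strict_mono_less_eq)
  then show "fst (snd (P ! k)) \<le> strand_time (P ! k) u" "strand_time (P ! k) u \<le> snd (snd (P ! k))"
    by (simp_all add: place_def strand_time_affine field_simps)
qed

lemma frac_place:
  assumes "k < length P" "u \<in> {-1..1}"
  shows "frac (place k m u) = strand_time (P ! k) u" "\<lfloor>place k m u\<rfloor> = m"
proof -
  have "0 \<le> strand_time (P ! k) u" "strand_time (P ! k) u < 1"
    using strand_time_bounds[OF assms] bounds[OF assms(1)] by auto
  then show "frac (place k m u) = strand_time (P ! k) u" "\<lfloor>place k m u\<rfloor> = m"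
    by (auto simp: place_def frac_def floor_eq_iff)
qed

lemma place_unique:
  assumes "k < length P" "l < length P" "u \<in> {-1..1}" "v \<in> {-1..1}"
    "strand_comp (P ! k) = strand_comp (P ! l)" "place k m u = place l m' v"
  shows "k = l \<and> m = m' \<and> u = v"
  using strands_disjoint[OF assms(1-5)] frac_place[OF assms(1,3), of m] frac_place[OF assms(2,4), of m'] assms(6)
  by auto

lemma on_strands_iff:
  "on_strands P i t \<longleftrightarrow> (\<exists>k<length P. \<exists>m. \<exists>u\<in>{-1..1}. i = strand_comp (P ! k) \<and> t = place k m u)"
proof
  assume "on_strands P i t"
  then obtain c a b where P: "(c, a, b) \<in> set P" "i = c" "a \<le> frac t" "frac t \<le> b"
    by (auto simp: on_strands_def)
  then obtain k where k: "k < length P" "P ! k = (c, a, b)"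
    by (auto simp: in_set_conv_nth)
  have ab: "a < b"
    using bounds[OF k(1)] by (simp add: k(2))
  define u where "u = (2 * frac t - a - b) / (b - a)"
  have "u \<in> {-1..1}"
    using P ab by (auto simp: u_def field_simps)
  moreover have "strand_time (P ! k) u = frac t"
    using ab by (simp add: k(2) u_def field_simps)
  then have "t = place k \<lfloor>t\<rfloor> u"
    by (simp add: place_def frac_def)
  ultimately show "\<exists>k<length P. \<exists>m. \<exists>u\<in>{-1..1}. i = strand_comp (P ! k) \<and> t = place k m u"
    using k P by (intro exI[of _ k] conjI exI[of _ "\<lfloor>t\<rfloor>"] bexI[of _ u]) auto
next
  assume "\<exists>k<length P. \<exists>m. \<exists>u\<in>{-1..1}. i = strand_comp (P ! k) \<and> t = place k m u"
  then obtain k m u where k: "k < length P" "u \<in> {-1..1}" "i = strand_comp (P ! k)" "t = place k m u"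
    by blast
  have "frac t \<in> {fst (snd (P ! k))..snd (snd (P ! k))}"
    using strand_time_bounds[OF k(1,2)] frac_place[OF k(1,2)] k(4) by simp
  moreover have "P ! k = (i, fst (snd (P ! k)), snd (snd (P ! k)))"
    using k(3) by (cases "P ! k") simp
  ultimately show "on_strands P i t"
    using k(1) unfolding on_strands_def by (metis (mono_tags, lifting) case_prodI nth_mem)
qed

text \<open>The end points of the strands are left out: their labels belong to the outer part of a
  coloring, which a move keeps.\<close>

definition inside :: "nat \<Rightarrow> real \<Rightarrow> bool" where
  "inside i t \<longleftrightarrow> (\<exists>k<length P. \<exists>m. \<exists>u\<in>{-1<..<1}. i = strand_comp (P ! k) \<and> t = place k m u)"

lemma insideI: "k < length P \<Longrightarrow> -1 < u \<Longrightarrow> u < 1 \<Longrightarrow> inside (strand_comp (P ! k)) (place k m u)"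
  unfolding inside_def by (metis greaterThanLessThan_iff)

lemma inside_on_strands: "inside i t \<Longrightarrow> on_strands P i t"
  unfolding inside_def on_strands_iff by fastforce

lemma on_strands_place: "k < length P \<Longrightarrow> u \<in> {-1..1} \<Longrightarrow> on_strands P (strand_comp (P ! k)) (place k m u)"
  unfolding on_strands_iff by blast

lemma inside_place:
  assumes "k < length P" "u \<in> {-1..1}"
  shows "inside (strand_comp (P ! k)) (place k m u) \<longleftrightarrow> u \<in> {-1<..<1}"
proof
  assume "inside (strand_comp (P ! k)) (place k m u)"
  then obtain l m' v where "l < length P" "v \<in> {-1<..<1}" "strand_comp (P ! k) = strand_comp (P ! l)"
    "place k m u = place l m' v"
    unfolding inside_def by blast
  then have "u = v"
    using place_unique[of k l u v m m'] assms by auto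
  then show "u \<in> {-1<..<1}"
    using \<open>v \<in> {-1<..<1}\<close> by simp
qed (use assms in \<open>unfold inside_def, blast\<close>)

lemma place_shift: "place k m u + of_int m' = place k (m + m') u"
  by (simp add: place_def)

lemma inside_shift: "inside i (t + 1) \<longleftrightarrow> inside i t"
proof -
  have *: "inside i (t + of_int m)" if inside: "inside i t" for t m
  proof -
    obtain k m' u where "k < length P" "u \<in> {-1<..<1}" "i = strand_comp (P ! k)" "t = place k m' u"
      using inside unfolding inside_def by blast
    then show ?thesis
      using place_shift[of k m' u m] unfolding inside_def by blast
  qed
  show ?thesis
    using *[of t 1] *[of "t + 1" "-1"] by auto
qed

text \<open>The strands occupy finitely many disjoint closed intervals, so near an end of strand
  \<open>k\<close> no other strand can be met. The filter \<open>F\<close> stands for the side of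
  the end that leads out of strand \<open>k\<close>.\<close>

lemma off_strands_beside:
  assumes k: "k < length P" and P: "\<forall>\<^sub>F t in F. t \<notin> {fst (snd (P ! k))..snd (snd (P ! k))}"
    and F: "F \<le> nhds z" "z = fst (snd (P ! k)) \<or> z = snd (snd (P ! k))"
  shows "\<forall>\<^sub>F t in F. \<not> on_strands P (strand_comp (P ! k)) (t + of_int m)"
proof -
  have ends: "strand_time (P ! k) (-1) = fst (snd (P ! k))" "strand_time (P ! k) 1 = snd (snd (P ! k))"
    by (simp_all add: strand_time_affine field_simps)
  obtain e where e: "e = -1 \<or> e = 1" "z = strand_time (P ! k) e"
    using F(2) ends by metis
  have unit: "\<forall>\<^sub>F t in F. t \<in> {0<..<1}"
    by (rule filter_leD[OF F(1)], rule eventually_nhds_in_open) (use F(2) bounds[OF k] in auto)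
  have "\<forall>\<^sub>F t in F. \<not> (strand_comp (P ! l) = strand_comp (P ! k) \<and> t \<in> {fst (snd (P ! l))..snd (snd (P ! l))})"
    if l: "l < length P" for l
  proof (cases "l = k \<or> strand_comp (P ! l) \<noteq> strand_comp (P ! k)")
    case True
    then show ?thesis
      using P by auto
  next
    case False
    have "z \<notin> {fst (snd (P ! l))..snd (snd (P ! l))}"
    proof
      assume z: "z \<in> {fst (snd (P ! l))..snd (snd (P ! l))}"
      define a b where "a = fst (snd (P ! l))" "b = snd (snd (P ! l))"
      define v where "v = (2 * z - a - b) / (b - a)"
      have ab: "a < b"
        using bounds[OF l] by (simp add: a_b_def)
      have "a \<le> z" "z \<le> b"
        using z by (simp_all add: a_b_def)
      then have v: "v \<in> {-1..1}"
        using ab by (simp add: v_def pos_divide_le_eq pos_le_divide_eq)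
      have "strand_time (P ! l) v = (a + b) / 2 + v * (b - a) / 2"
        by (simp add: strand_time_affine a_b_def)
      moreover have "v * (b - a) = 2 * z - a - b"
        using ab by (simp add: v_def)
      ultimately have "strand_time (P ! l) v = z"
        by (simp add: field_simps)
      then show False
        using v strands_disjoint[OF k l, of e v] False e by auto
    qed
    then have "\<forall>\<^sub>F t in nhds z. t \<in> - {fst (snd (P ! l))..snd (snd (P ! l))}"
      by (intro eventually_nhds_in_open) auto
    then have "\<forall>\<^sub>F t in F. t \<in> - {fst (snd (P ! l))..snd (snd (P ! l))}"
      by (rule filter_leD[OF F(1)])
    then show ?thesis
      by eventually_elim simp
  qed
  then have "\<forall>\<^sub>F t in F. \<forall>l\<in>{..<length P}. \<not> (strand_comp (P ! l) = strand_comp (P ! k) \<and>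
      t \<in> {fst (snd (P ! l))..snd (snd (P ! l))})"
    by (intro eventually_ball_finite) auto
  then show ?thesis
    using unit
  proof eventually_elim
    case (elim t)
    have "frac (t + of_int m) = t"
      using elim(2) by (simp add: frac_def floor_eq_iff)
    then have "\<exists>l<length P. strand_comp (P ! l) = strand_comp (P ! k) \<and>
        t \<in> {fst (snd (P ! l))..snd (snd (P ! l))}" if on: "on_strands P (strand_comp (P ! k)) (t + of_int m)"
    proof -
      obtain c a b where "(c, a, b) \<in> set P" "strand_comp (P ! k) = c" "t \<in> {a..b}"
        using on \<open>frac (t + of_int m) = t\<close> by (auto simp: on_strands_def)
      moreover from this(1) obtain l where "l < length P" "P ! l = (c, a, b)"
        by (auto simp: in_set_conv_nth)
      ultimately show ?thesis
        by (intro exI[of _ l]) simp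
    qed
    then show ?case
      using elim(1) by blast
  qed
qed

lemma off_strands_before:
  assumes "k < length P"
  shows "\<forall>\<^sub>F t in at_left (place k m (-1)). \<not> on_strands P (strand_comp (P ! k)) t"
proof -
  define a where "a = fst (snd (P ! k))"
  have "place k m (-1) = a + of_int m"
    by (simp add: place_def strand_time_affine a_def field_simps)
  moreover have "\<forall>\<^sub>F t in at_left a. t \<notin> {fst (snd (P ! k))..snd (snd (P ! k))}"
    by (simp add: eventually_at_filter a_def)
  then have "\<forall>\<^sub>F t in at_left a. \<not> on_strands P (strand_comp (P ! k)) (t + of_int m)"
    by (rule off_strands_beside[OF assms, where z = a]) (auto simp: a_def at_within_def)
  ultimately show ?thesis
    using eventually_at_left_strict_mono[of "\<lambda>t. t + of_int m"]
    by (simp add: strict_mono_def surj_plus_right)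
qed

lemma off_strands_after:
  assumes "k < length P"
  shows "\<forall>\<^sub>F t in at_right (place k m 1). \<not> on_strands P (strand_comp (P ! k)) t"
proof -
  define b where "b = snd (snd (P ! k))"
  have "place k m 1 = b + of_int m"
    by (simp add: place_def strand_time_affine b_def field_simps)
  moreover have "\<forall>\<^sub>F t in at_right b. t \<notin> {fst (snd (P ! k))..snd (snd (P ! k))}"
    by (simp add: eventually_at_filter b_def)
  then have "\<forall>\<^sub>F t in at_right b. \<not> on_strands P (strand_comp (P ! k)) (t + of_int m)"
    by (rule off_strands_beside[OF assms, where z = b]) (auto simp: b_def at_within_def)
  ultimately show ?thesis
    using eventually_at_right_strict_mono[of "\<lambda>t. t + of_int m"]
    by (simp add: strict_mono_def surj_plus_right)
qed

text \<open>The two times are shifted by independent integers, as the crossing set of a diagram is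
  closed under integer shifts of either time.\<close>

definition placed :: "crossing set \<Rightarrow> crossing set" where
  "placed Q = {(strand_comp (P ! k), place k m u, strand_comp (P ! l), place l m' v, p) | k m u l m' v p.
     (k, u, l, v, p) \<in> Q}"

lemma placedI:
  "(k, u, l, v, p) \<in> Q \<Longrightarrow>
     (strand_comp (P ! k), place k m u, strand_comp (P ! l), place l m' v, p) \<in> placed Q"
  unfolding placed_def by (rule CollectI) (intro exI conjI, rule refl)

lemma placedE:
  assumes "(i, s, j, t, p) \<in> placed Q"
  obtains k m u l m' v where "i = strand_comp (P ! k)" "s = place k m u" "j = strand_comp (P ! l)"
    "t = place l m' v" "(k, u, l, v, p) \<in> Q"
  using assms unfolding placed_def by blast

end

section \<open>Colorings of a tangle, their ends, and gluing them into a diagram\<close>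

definition tangle_colorings ::
  "'a set \<Rightarrow> ('a \<Rightarrow> 'a \<Rightarrow> 'a) \<Rightarrow> ('a \<Rightarrow> 'a \<Rightarrow> 'a) \<Rightarrow> nat \<Rightarrow> crossing set \<Rightarrow> (nat \<Rightarrow> real \<Rightarrow> 'a) set" where
  "tangle_colorings X ut ot N Q =
     {c. (\<forall>k<N. \<forall>u\<in>{-1..1}. \<not> passes Q k u \<longrightarrow>
            c k u \<in> X \<and> (\<forall>\<^sub>F v in at u within {-1..1}. c k v = c k u)) \<and>
         (\<forall>k u l v p. (k, u, l, v, p) \<in> Q \<longrightarrow>
            crossing_rule ut ot p (left_value (c k) u) (right_value (c k) u)
              (left_value (c l) v) (right_value (c l) v))}"

definition same_ends :: "nat \<Rightarrow> (nat \<Rightarrow> real \<Rightarrow> 'a) \<Rightarrow> (nat \<Rightarrow> real \<Rightarrow> 'a) \<Rightarrow> bool" where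
  "same_ends N c c' \<longleftrightarrow> (\<forall>k<N. c k (-1) = c' k (-1) \<and> c k 1 = c' k 1)"

text \<open>Existence is demanded for \<open>Q'\<close> and uniqueness for \<open>Q\<close>; the
  property in both directions yields a bijection. Uniqueness concerns times in [-1, 1] off the
  crossings, since the other values of a tangle coloring are arbitrary.\<close>

definition tangle_replaceable ::
  "'a set \<Rightarrow> ('a \<Rightarrow> 'a \<Rightarrow> 'a) \<Rightarrow> ('a \<Rightarrow> 'a \<Rightarrow> 'a) \<Rightarrow> nat \<Rightarrow> crossing set \<Rightarrow> crossing set \<Rightarrow> bool" where
  "tangle_replaceable X ut ot N Q Q' \<longleftrightarrow>
     (\<forall>c\<in>tangle_colorings X ut ot N Q. \<exists>c'\<in>tangle_colorings X ut ot N Q'. same_ends N c c') \<and>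
     (\<forall>c\<in>tangle_colorings X ut ot N Q. \<forall>c'\<in>tangle_colorings X ut ot N Q. same_ends N c c' \<longrightarrow>
        (\<forall>k<N. \<forall>u\<in>{-1..1}. \<not> passes Q k u \<longrightarrow> c k u = c' k u))"

lemma tangle_replaceable_unique:
  assumes "tangle_replaceable X ut ot N Q Q'" "c \<in> tangle_colorings X ut ot N Q"
    "c' \<in> tangle_colorings X ut ot N Q" "same_ends N c c'" "k < N" "u \<in> {-1..1}" "\<not> passes Q k u"
  shows "c k u = c' k u"
  using assms unfolding tangle_replaceable_def by blast

lemma tangle_coloring_in:
  "c \<in> tangle_colorings X ut ot N Q \<Longrightarrow> k < N \<Longrightarrow> u \<in> {-1..1} \<Longrightarrow> \<not> passes Q k u \<Longrightarrow> c k u \<in> X"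
  unfolding tangle_colorings_def by blast

lemma tangle_coloring_local:
  "c \<in> tangle_colorings X ut ot N Q \<Longrightarrow> k < N \<Longrightarrow> u \<in> {-1..1} \<Longrightarrow> \<not> passes Q k u \<Longrightarrow>
     \<forall>\<^sub>F v in at u within {-1..1}. c k v = c k u"
  unfolding tangle_colorings_def by blast

lemma tangle_coloring_rule:
  "c \<in> tangle_colorings X ut ot N Q \<Longrightarrow> (k, u, l, v, p) \<in> Q \<Longrightarrow>
     crossing_rule ut ot p (left_value (c k) u) (right_value (c k) u)
       (left_value (c l) v) (right_value (c l) v)"
  unfolding tangle_colorings_def by blast

text \<open>Every crossing has either both of its times off the strands or both on them; this makes
  replacing the tangle a local operation. Openness in \<open>off_open\<close> ensures that a
  coloring is unchanged near an outer time.\<close>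

locale tangle_diagram = strands n P + crossing_pattern n R for n P R +
  fixes out Q
  assumes decomposed: "R = out \<union> placed Q"
    and out_off: "(i, s, j, t, p) \<in> out \<Longrightarrow> \<not> on_strands P i s \<and> \<not> on_strands P j t"
    and tangle_inside: "(k, u, l, v, p) \<in> Q \<Longrightarrow> k < length P \<and> l < length P \<and> u \<in> {-1<..<1} \<and> v \<in> {-1<..<1}"
    and off_open: "i < n \<Longrightarrow> \<not> on_strands P i t \<Longrightarrow> \<forall>\<^sub>F u in nhds t. \<not> on_strands P i u"
begin

lemma comp_less: "k < length P \<Longrightarrow> strand_comp (P ! k) < n"
  using bounds by blast

lemma placed_inside: "(i, s, j, t, p) \<in> placed Q \<Longrightarrow> inside i s \<and> inside j t"
  by (erule placedE) (simp add: insideI tangle_inside[simplified])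

lemma passes_not_inside:
  assumes "\<not> inside i t"
  shows "passes R i t \<longleftrightarrow> passes out i t"
proof
  assume "passes R i t"
  then obtain j s p where *: "(i, t, j, s, p) \<in> R \<or> (j, s, i, t, p) \<in> R"
    by (auto simp: passes_def)
  then have "(i, t, j, s, p) \<in> out \<or> (j, s, i, t, p) \<in> out"
    using placed_inside assms unfolding decomposed by blast
  then show "passes out i t"
    by (auto simp: passes_def)
qed (auto simp: passes_def decomposed)

lemma passes_place:
  assumes k: "k < length P" and u: "u \<in> {-1..1}"
  shows "passes R (strand_comp (P ! k)) (place k m u) \<longleftrightarrow> passes Q k u"
proof
  assume "passes R (strand_comp (P ! k)) (place k m u)"
  then obtain j s p where *: "(strand_comp (P ! k), place k m u, j, s, p) \<in> R \<or> (j, s, strand_comp (P ! k), place k m u, p) \<in> R"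
    by (auto simp: passes_def)
  have "(strand_comp (P ! k), place k m u, j, s, p) \<notin> out" "(j, s, strand_comp (P ! k), place k m u, p) \<notin> out"
    using out_off on_strands_place[OF k u] by blast+
  then consider "(strand_comp (P ! k), place k m u, j, s, p) \<in> placed Q" | "(j, s, strand_comp (P ! k), place k m u, p) \<in> placed Q"
    using * by (auto simp: decomposed)
  then show "passes Q k u"
  proof cases
    case 1
    then obtain k' m' u' l v where Q: "strand_comp (P ! k) = strand_comp (P ! k')" "place k m u = place k' m' u'"
      "(k', u', l, v, p) \<in> Q"
      by (rule placedE)
    then have "k = k' \<and> m = m' \<and> u = u'"
      using tangle_inside[OF Q(3)] by (intro place_unique k u) auto
    then show ?thesis
      using Q by (auto simp: passes_def)
  next
    case 2
    then obtain k' m' u' l v where Q: "strand_comp (P ! k) = strand_comp (P ! k')" "place k m u = place k' m' u'"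
      "(l, v, k', u', p) \<in> Q"
      by (rule placedE)
    then have "k = k' \<and> m = m' \<and> u = u'"
      using tangle_inside[OF Q(3)] by (intro place_unique k u) auto
    then show ?thesis
      using Q by (auto simp: passes_def)
  qed
next
  assume "passes Q k u"
  then obtain l v p where "(k, u, l, v, p) \<in> Q \<or> (l, v, k, u, p) \<in> Q"
    by (auto simp: passes_def)
  then have "(strand_comp (P ! k), place k m u, strand_comp (P ! l), place l 0 v, p) \<in> R \<or>
     (strand_comp (P ! l), place l 0 v, strand_comp (P ! k), place k m u, p) \<in> R"
    using placedI decomposed by auto
  then show "passes R (strand_comp (P ! k)) (place k m u)"
    unfolding passes_def by blast
qed

lemma isolated_tangle:
  assumes k: "k < length P" and u: "u \<in> {-1..1}"
  shows "\<forall>\<^sub>F v in at u. v \<in> {-1..1} \<longrightarrow> \<not> passes Q k v"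
proof -
  have "\<forall>\<^sub>F t in at (place k 0 u). \<not> passes R (strand_comp (P ! k)) t"
    by (rule isolated[OF comp_less[OF k]])
  then have "\<forall>\<^sub>F v in at u. \<not> passes R (strand_comp (P ! k)) (place k 0 v)"
    by (simp add: eventually_at_strict_mono place_strict_mono k)
  then show ?thesis
    by eventually_elim (use passes_place[OF k] in blast)
qed

lemma restrict_closed:
  assumes f: "f \<in> time_colorings X ut ot n R"
  shows "(\<lambda>k u. f (strand_comp (P ! k)) (place k 0 u)) \<in> tangle_colorings X ut ot (length P) Q"
  unfolding tangle_colorings_def
proof (rule CollectI, intro conjI allI impI ballI)
  fix k u assume k: "k < length P" and u: "u \<in> {-1..1::real}" and np: "\<not> passes Q k u"
  have np': "\<not> passes R (strand_comp (P ! k)) (place k 0 u)"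
    using np passes_place[OF k u] by blast
  show "f (strand_comp (P ! k)) (place k 0 u) \<in> X"
    by (rule time_coloring_in[OF f comp_less[OF k] np'])
  have "\<forall>\<^sub>F v in at u. f (strand_comp (P ! k)) (place k 0 v) = f (strand_comp (P ! k)) (place k 0 u)"
    using time_coloring_local[OF f comp_less[OF k] np'] by (simp add: eventually_at_strict_mono place_strict_mono k)
  then show "\<forall>\<^sub>F v in at u within {-1..1}. f (strand_comp (P ! k)) (place k 0 v) = f (strand_comp (P ! k)) (place k 0 u)"
    by (rule filter_leD[OF at_le, rotated]) simp
next
  fix k u l v p assume Q: "(k, u, l, v, p) \<in> Q"
  then have kl: "k < length P" "l < length P"
    using tangle_inside by blast+
  have "(strand_comp (P ! k), place k 0 u, strand_comp (P ! l), place l 0 v, p) \<in> R"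
    using placedI[OF Q] by (simp add: decomposed)
  from time_coloring_rule[OF f this]
  show "crossing_rule ut ot p (left_value (\<lambda>u. f (strand_comp (P ! k)) (place k 0 u)) u)
      (right_value (\<lambda>u. f (strand_comp (P ! k)) (place k 0 u)) u)
      (left_value (\<lambda>u. f (strand_comp (P ! l)) (place l 0 u)) v)
      (right_value (\<lambda>u. f (strand_comp (P ! l)) (place l 0 u)) v)"
    by (simp add: left_value_strict_mono right_value_strict_mono place_strict_mono kl)
qed

text \<open>Equality outside includes the ends of the strands, and these determine the labels
  between them. Periodicity reduces all copies of a strand to the one in period 0.\<close>

lemma eq_if_eq_outside:
  assumes f: "f \<in> time_colorings X ut ot n R" and g: "g \<in> time_colorings X ut ot n R"
    and eq: "\<And>i t. \<not> inside i t \<Longrightarrow> f i t = g i t"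
    and unique: "\<And>c c' k u. c \<in> tangle_colorings X ut ot (length P) Q \<Longrightarrow>
      c' \<in> tangle_colorings X ut ot (length P) Q \<Longrightarrow> same_ends (length P) c c' \<Longrightarrow>
      k < length P \<Longrightarrow> u \<in> {-1..1} \<Longrightarrow> \<not> passes Q k u \<Longrightarrow> c k u = c' k u"
  shows "f = g"
proof (intro ext)
  fix i t
  show "f i t = g i t"
  proof (cases "inside i t \<and> \<not> passes R i t")
    case False
    then show ?thesis
      using eq time_coloring_undefined[OF f] time_coloring_undefined[OF g] by metis
  next
    case True
    then obtain k m u where k: "k < length P" "u \<in> {-1<..<1}" "i = strand_comp (P ! k)" "t = place k m u"
      unfolding inside_def by blast
    then have u: "u \<in> {-1..1}"
      by auto
    have "same_ends (length P) (\<lambda>k u. f (strand_comp (P ! k)) (place k 0 u)) (\<lambda>k u. g (strand_comp (P ! k)) (place k 0 u))"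
      unfolding same_ends_def using eq inside_place[of _ "-1"] inside_place[of _ 1] by auto
    then have "f (strand_comp (P ! k)) (place k 0 u) = g (strand_comp (P ! k)) (place k 0 u)"
      using True k by (intro unique[OF restrict_closed[OF f] restrict_closed[OF g] _ k(1) u]) (auto simp: passes_place[OF k(1) u])
    then show ?thesis
      using time_coloring_shift[OF f comp_less[OF k(1)], of "place k 0 u" m]
        time_coloring_shift[OF g comp_less[OF k(1)], of "place k 0 u" m] k
      by (simp add: place_shift)
  qed
qed

end

locale tangle_exchange =
  old: tangle_diagram n P R out Q + new: tangle_diagram n P R' out Q' for n P R R' out Q Q'
begin

text \<open>Disjointness of the strands makes the pair chosen by \<open>SOME\<close> unique, so
  \<open>c\<close> is read on the right strand at the right time.\<close>

definition glue :: "(nat \<Rightarrow> real \<Rightarrow> 'a) \<Rightarrow> (nat \<Rightarrow> real \<Rightarrow> 'a) \<Rightarrow> nat \<Rightarrow> real \<Rightarrow> 'a" where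
  "glue f c i t =
     (if i < n \<and> \<not> passes R' i t then
        if old.inside i t then
          (let (k, u) = (SOME (k, u). k < length P \<and> u \<in> {-1<..<1} \<and> i = strand_comp (P ! k) \<and> (\<exists>m. t = old.place k m u)) in c k u)
        else f i t
      else undefined)"

lemma glue_inside:
  assumes k: "k < length P" and u: "u \<in> {-1<..<1}" and np: "\<not> passes Q' k u"
  shows "glue f c (strand_comp (P ! k)) (old.place k m u) = c k u"
proof -
  let ?P = "\<lambda>(l, v). l < length P \<and> v \<in> {-1<..<1} \<and> strand_comp (P ! k) = strand_comp (P ! l) \<and>
     (\<exists>m'. old.place k m u = old.place l m' v)"
  obtain l v where lv: "(SOME x. ?P x) = (l, v)"
    by fastforce
  have "?P (SOME x. ?P x)"
    by (rule someI[of ?P "(k, u)"]) (use k u in blast)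
  then obtain m' where P: "l < length P" "v \<in> {-1<..<1}" "strand_comp (P ! k) = strand_comp (P ! l)"
     "old.place k m u = old.place l m' v"
    unfolding lv by blast
  have u': "u \<in> {-1..1}"
    using u by auto
  have "k = l \<and> m = m' \<and> u = v"
    using P(2) by (intro old.place_unique k u' P) auto
  moreover have "\<not> passes R' (strand_comp (P ! k)) (old.place k m u)"
    using np new.passes_place[OF k u'] by blast
  moreover have "old.inside (strand_comp (P ! k)) (old.place k m u)"
    using u by (intro old.insideI k) auto
  ultimately show ?thesis
    using lv old.comp_less[OF k] by (simp add: glue_def)
qed

lemma glue_outside:
  assumes f: "f \<in> time_colorings X ut ot n R" and "\<not> old.inside i t"
  shows "glue f c i t = f i t"
proof (cases "i < n \<and> \<not> passes R' i t")
  case True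
  then show ?thesis
    using assms(2) by (simp add: glue_def)
next
  case False
  then have "\<not> (i < n \<and> \<not> passes R i t)"
    using old.passes_not_inside[OF assms(2)] new.passes_not_inside[OF assms(2)] by blast
  then have "f i t = undefined"
    by (rule time_coloring_undefined[OF f])
  then show ?thesis
    using False unfolding glue_def by presburger
qed

context
  fixes X :: "'a set" and ut ot f c
  assumes f: "f \<in> time_colorings X ut ot n R"
    and c: "c \<in> tangle_colorings X ut ot (length P) Q'"
    and ends: "same_ends (length P) (\<lambda>k u. f (strand_comp (P ! k)) (old.place k 0 u)) c"
begin

lemma glue_end:
  assumes k: "k < length P" and e: "e = -1 \<or> e = 1"
  shows "glue f c (strand_comp (P ! k)) (old.place k m e) = c k e"
proof -
  have "\<not> old.inside (strand_comp (P ! k)) (old.place k m e)"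
    using old.inside_place[OF k, of e m] e by auto
  then have "glue f c (strand_comp (P ! k)) (old.place k m e) = f (strand_comp (P ! k)) (old.place k m e)"
    by (rule glue_outside[OF f])
  also have "\<dots> = f (strand_comp (P ! k)) (old.place k 0 e)"
    using time_coloring_shift[OF f old.comp_less[OF k], of "old.place k 0 e" m] by (simp add: old.place_shift)
  also have "\<dots> = c k e"
    using ends k e by (auto simp: same_ends_def)
  finally show ?thesis .
qed

lemma glue_on_strand:
  assumes k: "k < length P" and u: "u \<in> {-1..1}" and np: "\<not> passes Q' k u"
  shows "glue f c (strand_comp (P ! k)) (old.place k m u) = c k u"
proof (cases "u \<in> {-1<..<1}")
  case True
  then show ?thesis
    by (rule glue_inside[OF k _ np])
next
  case False
  then show ?thesis
    using u by (intro glue_end k) auto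
qed

lemma glue_near_inside:
  assumes k: "k < length P" and u: "u \<in> {-1<..<1}"
  shows "\<forall>\<^sub>F v in at u. glue f c (strand_comp (P ! k)) (old.place k m v) = c k v"
proof -
  have "\<forall>\<^sub>F v in at u. v \<in> {-1<..<1}"
    by (rule eventually_at_in_open') (use u in auto)
  moreover have "\<forall>\<^sub>F v in at u. v \<in> {-1..1} \<longrightarrow> \<not> passes Q' k v"
    using u by (intro new.isolated_tangle k) auto
  ultimately show ?thesis
  proof eventually_elim
    case (elim v)
    then show ?case
      using glue_inside[OF k, of v f c m] by simp
  qed
qed

lemma glue_off_strands:
  assumes "i < n" "\<not> on_strands P i t"
  shows "\<forall>\<^sub>F u in nhds t. glue f c i u = f i u"
  using old.off_open[OF assms] by eventually_elim (use glue_outside[OF f] old.inside_on_strands in blast)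

text \<open>The only place where the two functions touch: on one side of an end the result follows
  \<open>f\<close>, on the other side \<open>c\<close>. Both are locally constant there and have the
  same value at the end.\<close>

lemma glue_end_local:
  assumes k: "k < length P" and e: "e = -1 \<or> e = 1"
  shows "\<forall>\<^sub>F t in at (old.place k m e). glue f c (strand_comp (P ! k)) t = c k e"
proof -
  let ?i = "strand_comp (P ! k)"
  have eX: "e \<in> {-1..1}"
    using e by auto
  have npQ': "\<not> passes Q' k e"
    using new.tangle_inside e unfolding passes_def by fastforce
  have notin: "\<not> old.inside ?i (old.place k m e)"
    using old.inside_place[OF k, of e m] e by auto
  then have npR: "\<not> passes R ?i (old.place k m e)"
    using old.passes_not_inside new.passes_not_inside new.passes_place[OF k eX] npQ' by blast
  have "f ?i (old.place k m e) = c k e"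
    using glue_outside[OF f notin] glue_end[OF k e] by metis
  then have fl: "\<forall>\<^sub>F t in at (old.place k m e). f ?i t = c k e"
    using time_coloring_local[OF f old.comp_less[OF k] npR] by simp
  have cl: "\<forall>\<^sub>F v in at e within {-1..1}. c k v = c k e"
    by (rule tangle_coloring_local[OF c k eX npQ'])
  have iso: "\<forall>\<^sub>F v in at e. v \<in> {-1..1} \<longrightarrow> \<not> passes Q' k v"
    by (rule new.isolated_tangle[OF k eX])
  show ?thesis
    using e
  proof
    assume e: "e = -1"
    have "\<forall>\<^sub>F t in at_left (old.place k m e). glue f c ?i t = c k e"
    proof -
      have "\<forall>\<^sub>F t in at_left (old.place k m e). f ?i t = c k e"
        using fl by (simp add: eventually_at_split)
      moreover have "\<forall>\<^sub>F t in at_left (old.place k m e). \<not> on_strands P ?i t"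
        unfolding e by (rule old.off_strands_before[OF k])
      ultimately show ?thesis
        by eventually_elim (use glue_outside[OF f] old.inside_on_strands in metis)
    qed
    moreover have "\<forall>\<^sub>F t in at_right (old.place k m e). glue f c ?i t = c k e"
      unfolding eventually_at_right_strict_mono[OF old.place_strict_mono[OF k]]
    proof -
      have "\<forall>\<^sub>F v in at_right e. c k v = c k e"
        using cl unfolding e by (simp add: at_within_Icc_at_right)
      moreover have "\<forall>\<^sub>F v in at_right e. v \<in> {-1..1} \<longrightarrow> \<not> passes Q' k v"
        using iso by (simp add: eventually_at_split)
      moreover have "\<forall>\<^sub>F v in at_right e. v \<in> {-1<..<1}"
        unfolding e by (rule eventually_at_rightI[of _ 1]) auto
      ultimately show "\<forall>\<^sub>F v in at_right e. glue f c ?i (old.place k m v) = c k e"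
      proof eventually_elim
        case (elim v)
        then show ?case
          using glue_inside[OF k, of v f c m] by simp
      qed
    qed
    ultimately show ?thesis
      by (simp add: eventually_at_split)
  next
    assume e: "e = 1"
    have "\<forall>\<^sub>F t in at_right (old.place k m e). glue f c ?i t = c k e"
    proof -
      have "\<forall>\<^sub>F t in at_right (old.place k m e). f ?i t = c k e"
        using fl by (simp add: eventually_at_split)
      moreover have "\<forall>\<^sub>F t in at_right (old.place k m e). \<not> on_strands P ?i t"
        unfolding e by (rule old.off_strands_after[OF k])
      ultimately show ?thesis
        by eventually_elim (use glue_outside[OF f] old.inside_on_strands in metis)
    qed
    moreover have "\<forall>\<^sub>F t in at_left (old.place k m e). glue f c ?i t = c k e"
      unfolding eventually_at_left_strict_mono[OF old.place_strict_mono[OF k]]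
    proof -
      have "\<forall>\<^sub>F v in at_left e. c k v = c k e"
        using cl unfolding e by (simp add: at_within_Icc_at_left)
      moreover have "\<forall>\<^sub>F v in at_left e. v \<in> {-1..1} \<longrightarrow> \<not> passes Q' k v"
        using iso by (simp add: eventually_at_split)
      moreover have "\<forall>\<^sub>F v in at_left e. v \<in> {-1<..<1}"
        unfolding e by (rule eventually_at_leftI[of "-1"]) auto
      ultimately show "\<forall>\<^sub>F v in at_left e. glue f c ?i (old.place k m v) = c k e"
      proof eventually_elim
        case (elim v)
        then show ?case
          using glue_inside[OF k, of v f c m] by simp
      qed
    qed
    ultimately show ?thesis
      by (simp add: eventually_at_split)
  qed
qed

text \<open>Off the strands the result is locally \<open>f\<close>, on the open strands it is
  \<open>c\<close> up to the affine placement away from crossing times, and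
  \<open>glue_end_local\<close> joins the two; every condition is inherited from one of
  them.\<close>

lemma glue_closed: "glue f c \<in> time_colorings X ut ot n R'"
  unfolding time_colorings_def
proof (rule CollectI, intro conjI allI impI)
  fix i t
  show "if i < n \<and> \<not> passes R' i t then glue f c i t \<in> X else glue f c i t = undefined"
  proof (cases "i < n \<and> \<not> passes R' i t")
    case False
    then show ?thesis
      unfolding glue_def by presburger
  next
    case np: True
    have "glue f c i t \<in> X"
    proof (cases "old.inside i t")
      case False
      then show ?thesis
        using np time_coloring_in[OF f] glue_outside[OF f False]
          old.passes_not_inside[OF False] new.passes_not_inside[OF False] by simp
    next
      case True
      then obtain k m u where k: "k < length P" "u \<in> {-1<..<1}" "i = strand_comp (P ! k)" "t = old.place k m u"
        unfolding old.inside_def by blast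
      then have u: "u \<in> {-1..1}"
        by auto
      have "\<not> passes Q' k u"
        using np new.passes_place[OF k(1) u] k by blast
      then show ?thesis
        using tangle_coloring_in[OF c k(1) u] by (simp add: glue_inside[OF k(1,2)] k(3,4))
    qed
    with np show ?thesis
      by simp
  qed
next
  fix i t assume i: "i < n"
  show "glue f c i (t + 1) = glue f c i t"
  proof (cases "old.inside i t")
    case False
    then have "glue f c i (t + 1) = f i (t + 1)" "glue f c i t = f i t"
      by (simp_all only: glue_outside[OF f] old.inside_shift not_False_eq_True)
    then show ?thesis
      using time_coloring_shift[OF f i, of t 1] by simp
  next
    case True
    then obtain k m u where k: "k < length P" "u \<in> {-1<..<1}" "i = strand_comp (P ! k)" "t = old.place k m u"
      unfolding old.inside_def by blast
    have shift: "t + 1 = old.place k (m + 1) u"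
      using old.place_shift[of k m u 1] k by simp
    show ?thesis
    proof (cases "passes Q' k u")
      case True
      have u: "u \<in> {-1..1}"
        using k by auto
      have "passes R' i t" "passes R' i (t + 1)"
        unfolding shift using True new.passes_place[OF k(1) u] k by auto
      then show ?thesis
        by (simp add: glue_def)
    next
      case False
      then show ?thesis
        unfolding shift by (simp add: glue_inside[OF k(1,2)] k(3,4))
    qed
  qed
next
  fix i t assume i: "i < n" and np: "\<not> passes R' i t"
  show "\<forall>\<^sub>F u in at t. glue f c i u = glue f c i t"
  proof (cases "on_strands P i t")
    case False
    have near: "\<forall>\<^sub>F u in at t. glue f c i u = f i u"
      using glue_off_strands[OF i False] by (rule filter_leD[rotated]) (simp add: at_within_def)
    have notin: "\<not> old.inside i t"
      using False old.inside_on_strands by blast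
    have "\<forall>\<^sub>F u in at t. f i u = f i t"
      using np old.passes_not_inside[OF notin] new.passes_not_inside[OF notin]
      by (intro time_coloring_local[OF f i]) simp
    with near show ?thesis
      by eventually_elim (simp add: glue_outside[OF f notin])
  next
    case True
    then obtain k m u where k: "k < length P" "u \<in> {-1..1}" "i = strand_comp (P ! k)" "t = old.place k m u"
      unfolding old.on_strands_iff by blast
    have npQ': "\<not> passes Q' k u"
      using np new.passes_place[OF k(1,2)] k by blast
    have eq: "glue f c i t = c k u"
      unfolding k using glue_on_strand[OF k(1,2) npQ'] .
    show ?thesis
    proof (cases "u \<in> {-1<..<1}")
      case True
      have "at u within {-1..1} = at u"
        using True by (intro at_within_interior) auto
      then have "\<forall>\<^sub>F v in at u. c k v = c k u"
        using tangle_coloring_local[OF c k(1,2) npQ'] by simp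
      with glue_near_inside[OF k(1) True, of m]
      have "\<forall>\<^sub>F v in at u. glue f c (strand_comp (P ! k)) (old.place k m v) = c k u"
        by eventually_elim simp
      then have "\<forall>\<^sub>F s in at t. glue f c i s = c k u"
        unfolding k(3,4) eventually_at_strict_mono[OF old.place_strict_mono[OF k(1)]] .
      then show ?thesis
        by (simp add: eq)
    next
      case False
      then have "u = -1 \<or> u = 1"
        using k(2) by auto
      then show ?thesis
        using glue_end_local[OF k(1), of u m] by (simp add: eq flip: k(3,4))
    qed
  qed
next
  fix i s j t p assume R: "(i, s, j, t, p) \<in> R'"
  show "crossing_rule ut ot p (left_value (glue f c i) s) (right_value (glue f c i) s)
     (left_value (glue f c j) t) (right_value (glue f c j) t)"
  proof (cases "(i, s, j, t, p) \<in> out")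
    case True
    have sides: "left_value (glue f c i) s = left_value (f i) s \<and> right_value (glue f c i) s = right_value (f i) s"
      if "i < n" "\<not> on_strands P i s" for i s
    proof
      have "\<forall>\<^sub>F u in at s. glue f c i u = f i u"
        using glue_off_strands[OF that] by (rule filter_leD[rotated]) (simp add: at_within_def)
      then have "\<forall>\<^sub>F u in at_left s. glue f c i u = f i u" "\<forall>\<^sub>F u in at_right s. glue f c i u = f i u"
        by (simp_all add: eventually_at_split)
      then show "left_value (glue f c i) s = left_value (f i) s" "right_value (glue f c i) s = right_value (f i) s"
        by (simp_all add: left_value_cong right_value_cong)
    qed
    have "(i, s, j, t, p) \<in> R"
      using True by (simp add: old.decomposed)
    then show ?thesis
      using time_coloring_rule[OF f, of i s j t p] sides[of i s] sides[of j t] old.out_off[OF True]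
        new.components[OF R] by simp
  next
    case False
    then have "(i, s, j, t, p) \<in> old.placed Q'"
      using R by (simp add: new.decomposed)
    then obtain k m u l m' v where kl: "i = strand_comp (P ! k)" "s = old.place k m u" "j = strand_comp (P ! l)"
      "t = old.place l m' v" "(k, u, l, v, p) \<in> Q'"
      by (rule old.placedE)
    have in': "k < length P" "l < length P" "u \<in> {-1<..<1}" "v \<in> {-1<..<1}"
      using new.tangle_inside[OF kl(5)] by auto
    have sides: "left_value (glue f c (strand_comp (P ! k))) (old.place k m u) = left_value (c k) u \<and>
        right_value (glue f c (strand_comp (P ! k))) (old.place k m u) = right_value (c k) u"
      if k: "k < length P" and u: "u \<in> {-1<..<1}" for k m u
    proof
      have "\<forall>\<^sub>F v in at_left u. glue f c (strand_comp (P ! k)) (old.place k m v) = c k v"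
        "\<forall>\<^sub>F v in at_right u. glue f c (strand_comp (P ! k)) (old.place k m v) = c k v"
        using glue_near_inside[OF k u, of m] by (simp_all add: eventually_at_split)
      then show "left_value (glue f c (strand_comp (P ! k))) (old.place k m u) = left_value (c k) u"
        "right_value (glue f c (strand_comp (P ! k))) (old.place k m u) = right_value (c k) u"
        by (simp_all add: left_value_strict_mono right_value_strict_mono old.place_strict_mono k
            left_value_cong right_value_cong)
    qed
    show ?thesis
      using tangle_coloring_rule[OF c kl(5)] sides[OF in'(1,3)] sides[OF in'(2,4)] by (simp add: kl)
  qed
qed

end

end

lemma same_time_colorings_exchange:
  fixes X :: "'a set"
  assumes "tangle_exchange n P R R' out Q Q'"
    and repl: "tangle_replaceable X ut ot (length P) Q Q'" "tangle_replaceable X ut ot (length P) Q' Q"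
  shows "same_time_colorings X ut ot n R n R'"
proof -
  interpret tangle_exchange n P R R' out Q Q'
    by fact
  interpret swap: tangle_exchange n P R' R out Q' Q
    by unfold_locales
  \<comment> \<open>Colorings correspond if they agree outside the open strands. The crossing times
    there are the same for \<open>R\<close> and \<open>R'\<close>, so \<open>act\<close> respects
    the relation.\<close>
  let ?r = "\<lambda>f g :: nat \<Rightarrow> real \<Rightarrow> 'a. \<forall>i t. \<not> old.inside i t \<longrightarrow> f i t = g i t"
  show ?thesis
  proof (rule same_time_coloringsI[where r = ?r])
    show "crossing_pattern n R" "crossing_pattern n R'"
      by unfold_locales
    show "\<exists>g\<in>time_colorings X ut ot n R'. ?r f g" if f: "f \<in> time_colorings X ut ot n R" for f
    proof -
      obtain c where c: "c \<in> tangle_colorings X ut ot (length P) Q'"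
          "same_ends (length P) (\<lambda>k u. f (strand_comp (P ! k)) (old.place k 0 u)) c"
        using repl(1) old.restrict_closed[OF f] unfolding tangle_replaceable_def by blast
      show ?thesis
        using glue_closed[OF f c] glue_outside[OF f] by (intro bexI[of _ "glue f c"]) auto
    qed
    show "\<exists>f\<in>time_colorings X ut ot n R. ?r f g" if g: "g \<in> time_colorings X ut ot n R'" for g
    proof -
      obtain c where c: "c \<in> tangle_colorings X ut ot (length P) Q"
          "same_ends (length P) (\<lambda>k u. g (strand_comp (P ! k)) (old.place k 0 u)) c"
        using repl(2) new.restrict_closed[OF g] unfolding tangle_replaceable_def by blast
      show ?thesis
        using swap.glue_closed[OF g c] swap.glue_outside[OF g] by (intro bexI[of _ "swap.glue g c"]) auto
    qed
    show "g = g'" if "g \<in> time_colorings X ut ot n R'" "g' \<in> time_colorings X ut ot n R'" "?r f g" "?r f g'" for f g g'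
    proof (rule new.eq_if_eq_outside[OF that(1,2)])
      show "g i t = g' i t" if "\<not> old.inside i t" for i t
        using \<open>?r f g\<close> \<open>?r f g'\<close> that by metis
    qed (rule tangle_replaceable_unique[OF repl(2)])
    show "f = f'" if "f \<in> time_colorings X ut ot n R" "f' \<in> time_colorings X ut ot n R" "?r f g" "?r f' g" for f f' g
    proof (rule old.eq_if_eq_outside[OF that(1,2)])
      show "f i t = f' i t" if "\<not> old.inside i t" for i t
        using \<open>?r f g\<close> \<open>?r f' g\<close> that by metis
    qed (rule tangle_replaceable_unique[OF repl(1)])
    show "?r (act n R \<alpha> f) (act n R' \<alpha> g)" if "?r f g" for f g \<alpha>
      using that old.passes_not_inside new.passes_not_inside by (simp add: act_def)
  qed
qed

section \<open>From a tangle shown in a disc to the crossings of the diagram\<close>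

definition tangle_crossings :: "real \<Rightarrow> over_rule \<Rightarrow> tangle \<Rightarrow> crossing set" where
  "tangle_crossings \<kappa> W T =
     {(k, u, l, v, p). k < length T \<and> l < length T \<and> u \<in> {-1..1} \<and> v \<in> {-1..1} \<and>
        (k, u) \<noteq> (l, v) \<and> (T ! k) u = (T ! l) v \<and> W (k, u) (l, v) \<and>
        (p \<longleftrightarrow> \<kappa> * det2 (vector_derivative (T ! k) (at u)) (vector_derivative (T ! l) (at v)) > 0)}"

text \<open>An end that meets nothing else keeps all crossings within the open strands and, once the
  tangle is placed, keeps the parameter intervals of its strands apart.\<close>

definition proper_tangle :: "tangle \<Rightarrow> bool" where
  "proper_tangle T \<longleftrightarrow>
     (\<forall>k<length T. \<forall>u. (T ! k) differentiable (at u)) \<and>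
     (\<forall>k<length T. \<forall>l<length T. \<forall>u\<in>{-1, 1}. \<forall>v\<in>{-1..1}. (T ! k) u = (T ! l) v \<longrightarrow> k = l \<and> u = v)"

lemma strand_time_onto:
  assumes "fst (snd q) < snd (snd q)" "fst (snd q) \<le> x" "x \<le> snd (snd q)"
  shows "\<exists>u\<in>{-1..1}. strand_time q u = x"
proof -
  define a b where "a = fst (snd q)" "b = snd (snd q)"
  define u where "u = (2 * x - a - b) / (b - a)"
  have ab: "a < b" "a \<le> x" "x \<le> b"
    using assms by (auto simp: a_b_def)
  then have "u \<in> {-1..1}"
    by (simp add: u_def pos_divide_le_eq pos_le_divide_eq)
  moreover have "strand_time q u = (a + b) / 2 + u * (b - a) / 2"
    by (simp add: strand_time_affine a_b_def)
  moreover have "u * (b - a) = 2 * x - a - b"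
    using ab by (simp add: u_def)
  ultimately show ?thesis
    by (intro bexI[of _ u]) (simp_all add: field_simps)
qed

lemma strand_time_range:
  assumes "fst (snd q) < snd (snd q)" "u \<in> {-1..1}"
  shows "fst (snd q) \<le> strand_time q u \<and> strand_time q u \<le> snd (snd q)"
proof -
  define a b where "a = fst (snd q)" "b = snd (snd q)"
  have "b - a > 0"
    using assms by (simp add: a_b_def)
  then have "- (b - a) \<le> u * (b - a)" "u * (b - a) \<le> b - a"
    using mult_right_mono[of "-1" u "b - a"] mult_right_mono[of u 1 "b - a"] assms(2) by auto
  then show ?thesis
    by (simp add: strand_time_affine field_simps flip: a_b_def)
qed

lemma strand_time_inj:
  assumes "fst (snd q) < snd (snd q)" "strand_time q u = strand_time q v"
  shows "u = v"
  using assms by (simp add: strand_time_affine)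

lemma strand_time_start [simp]: "strand_time q (-1) = fst (snd q)"
  by (simp add: strand_time_affine field_simps)

lemma sign_mult_iff:
  fixes \<kappa> d e :: real
  assumes "\<kappa> = 1 \<or> \<kappa> = -1" "\<kappa> * d > 0"
  shows "d * e > 0 \<longleftrightarrow> \<kappa> * e > 0"
  using assms by (auto simp: zero_less_mult_iff)

text \<open>\<kappa> is the constant sign of the Jacobian determinant of \<phi>; it is -1 if the
  disc shows the mirror image of the model.\<close>

locale shown_tangle =
  fixes \<phi> :: "complex \<Rightarrow> complex" and \<phi>' \<kappa> P W T D
  assumes diagram: "link_diagram D"
    and shown: "shows_tangle \<phi> P W T D"
    and proper: "proper_tangle T"
    and inj: "inj \<phi>"
    and deriv: "(\<phi> has_derivative \<phi>' z) (at z)"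
    and sign: "\<kappa> = 1 \<or> \<kappa> = -1" "\<kappa> * det2 (\<phi>' z 1) (\<phi>' z \<i>) > 0"
begin

lemma length_P: "length P = length T"
  using shown by (simp add: shows_tangle_def)

lemma placement_bounds:
  assumes "k < length P"
  shows "strand_comp (P ! k) < ncomp D" "0 < fst (snd (P ! k))" "fst (snd (P ! k)) < snd (snd (P ! k))"
    "snd (snd (P ! k)) < 1"
proof -
  obtain c a b where cab: "P ! k = (c, a, b)"
    by (cases "P ! k") auto
  have "(c, a, b) \<in> set P"
    using assms by (simp flip: cab)
  then have "c < ncomp D \<and> 0 < a \<and> a < b \<and> b < 1"
    using bspec[OF shown[unfolded shows_tangle_def, THEN conjunct2, THEN conjunct1], of "(c, a, b)"] by simp
  then show "strand_comp (P ! k) < ncomp D" "0 < fst (snd (P ! k))" "fst (snd (P ! k)) < snd (snd (P ! k))"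
    "snd (snd (P ! k)) < 1"
    by (auto simp: cab)
qed

lemmas shown_parts = shown[unfolded shows_tangle_def, THEN conjunct2, THEN conjunct2]

lemma curve_strand:
  "k < length P \<Longrightarrow> u \<in> {-1..1} \<Longrightarrow> curve D (strand_comp (P ! k)) (strand_time (P ! k) u) = \<phi> ((T ! k) u)"
  using shown_parts[THEN conjunct2, THEN conjunct1, rule_format, of k u] by (simp only: length_P)

lemma over_strand:
  "k < length P \<Longrightarrow> u \<in> {-1..1} \<Longrightarrow> strand_time (P ! k) u \<in> over D (strand_comp (P ! k)) \<longleftrightarrow>
     (\<exists>l<length T. \<exists>v\<in>{-1..1}. (k, u) \<noteq> (l, v) \<and> (T ! k) u = (T ! l) v \<and> W (k, u) (l, v))"
  using shown_parts[THEN conjunct2, THEN conjunct2, rule_format, of k u] by (simp only: length_P)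

lemma curve_in_square: "i < ncomp D \<Longrightarrow> curve D i t \<in> \<phi> ` square \<longleftrightarrow> on_strands P i t"
  by (rule shown_parts[THEN conjunct1, rule_format])

text \<open>If two parameter intervals on one component overlap, one of them starts within the
  other. Then the initial point of one strand would lie on the other strand.\<close>

lemma strands_meet:
  assumes "k < length P" "l < length P" "strand_comp (P ! k) = strand_comp (P ! l)"
    and "fst (snd (P ! k)) \<le> fst (snd (P ! l))" "fst (snd (P ! l)) \<le> snd (snd (P ! k))"
  shows "k = l"
proof -
  obtain w where w: "w \<in> {-1..1}" "strand_time (P ! k) w = fst (snd (P ! l))"
    using strand_time_onto[OF placement_bounds(3)[OF assms(1)] assms(4,5)] by blast
  have "\<phi> ((T ! k) w) = \<phi> ((T ! l) (-1))"
    using curve_strand[OF assms(1) w(1)] curve_strand[OF assms(2), of "-1"] w(2) assms(3) by simp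
  then have "(T ! l) (-1) = (T ! k) w"
    using inj by (simp add: inj_eq)
  then show ?thesis
    using proper w(1) assms(1,2) unfolding proper_tangle_def length_P by blast
qed

sublocale strands "ncomp D" P
proof
  show "strand_comp (P ! k) < ncomp D \<and> 0 < fst (snd (P ! k)) \<and>
      fst (snd (P ! k)) < snd (snd (P ! k)) \<and> snd (snd (P ! k)) < 1" if "k < length P" for k
    using placement_bounds[OF that] by simp
  fix k l u v
  assume kl: "k < length P" "l < length P" and uv: "u \<in> {-1..1::real}" "v \<in> {-1..1::real}"
    and comp: "strand_comp (P ! k) = strand_comp (P ! l)"
    and time: "strand_time (P ! k) u = strand_time (P ! l) v"
  have r: "fst (snd (P ! k)) \<le> strand_time (P ! k) u" "strand_time (P ! k) u \<le> snd (snd (P ! k))"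
    "fst (snd (P ! l)) \<le> strand_time (P ! l) v" "strand_time (P ! l) v \<le> snd (snd (P ! l))"
    using strand_time_range[OF placement_bounds(3)[OF kl(1)] uv(1)]
      strand_time_range[OF placement_bounds(3)[OF kl(2)] uv(2)] by auto
  have "k = l"
  proof (cases "fst (snd (P ! k)) \<le> fst (snd (P ! l))")
    case True
    then show ?thesis
      using r time by (intro strands_meet[OF kl comp]) auto
  next
    case False
    then show ?thesis
      using r time by (intro strands_meet[OF kl(2,1) comp[symmetric], symmetric]) auto
  qed
  then show "k = l \<and> u = v"
    using strand_time_inj[OF placement_bounds(3)[OF kl(1)], of u v] time by simp
qed

lemma curve_place:
  "k < length P \<Longrightarrow> u \<in> {-1..1} \<Longrightarrow> curve D (strand_comp (P ! k)) (place k m u) = \<phi> ((T ! k) u)"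
  using curve_strand curve_shift[OF diagram placement_bounds(1)] by (simp add: place_def)

lemma over_place:
  "k < length P \<Longrightarrow> u \<in> {-1..1} \<Longrightarrow> place k m u \<in> over D (strand_comp (P ! k)) \<longleftrightarrow>
     (\<exists>l<length T. \<exists>v\<in>{-1..1}. (k, u) \<noteq> (l, v) \<and> (T ! k) u = (T ! l) v \<and> W (k, u) (l, v))"
  unfolding place_def over_shift[OF diagram placement_bounds(1)] by (rule over_strand)

lemma crosses_place:
  assumes "k < length P" "l < length P" "u \<in> {-1..1}" "v \<in> {-1..1}"
  shows "crosses D (strand_comp (P ! k)) (place k m u) (strand_comp (P ! l)) (place l m' v) \<longleftrightarrow>
    (T ! k) u = (T ! l) v \<and> (k, u) \<noteq> (l, v)"
proof -
  have "(strand_comp (P ! k) = strand_comp (P ! l) \<and> place k m u - place l m' v \<in> \<int>) \<longleftrightarrow> (k, u) = (l, v)"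
  proof
    assume *: "strand_comp (P ! k) = strand_comp (P ! l) \<and> place k m u - place l m' v \<in> \<int>"
    then obtain d where "place k m u - place l m' v = of_int d"
      by (auto elim: Ints_cases)
    then have "place k m u = place l (m' + d) v"
      using place_shift[of l m' v d] by simp
    then show "(k, u) = (l, v)"
      using place_unique[OF assms] * by blast
  qed (auto simp: place_def)
  then show ?thesis
    using inj placement_bounds(1) assms by (auto simp: crosses_def curve_place inj_eq)
qed

text \<open>Chain rule for \<phi> after the strand after the inverse \<open>g\<close> of the
  placement. The factor is positive since placements keep the direction; the time lies in the open
  interval, where a whole neighbourhood shows the model.\<close>

lemma velocity_place:
  assumes k: "k < length P" and u: "u \<in> {-1<..<1}"
  obtains r where "r > 0"
    "velocity D (strand_comp (P ! k)) (place k m u) = r *\<^sub>R \<phi>' ((T ! k) u) (vector_derivative (T ! k) (at u))"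
proof -
  define a b where "a = fst (snd (P ! k))" "b = snd (snd (P ! k))"
  have ab: "a < b"
    using placement_bounds(3)[OF k] by (simp add: a_b_def)
  define r where "r = 2 / (b - a)"
  have r: "r > 0" "(b - a) / 2 * r = 1"
    using ab by (auto simp: r_def)
  define g where "g t = (t - of_int m - (a + b) / 2) * r" for t
  have place: "place k m w = (a + b) / 2 + w * (b - a) / 2 + of_int m" for w
    by (simp add: place_def strand_time_affine a_b_def)
  have gp: "g (place k m w) = w" for w
  proof -
    have "g (place k m w) = w * ((b - a) / 2 * r)"
      unfolding g_def place by simp
    then show ?thesis
      by (simp only: r(2) mult_1_right)
  qed
  have pg: "place k m (g t) = t" for t
  proof -
    obtain w where "t = place k m w"
      using surjD[OF place_strict_mono(2)[OF k, of m], of t] by blast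
    then show ?thesis
      by (simp add: gp)
  qed
  have "(g has_real_derivative r) (at t)" for t
    unfolding g_def by (auto intro!: derivative_eq_intros)
  then have "(g has_vector_derivative r) (at (place k m u))"
    by (simp add: has_real_derivative_iff_has_vector_derivative)
  moreover have "((T ! k) has_vector_derivative vector_derivative (T ! k) (at u)) (at (g (place k m u)))"
    using proper k length_P unfolding gp by (simp add: proper_tangle_def vector_derivative_works)
  ultimately have "((T ! k \<circ> g) has_vector_derivative
      r *\<^sub>R vector_derivative (T ! k) (at u)) (at (place k m u))"
    by (rule vector_diff_chain_at)
  moreover have "(\<phi> has_derivative \<phi>' ((T ! k) u)) (at ((T ! k \<circ> g) (place k m u)))"
    using deriv by (simp add: gp)
  ultimately have "((\<phi> \<circ> (T ! k \<circ> g)) has_vector_derivative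
      \<phi>' ((T ! k) u) (r *\<^sub>R vector_derivative (T ! k) (at u))) (at (place k m u))"
    using vector_derivative_diff_chain_within[of "T ! k \<circ> g" _ "place k m u" UNIV \<phi>]
      has_derivative_at_withinI by fastforce
  then have "(curve D (strand_comp (P ! k)) has_vector_derivative
      \<phi>' ((T ! k) u) (r *\<^sub>R vector_derivative (T ! k) (at u))) (at (place k m u))"
  proof (rule has_vector_derivative_transform_within_open[where S = "g -` {-1<..<1}"])
    have "continuous_on UNIV g"
      unfolding g_def by (intro continuous_intros)
    then show "open (g -` {-1<..<1})"
      by (intro open_vimage) auto
    show "place k m u \<in> g -` {-1<..<1}"
      using u by (simp add: gp)
    show "(\<phi> \<circ> (T ! k \<circ> g)) t = curve D (strand_comp (P ! k)) t" if "t \<in> g -` {-1<..<1}" for t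
      using curve_place[OF k, of "g t" m] that by (simp add: pg)
  qed
  moreover have "linear (\<phi>' ((T ! k) u))"
    using deriv by (rule has_derivative_linear)
  ultimately have "velocity D (strand_comp (P ! k)) (place k m u)
      = r *\<^sub>R \<phi>' ((T ! k) u) (vector_derivative (T ! k) (at u))"
    by (simp add: velocity_def vector_derivative_at linear_cmul)
  then show thesis
    by (rule that[OF r(1)])
qed

text \<open>At a common point both velocities are images under the same derivative of \<phi>, up to
  positive factors, so the determinant in the model is multiplied by one of sign \<kappa>.\<close>

lemma crossing_sign:
  assumes "k < length P" "l < length P" "u \<in> {-1<..<1}" "v \<in> {-1<..<1}" "(T ! k) u = (T ! l) v"
  shows "det2 (velocity D (strand_comp (P ! k)) (place k m u)) (velocity D (strand_comp (P ! l)) (place l m' v)) > 0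
    \<longleftrightarrow> \<kappa> * det2 (vector_derivative (T ! k) (at u)) (vector_derivative (T ! l) (at v)) > 0"
proof -
  obtain r where r: "r > 0" "velocity D (strand_comp (P ! k)) (place k m u)
      = r *\<^sub>R \<phi>' ((T ! k) u) (vector_derivative (T ! k) (at u))"
    using velocity_place[OF assms(1,3)] .
  obtain r' where r': "r' > 0" "velocity D (strand_comp (P ! l)) (place l m' v)
      = r' *\<^sub>R \<phi>' ((T ! l) v) (vector_derivative (T ! l) (at v))"
    using velocity_place[OF assms(2,4)] .
  have "linear (\<phi>' ((T ! l) v))"
    using deriv by (rule has_derivative_linear)
  then have *: "det2 (\<phi>' ((T ! l) v) x) (\<phi>' ((T ! l) v) y)
      = det2 (\<phi>' ((T ! l) v) 1) (\<phi>' ((T ! l) v) \<i>) * det2 x y" for x y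
    by (rule det2_linear)
  show ?thesis
    unfolding r(2) r'(2) det2_scale_pos[OF r(1) r'(1)] assms(5)
    unfolding *[of "vector_derivative (T ! k) (at u)" "vector_derivative (T ! l) (at v)"]
    by (rule sign_mult_iff[OF sign])
qed

lemma tangle_crossing_inside:
  assumes "k < length T" "l < length T" "u \<in> {-1..1}" "v \<in> {-1..1}" "(k, u) \<noteq> (l, v)" "(T ! k) u = (T ! l) v"
  shows "u \<in> {-1<..<1} \<and> v \<in> {-1<..<1}"
proof -
  have "u \<notin> {-1, 1}"
    using proper assms unfolding proper_tangle_def by blast
  moreover have "v \<notin> {-1, 1}"
    using proper assms(1-5) assms(6)[symmetric] unfolding proper_tangle_def by blast
  ultimately show ?thesis
    using assms(3,4) by auto
qed

definition outer_crossings :: "crossing set" where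
  "outer_crossings = {(i, s, j, t, p) \<in> classical_crossings D. \<not> on_strands P i s \<and> \<not> on_strands P j t}"

lemma crossing_decomposition:
  "classical_crossings D = outer_crossings \<union> placed (tangle_crossings \<kappa> W T)"
proof
  show "outer_crossings \<union> placed (tangle_crossings \<kappa> W T) \<subseteq> classical_crossings D"
  proof
    fix x assume x: "x \<in> outer_crossings \<union> placed (tangle_crossings \<kappa> W T)"
    obtain i s j t p where xx: "x = (i, s, j, t, p)"
      by (cases x) auto
    show "x \<in> classical_crossings D"
    proof (cases "x \<in> outer_crossings")
      case True
      then show ?thesis
        by (auto simp: outer_crossings_def)
    next
      case False
      then obtain k m u l m' v where kl: "i = strand_comp (P ! k)" "s = place k m u" "j = strand_comp (P ! l)"
        "t = place l m' v" "(k, u, l, v, p) \<in> tangle_crossings \<kappa> W T"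
        using x xx placedE by blast
      have Q: "k < length T" "l < length T" "u \<in> {-1..1}" "v \<in> {-1..1}" "(k, u) \<noteq> (l, v)" "(T ! k) u = (T ! l) v" "W (k, u) (l, v)"
        "p \<longleftrightarrow> \<kappa> * det2 (vector_derivative (T ! k) (at u)) (vector_derivative (T ! l) (at v)) > 0"
        using kl(5) by (auto simp: tangle_crossings_def)
      have "place k m u \<in> over D (strand_comp (P ! k))"
      proof (subst over_place)
        show "\<exists>l<length T. \<exists>v\<in>{-1..1}. (k, u) \<noteq> (l, v) \<and> (T ! k) u = (T ! l) v \<and> W (k, u) (l, v)"
          using Q(2-7) by blast
      qed (use Q in \<open>simp_all add: length_P\<close>)
      then show ?thesis
        using Q crosses_place[of k l u v m m'] crossing_sign[of k l u v m m'] tangle_crossing_inside[OF Q(1-6)]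
        by (simp add: xx kl(1-4) classical_crossings_def length_P)
    qed
  qed
  show "classical_crossings D \<subseteq> outer_crossings \<union> placed (tangle_crossings \<kappa> W T)"
  proof
    fix x assume x: "x \<in> classical_crossings D"
    obtain i s j t p where xx: "x = (i, s, j, t, p)"
      by (cases x) auto
    have cr: "crosses D i s j t" "s \<in> over D i" "p \<longleftrightarrow> det2 (velocity D i s) (velocity D j t) > 0"
      using x by (auto simp: xx classical_crossings_def)
    \<comment> \<open>Both times have the same image point, which lies in the disc or does
      not.\<close>
    have "on_strands P i s \<longleftrightarrow> on_strands P j t"
      using cr(1) curve_in_square[of i s] curve_in_square[of j t] by (auto simp: crosses_def)
    then consider "\<not> on_strands P i s" "\<not> on_strands P j t" | "on_strands P i s" "on_strands P j t"
      by blast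
    then show "x \<in> outer_crossings \<union> placed (tangle_crossings \<kappa> W T)"
    proof cases
      case 1
      then show ?thesis
        using x by (simp add: xx outer_crossings_def)
    next
      case 2
      obtain k m u where k: "k < length P" "u \<in> {-1..1}" "i = strand_comp (P ! k)" "s = place k m u"
        using 2(1) unfolding on_strands_iff by blast
      obtain l m' v where l: "l < length P" "v \<in> {-1..1}" "j = strand_comp (P ! l)" "t = place l m' v"
        using 2(2) unfolding on_strands_iff by blast
      have T: "(T ! k) u = (T ! l) v" "(k, u) \<noteq> (l, v)"
        using cr(1) crosses_place[OF k(1) l(1) k(2) l(2)] k l by blast+
      \<comment> \<open>Membership in \<open>over\<close> yields some crossing of the model where
        strand \<open>k\<close> is upper, at first perhaps not the given one; the absence of triple
        points identifies the two.\<close>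
      obtain l' v' where l': "l' < length P" "v' \<in> {-1..1}" "(k, u) \<noteq> (l', v')" "(T ! k) u = (T ! l') v'"
        "W (k, u) (l', v')"
        using cr(2) over_place[OF k(1,2)] k(3,4) length_P by auto
      have "crosses D i s (strand_comp (P ! l')) (place l' 0 v')"
        using crosses_place[OF k(1) l'(1) k(2) l'(2)] l' k by blast
      then have "strand_comp (P ! l') = j \<and> place l' 0 v' - t \<in> \<int>"
        using diagram cr(1) unfolding link_diagram_def by blast
      then have "\<not> crosses D (strand_comp (P ! l')) (place l' 0 v') j t"
        by (simp add: crosses_def)
      then have "l' = l \<and> v' = v"
        using crosses_place[OF l'(1) l(1) l'(2) l(2)] l T l'(4) by (metis prod.inject)
      then have "(k, u, l, v, p) \<in> tangle_crossings \<kappa> W T"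
        using k l T l'(5) cr(3) tangle_crossing_inside[of k l u v] crossing_sign[of k l u v m m']
        by (simp add: tangle_crossings_def length_P)
      then have "x \<in> placed (tangle_crossings \<kappa> W T)"
        unfolding xx k(3,4) l(3,4) by (rule placedI)
      then show ?thesis
        by blast
    qed
  qed
qed

text \<open>The disc is compact, hence closed, and the strands are the preimage of the disc under
  continuous curves.\<close>

lemma off_strands_open:
  assumes "i < ncomp D" "\<not> on_strands P i t"
  shows "\<forall>\<^sub>F u in nhds t. \<not> on_strands P i u"
proof -
  have "continuous_on UNIV \<phi>"
    using deriv has_derivative_continuous by (intro continuous_at_imp_continuous_on) blast
  then have "closed (\<phi> ` square)"
    unfolding square_def by (intro compact_imp_closed compact_continuous_image compact_cbox) (rule continuous_on_subset, auto)
  moreover have "continuous_on UNIV (curve D i)"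
    using curve_has_velocity[OF diagram assms(1)]
    by (intro continuous_at_imp_continuous_on) (blast intro: has_vector_derivative_continuous)
  ultimately have "open (curve D i -` (- \<phi> ` square))"
    by (intro open_vimage) auto
  then have "\<forall>\<^sub>F u in nhds t. u \<in> curve D i -` (- \<phi> ` square)"
    using assms by (intro eventually_nhds_in_open) (auto simp: curve_in_square)
  then show ?thesis
    by eventually_elim (use curve_in_square[OF assms(1)] in auto)
qed

lemma tangle_diagram: "tangle_diagram (ncomp D) P (classical_crossings D) outer_crossings (tangle_crossings \<kappa> W T)"
proof (intro tangle_diagram.intro tangle_diagram_axioms.intro strands_axioms crossing_pattern_diagram diagram
    crossing_decomposition off_strands_open)
  show "\<not> on_strands P i s \<and> \<not> on_strands P j t" if "(i, s, j, t, p) \<in> outer_crossings" for i s j t p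
    using that by (simp add: outer_crossings_def)
  show "k < length P \<and> l < length P \<and> u \<in> {-1<..<1} \<and> v \<in> {-1<..<1}"
    if "(k, u, l, v, p) \<in> tangle_crossings \<kappa> W T" for k u l v p
  proof -
    have "k < length T" "l < length T" "u \<in> {-1..1}" "v \<in> {-1..1}" "(k, u) \<noteq> (l, v)" "(T ! k) u = (T ! l) v"
      using that by (auto simp: tangle_crossings_def)
    from this(1,2) tangle_crossing_inside[OF this] show ?thesis
      by (simp add: length_P)
  qed
qed

end

text \<open>The Jacobian determinant is continuous and nowhere zero on the connected plane, so it
  keeps one sign.\<close>

lemma C1_diffeo_sign:
  assumes "C1_diffeo \<phi>"
  obtains \<phi>' and \<kappa> :: real where "\<kappa> = 1 \<or> \<kappa> = -1"
    "\<And>z. (\<phi> has_derivative \<phi>' z) (at z)" "\<And>z. \<kappa> * det2 (\<phi>' z 1) (\<phi>' z \<i>) > 0"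
proof -
  obtain \<phi>' where d: "\<And>z. (\<phi> has_derivative \<phi>' z) (at z)" "\<And>z. bij (\<phi>' z)"
    and cont: "\<And>w. continuous_on UNIV (\<lambda>z. \<phi>' z w)"
    using assms unfolding C1_diffeo_def by blast
  define d where "d z = det2 (\<phi>' z 1) (\<phi>' z \<i>)" for z
  have nonzero: "d z \<noteq> 0" for z
    unfolding d_def using has_derivative_linear[OF d(1)] d(2) by (rule det2_linear_bij)
  have "connected (d ` UNIV)"
    unfolding d_def by (intro connected_continuous_image continuous_intros cont connected_UNIV)
  then have same: "x \<le> 0 \<Longrightarrow> 0 \<le> y \<Longrightarrow> x \<in> range d \<Longrightarrow> y \<in> range d \<Longrightarrow> False" for x y
    using connectedD_interval[of "range d" x y 0] nonzero by (metis rangeE)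
  define \<kappa> :: real where "\<kappa> = (if d 0 > 0 then 1 else -1)"
  have "\<kappa> * d z > 0" for z
    using same[of "d 0" "d z"] same[of "d z" "d 0"] nonzero[of z] nonzero[of 0]
    by (auto simp: \<kappa>_def not_less) (meson linorder_not_less order_le_less)+
  then show thesis
    using that[of \<kappa> \<phi>'] d(1) by (simp add: \<kappa>_def d_def)
qed

lemma local_move_exchange:
  assumes D: "link_diagram D" "link_diagram D'" and move: "local_move W T T' D D'"
    and T: "proper_tangle T" "proper_tangle T'"
  obtains \<kappa> P out where "\<kappa> = 1 \<or> \<kappa> = -1" "length P = length T" "ncomp D' = ncomp D"
    "tangle_exchange (ncomp D) P (classical_crossings D) (classical_crossings D') out
       (tangle_crossings \<kappa> W T) (tangle_crossings \<kappa> W T')"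
proof -
  obtain \<phi> P where n: "ncomp D' = ncomp D" and \<phi>: "C1_diffeo \<phi>"
    and sh: "shows_tangle \<phi> P W T D" "shows_tangle \<phi> P W T' D'"
    and out: "\<And>i t. i < ncomp D \<Longrightarrow> \<not> on_strands P i t \<Longrightarrow> curve D' i t = curve D i t"
      "\<And>i t. i < ncomp D \<Longrightarrow> \<not> on_strands P i t \<Longrightarrow> t \<in> over D' i \<longleftrightarrow> t \<in> over D i"
    using move unfolding local_move_def by blast
  obtain \<phi>' \<kappa> where \<kappa>: "\<kappa> = 1 \<or> \<kappa> = (-1 :: real)"
    and d: "\<And>z. (\<phi> has_derivative \<phi>' z) (at z)" "\<And>z. \<kappa> * det2 (\<phi>' z 1) (\<phi>' z \<i>) > 0"
    using C1_diffeo_sign[OF \<phi>] by metis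
  have inj: "inj \<phi>"
    using \<phi> unfolding C1_diffeo_def by (auto simp: bij_def)
  interpret old: shown_tangle \<phi> \<phi>' \<kappa> P W T D
    by (rule shown_tangle.intro[OF D(1) sh(1) T(1) inj d(1) \<kappa> d(2)])
  interpret new: shown_tangle \<phi> \<phi>' \<kappa> P W T' D'
    by (rule shown_tangle.intro[OF D(2) sh(2) T(2) inj d(1) \<kappa> d(2)])
  \<comment> \<open>Equality of the curves at a single time would not give equal velocities; it
    holds on a neighbourhood because the times off the strands form an open set.\<close>
  have vel: "velocity D' i t = velocity D i t" if i: "i < ncomp D" "\<not> on_strands P i t" for i t
  proof (rule velocity_eqI)
    have "\<forall>\<^sub>F u in nhds t. curve D' i u = curve D i u"
      using old.off_strands_open[OF i] by eventually_elim (rule out(1)[OF i(1)])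
    then show "(curve D' i has_vector_derivative velocity D i t) (at t)"
      using curve_has_velocity[OF D(1) i(1), of t] has_vector_derivative_cong_ev[of UNIV "curve D' i" "curve D i" t]
      by (simp add: out(1)[OF i])
  qed (rule D(2))
  have "new.outer_crossings = old.outer_crossings"
  proof -
    have "(i, s, j, t, p) \<in> new.outer_crossings \<longleftrightarrow> (i, s, j, t, p) \<in> old.outer_crossings" for i s j t p
      using out vel
      by (auto simp: new.outer_crossings_def old.outer_crossings_def classical_crossings_def crosses_def n)
    then show ?thesis
      by (auto simp only: set_eq_iff split_paired_All)
  qed
  then have "tangle_diagram (ncomp D) P (classical_crossings D') old.outer_crossings (tangle_crossings \<kappa> W T')"
    using new.tangle_diagram n by simp
  then show thesis
    using old.tangle_diagram \<kappa> n old.length_P by (intro that tangle_exchange.intro)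
qed

text \<open>Serves the moves that leave the classical crossings inside the disc where they are, so
  that no labels have to be replaced.\<close>

lemma same_colorings_local_move_same_crossings:
  assumes D: "link_diagram D" "link_diagram D'" and move: "local_move W T T' D D'"
    and T: "proper_tangle T" "proper_tangle T'"
    and eq: "\<And>\<kappa>. tangle_crossings \<kappa> W T = tangle_crossings \<kappa> W T'"
  shows "same_colorings X ut ot D D'"
proof -
  obtain \<kappa> P out where n: "ncomp D' = ncomp D"
    "tangle_exchange (ncomp D) P (classical_crossings D) (classical_crossings D') out
       (tangle_crossings \<kappa> W T) (tangle_crossings \<kappa> W T')"
    using local_move_exchange[OF D move T] by metis
  then interpret tangle_exchange "ncomp D" P "classical_crossings D" "classical_crossings D'" out
       "tangle_crossings \<kappa> W T" "tangle_crossings \<kappa> W T'"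
    by blast
  have "classical_crossings D' = classical_crossings D"
    using old.decomposed new.decomposed eq by simp
  then show ?thesis
    by (rule same_colorings_if_same_crossings[OF D n(1)])
qed

lemma same_colorings_local_move_replaceable:
  assumes D: "link_diagram D" "link_diagram D'" and move: "local_move W T T' D D'"
    and T: "proper_tangle T" "proper_tangle T'"
    and repl: "\<And>\<kappa>. \<kappa> = 1 \<or> \<kappa> = -1 \<Longrightarrow>
      tangle_replaceable X ut ot (length T) (tangle_crossings \<kappa> W T) (tangle_crossings \<kappa> W T') \<and>
      tangle_replaceable X ut ot (length T) (tangle_crossings \<kappa> W T') (tangle_crossings \<kappa> W T)"
  shows "same_colorings X ut ot D D'"
proof -
  obtain \<kappa> P out where n: "\<kappa> = 1 \<or> \<kappa> = -1" "length P = length T" "ncomp D' = ncomp D"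
    "tangle_exchange (ncomp D) P (classical_crossings D) (classical_crossings D') out
       (tangle_crossings \<kappa> W T) (tangle_crossings \<kappa> W T')"
    using local_move_exchange[OF D move T] by metis
  have "same_time_colorings X ut ot (ncomp D) (classical_crossings D) (ncomp D) (classical_crossings D')"
    using same_time_colorings_exchange[OF n(4), of X ut ot] repl[OF n(1)] n(2) by simp
  then show ?thesis
    using n(3) by (intro same_coloringsI[OF D]) simp
qed

section \<open>Tangles whose strands each have exactly two crossing times\<close>

lemma local_constant_on:
  assumes "connected S" "S \<subseteq> {-1..1}" "u \<in> S" "v \<in> S"
    and "\<And>w. w \<in> S \<Longrightarrow> \<forall>\<^sub>F v in at w within {-1..1}. c v = c w"
  shows "c u = c (v :: real)"
proof (rule connected_local_const[OF assms(1,3,4)], rule ballI)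
  fix w assume "w \<in> S"
  then have "\<forall>\<^sub>F v in at w within S. c v = c w"
    using assms(2,5) by (intro filter_leD[OF at_le[OF assms(2)]]) auto
  then show "\<forall>\<^sub>F v in at w within S. c w = c v"
    by eventually_elim simp
qed

text \<open>The normal form of a coloring along a strand with crossing times
  \<open>a < b\<close>.\<close>

definition step :: "real \<Rightarrow> real \<Rightarrow> 'a \<Rightarrow> 'a \<Rightarrow> 'a \<Rightarrow> real \<Rightarrow> 'a" where
  "step a b x m z u = (if u < a then x else if u < b then m else z)"

lemma step_values:
  assumes "a < b"
  shows "left_value (step a b x m z) a = x" "right_value (step a b x m z) a = m"
    "left_value (step a b x m z) b = m" "right_value (step a b x m z) b = z"
proof -
  show "left_value (step a b x m z) a = x"
    by (rule left_value_eq) (auto simp: eventually_at_left_field step_def intro!: exI[of _ "a - 1"])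
  show "right_value (step a b x m z) a = m"
    by (rule right_value_eq) (use assms in \<open>auto simp: eventually_at_right_field step_def intro!: exI[of _ b]\<close>)
  show "left_value (step a b x m z) b = m"
    by (rule left_value_eq) (use assms in \<open>auto simp: eventually_at_left_field step_def intro!: exI[of _ a]\<close>)
  show "right_value (step a b x m z) b = z"
    by (rule right_value_eq) (use assms in \<open>auto simp: eventually_at_right_field step_def intro!: exI[of _ "b + 1"]\<close>)
qed

lemma step_local:
  assumes "a < b" "u \<noteq> a" "u \<noteq> b"
  shows "\<forall>\<^sub>F v in at u within S. step a b x m z v = step a b x m z u"
proof -
  have "\<forall>\<^sub>F v in nhds u. (v < a \<longleftrightarrow> u < a) \<and> (v < b \<longleftrightarrow> u < b)"
  proof (intro eventually_conj)
    have "\<forall>\<^sub>F v in nhds u. v < w \<longleftrightarrow> u < w" if "u \<noteq> w" for w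
    proof (cases "u < w")
      case True
      then show ?thesis
        using eventually_nhds_in_open[of "{..<w}" u] by auto
    next
      case False
      then have "\<forall>\<^sub>F v in nhds u. v \<in> {w<..}"
        using that by (intro eventually_nhds_in_open) auto
      then show ?thesis
        by eventually_elim (use False in auto)
    qed
    then show "\<forall>\<^sub>F v in nhds u. v < a \<longleftrightarrow> u < a" "\<forall>\<^sub>F v in nhds u. v < b \<longleftrightarrow> u < b"
      using assms by blast+
  qed
  then have "\<forall>\<^sub>F v in nhds u. step a b x m z v = step a b x m z u"
    by eventually_elim (simp add: step_def)
  then show ?thesis
    by (rule filter_leD[rotated]) (simp add: at_within_def)
qed

text \<open>The crossing rule for step colorings. A crossing time of strand \<open>k\<close> is the
  first one, \<open>a k\<close>, or else the second, so comparison with \<open>a k\<close> tells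
  which two of the three labels meet there.\<close>

definition full_rule ::
  "('a \<Rightarrow> 'a \<Rightarrow> 'a) \<Rightarrow> ('a \<Rightarrow> 'a \<Rightarrow> 'a) \<Rightarrow> crossing set \<Rightarrow> (nat \<Rightarrow> real) \<Rightarrow>
   (nat \<Rightarrow> 'a) \<Rightarrow> (nat \<Rightarrow> 'a) \<Rightarrow> (nat \<Rightarrow> 'a) \<Rightarrow> bool" where
  "full_rule ut ot Q a x m z \<longleftrightarrow>
     (\<forall>k u l v p. (k, u, l, v, p) \<in> Q \<longrightarrow>
        crossing_rule ut ot p (if u = a k then x k else m k) (if u = a k then m k else z k)
          (if v = a l then x l else m l) (if v = a l then m l else z l))"

definition unique_middles ::
  "'a set \<Rightarrow> ('a \<Rightarrow> 'a \<Rightarrow> 'a) \<Rightarrow> ('a \<Rightarrow> 'a \<Rightarrow> 'a) \<Rightarrow> nat \<Rightarrow> crossing set \<Rightarrow> (nat \<Rightarrow> real) \<Rightarrow> bool" where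
  "unique_middles X ut ot N Q a \<longleftrightarrow>
     (\<forall>x m m' z. full_rule ut ot Q a x m z \<and> full_rule ut ot Q a x m' z \<and>
        (\<forall>k<N. x k \<in> X \<and> m k \<in> X \<and> m' k \<in> X \<and> z k \<in> X) \<longrightarrow> (\<forall>k<N. m k = m' k))"

text \<open>The crossed models of all three classical moves have this form, the kink passing its one
  crossing twice. A coloring then amounts to three labels per strand, which turns the moves into
  finite statements.\<close>

locale full_tangle =
  fixes N :: nat and Q :: "crossing set" and a b :: "nat \<Rightarrow> real"
  assumes breaks: "k < N \<Longrightarrow> -1 < a k \<and> a k < b k \<and> b k < 1"
    and passes_iff: "k < N \<Longrightarrow> passes Q k u \<longleftrightarrow> u = a k \<or> u = b k"
    and strand_less: "(k, u, l, v, p) \<in> Q \<Longrightarrow> k < N \<and> l < N"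
begin

lemma crossing_at_break:
  "(k, u, l, v, p) \<in> Q \<Longrightarrow> (u = a k \<or> u = b k) \<and> (v = a l \<or> v = b l)"
  using passes_iff[of k u] passes_iff[of l v] strand_less[of k u l v p] unfolding passes_def by blast

lemma full_rule_cong:
  assumes "full_rule ut ot Q a x m z" "\<And>k. k < N \<Longrightarrow> x k = x' k \<and> m k = m' k \<and> z k = z' k"
  shows "full_rule ut ot Q a x' m' z'"
  unfolding full_rule_def
proof (intro allI impI)
  fix k u l v p assume Q: "(k, u, l, v, p) \<in> Q"
  have eqs: "x k = x' k" "m k = m' k" "z k = z' k" "x l = x' l" "m l = m' l" "z l = z' l"
    using strand_less[OF Q] assms(2) by auto
  show "crossing_rule ut ot p (if u = a k then x' k else m' k) (if u = a k then m' k else z' k)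
          (if v = a l then x' l else m' l) (if v = a l then m' l else z' l)"
    using assms(1)[unfolded full_rule_def, rule_format, OF Q] unfolding eqs .
qed

definition middle :: "(nat \<Rightarrow> real \<Rightarrow> 'a) \<Rightarrow> nat \<Rightarrow> 'a" where
  "middle c k = c k ((a k + b k) / 2)"

lemma coloring_eq_step:
  assumes c: "c \<in> tangle_colorings X ut ot N Q" and k: "k < N" and u: "u \<in> {-1..1}" "u \<noteq> a k" "u \<noteq> b k"
  shows "c k u = step (a k) (b k) (c k (-1)) (middle c k) (c k 1) u"
proof -
  have ab: "-1 < a k" "a k < b k" "b k < 1"
    using breaks[OF k] by auto
  have const: "c k v = c k w" if "connected S" "S \<subseteq> {-1..1} - {a k, b k}" "v \<in> S" "w \<in> S" for S v w
    by (rule local_constant_on[OF that(1) _ that(3,4)])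
      (use that(2) tangle_coloring_local[OF c k] passes_iff[OF k] in blast)+
  consider "u < a k" | "a k < u" "u < b k" | "b k < u"
    using u by linarith
  then show ?thesis
  proof cases
    case 1
    have "c k u = c k (-1)"
      by (rule const[of "{-1..<a k}"]) (use 1 ab u in auto)
    then show ?thesis
      using 1 by (simp add: step_def)
  next
    case 2
    have "c k u = c k ((a k + b k) / 2)"
      by (rule const[of "{a k<..<b k}"]) (use 2 ab u in auto)
    then show ?thesis
      using 2 by (simp add: step_def middle_def)
  next
    case 3
    have "c k u = c k 1"
      by (rule const[of "{b k<..1}"]) (use 3 ab u in auto)
    then show ?thesis
      using 3 ab by (simp add: step_def)
  qed
qed

lemma coloring_values:
  assumes c: "c \<in> tangle_colorings X ut ot N Q" and k: "k < N"
  shows "left_value (c k) (a k) = c k (-1)" "right_value (c k) (a k) = middle c k"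
    "left_value (c k) (b k) = middle c k" "right_value (c k) (b k) = c k 1"
proof -
  let ?s = "step (a k) (b k) (c k (-1)) (middle c k) (c k 1)"
  have ab: "-1 < a k" "a k < b k" "b k < 1"
    using breaks[OF k] by auto
  have "\<forall>\<^sub>F v in at u. c k v = ?s v" if u: "-1 < u" "u < 1" for u
  proof -
    have unit: "\<forall>\<^sub>F v in at u. v \<in> {-1<..<1}"
      by (rule eventually_at_in_open') (use u in auto)
    have ne: "\<forall>\<^sub>F v in at u. v \<noteq> w" for w
    proof (cases "u = w")
      case False
      then show ?thesis
        using eventually_at_in_open'[of "- {w}" u] by auto
    qed (simp add: eventually_at_filter)
    show ?thesis
      using unit ne[of "a k"] ne[of "b k"]
    proof eventually_elim
      case (elim v)
      then show ?case
        by (intro coloring_eq_step[OF c k]) auto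
    qed
  qed
  then have eq: "left_value (c k) u = left_value ?s u" "right_value (c k) u = right_value ?s u"
    if "-1 < u" "u < 1" for u
    using that by (auto simp: eventually_at_split intro!: left_value_cong right_value_cong)
  show "left_value (c k) (a k) = c k (-1)" "right_value (c k) (a k) = middle c k"
    "left_value (c k) (b k) = middle c k" "right_value (c k) (b k) = c k 1"
    using eq[of "a k"] eq[of "b k"] ab step_values[OF ab(2)] by auto
qed

lemma coloring_full_rule:
  assumes c: "c \<in> tangle_colorings X ut ot N Q"
  shows "full_rule ut ot Q a (\<lambda>k. c k (-1)) (middle c) (\<lambda>k. c k 1)"
  unfolding full_rule_def
proof (intro allI impI)
  fix k u l v p assume Q: "(k, u, l, v, p) \<in> Q"
  have kl: "k < N" "l < N"
    using strand_less[OF Q] by auto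
  have eqs: "left_value (c k) u = (if u = a k then c k (-1) else middle c k)"
    "right_value (c k) u = (if u = a k then middle c k else c k 1)"
    "left_value (c l) v = (if v = a l then c l (-1) else middle c l)"
    "right_value (c l) v = (if v = a l then middle c l else c l 1)"
    using crossing_at_break[OF Q] coloring_values[OF c kl(1)] coloring_values[OF c kl(2)] by auto
  show "crossing_rule ut ot p (if u = a k then c k (-1) else middle c k) (if u = a k then middle c k else c k 1)
      (if v = a l then c l (-1) else middle c l) (if v = a l then middle c l else c l 1)"
    using tangle_coloring_rule[OF c Q] unfolding eqs .
qed

lemma coloring_in:
  assumes c: "c \<in> tangle_colorings X ut ot N Q" and k: "k < N"
  shows "c k (-1) \<in> X" "middle c k \<in> X" "c k 1 \<in> X"
  unfolding middle_def
  by (rule tangle_coloring_in[OF c k]; use breaks[OF k] in \<open>auto simp: passes_iff[OF k]\<close>)+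

lemma step_coloring:
  assumes "full_rule ut ot Q a x m z" "\<And>k. k < N \<Longrightarrow> x k \<in> X \<and> m k \<in> X \<and> z k \<in> X"
  shows "(\<lambda>k. step (a k) (b k) (x k) (m k) (z k)) \<in> tangle_colorings X ut ot N Q"
  unfolding tangle_colorings_def
proof (rule CollectI, intro conjI allI impI ballI)
  fix k u assume k: "k < N" and "\<not> passes Q k u"
  then have u: "u \<noteq> a k" "u \<noteq> b k"
    by (auto simp: passes_iff)
  show "step (a k) (b k) (x k) (m k) (z k) u \<in> X"
    using assms(2)[OF k] by (simp add: step_def)
  show "\<forall>\<^sub>F v in at u within {-1..1}.
      step (a k) (b k) (x k) (m k) (z k) v = step (a k) (b k) (x k) (m k) (z k) u"
    using breaks[OF k] u by (intro step_local) auto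
next
  fix k u l v p assume Q: "(k, u, l, v, p) \<in> Q"
  have kl: "a k < b k" "a l < b l"
    using strand_less[OF Q] breaks by auto
  show "crossing_rule ut ot p (left_value (step (a k) (b k) (x k) (m k) (z k)) u)
      (right_value (step (a k) (b k) (x k) (m k) (z k)) u)
      (left_value (step (a l) (b l) (x l) (m l) (z l)) v) (right_value (step (a l) (b l) (x l) (m l) (z l)) v)"
    using assms(1)[unfolded full_rule_def, rule_format, OF Q] crossing_at_break[OF Q] kl
    by (auto simp: step_values)
qed

lemma step_ends:
  assumes "k < N" shows "step (a k) (b k) x m z (-1) = x" "step (a k) (b k) x m z 1 = z"
  using breaks[OF assms] by (auto simp: step_def)

lemma full_unique:
  assumes unique: "unique_middles X ut ot N Q a"
  shows "\<forall>c\<in>tangle_colorings X ut ot N Q. \<forall>c'\<in>tangle_colorings X ut ot N Q. same_ends N c c' \<longrightarrow>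
        (\<forall>k<N. \<forall>u\<in>{-1..1}. \<not> passes Q k u \<longrightarrow> c k u = c' k u)"
proof (intro ballI allI impI)
  fix c c' k u
  assume c: "c \<in> tangle_colorings X ut ot N Q" and c': "c' \<in> tangle_colorings X ut ot N Q"
    and ends: "same_ends N c c'" and k: "k < N" and u: "u \<in> {-1..1}" and np: "\<not> passes Q k u"
  \<comment> \<open>Outside the range \<open>k < N\<close> the ends are set to
    \<open>undefined\<close>: \<open>same_ends\<close> compares only the strands of the tangle,
    whereas \<open>unique_middles\<close> demands one and the same \<open>x\<close> and
    \<open>z\<close> for both colorings.\<close>
  let ?x = "\<lambda>k. if k < N then c k (-1) else undefined" and ?z = "\<lambda>k. if k < N then c k 1 else undefined"
  have full: "full_rule ut ot Q a ?x (middle c) ?z"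
    by (rule full_rule_cong[OF coloring_full_rule[OF c]]) simp
  have full': "full_rule ut ot Q a ?x (middle c') ?z"
    by (rule full_rule_cong[OF coloring_full_rule[OF c']]) (use ends in \<open>simp add: same_ends_def\<close>)
  have "middle c k = middle c' k"
    using unique[unfolded unique_middles_def, rule_format, OF conjI[OF full conjI[OF full']] k]
      coloring_in[OF c] coloring_in[OF c'] by simp
  then show "c k u = c' k u"
    using coloring_eq_step[OF c k u] coloring_eq_step[OF c' k u] np ends k
    by (simp add: passes_iff same_ends_def)
qed

text \<open>Without crossings labels are constant along a strand, so the outer labels
  \<open>x\<close> and \<open>z\<close> have to agree already.\<close>

lemma replaceable_empty:
  assumes rule_ends: "\<And>x m z k. full_rule ut ot Q a x m z \<Longrightarrow>
      (\<And>k. k < N \<Longrightarrow> x k \<in> X \<and> m k \<in> X \<and> z k \<in> X) \<Longrightarrow> k < N \<Longrightarrow> x k = z k"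
    and unique: "unique_middles X ut ot N Q a"
  shows "tangle_replaceable X ut ot N Q {}"
  unfolding tangle_replaceable_def
proof (rule conjI[OF ballI full_unique[OF unique]])
  fix c assume c: "c \<in> tangle_colorings X ut ot N Q"
  have "c k (-1) = c k 1" if "k < N" for k
    by (rule rule_ends[OF coloring_full_rule[OF c] _ that]) (use coloring_in[OF c] in blast)
  then show "\<exists>c'\<in>tangle_colorings X ut ot N {}. same_ends N c c'"
    using coloring_in[OF c]
    by (intro bexI[of _ "\<lambda>k u. c k (-1)"]) (auto simp: same_ends_def tangle_colorings_def)
qed

lemma empty_replaceable:
  assumes "\<And>x. (\<And>k. k < N \<Longrightarrow> x k \<in> X) \<Longrightarrow>
      \<exists>m. (\<forall>k<N. m k \<in> X) \<and> full_rule ut ot Q a x m x"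
  shows "tangle_replaceable X ut ot N {} Q"
  unfolding tangle_replaceable_def
proof (intro conjI ballI)
  have const: "c k u = c k (-1)" if c: "c \<in> tangle_colorings X ut ot N {}" and "k < N" "u \<in> {-1..1}" for c k u
    by (rule local_constant_on[of "{-1..1}"])
      (use that tangle_coloring_local[OF c] in \<open>auto simp: passes_def\<close>)
  fix c assume c: "c \<in> tangle_colorings X ut ot N {}"
  have "c k (-1) \<in> X" if "k < N" for k
    using tangle_coloring_in[OF c that, of "-1"] by (simp add: passes_def)
  then obtain m where m: "\<forall>k<N. m k \<in> X" "full_rule ut ot Q a (\<lambda>k. c k (-1)) m (\<lambda>k. c k (-1))"
    using assms[of "\<lambda>k. c k (-1)"] by blast
  show "\<exists>c'\<in>tangle_colorings X ut ot N Q. same_ends N c c'"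
  proof (rule bexI[OF _ step_coloring[OF m(2), of X]])
    show "same_ends N c (\<lambda>k. step (a k) (b k) (c k (-1)) (m k) (c k (-1)))"
      using const[OF c, of _ 1] by (simp add: same_ends_def step_ends)
  qed (use m \<open>\<And>k. k < N \<Longrightarrow> c k (-1) \<in> X\<close> in blast)
  fix c' assume c': "c' \<in> tangle_colorings X ut ot N {}"
  show "same_ends N c c' \<longrightarrow> (\<forall>k<N. \<forall>u\<in>{-1..1}. \<not> passes {} k u \<longrightarrow> c k u = c' k u)"
    using const[OF c] const[OF c'] by (metis same_ends_def)
qed

end

lemma full_replaceable:
  assumes "full_tangle N Q a b" "full_tangle N Q' a' b'"
    and move: "\<And>x m z. full_rule ut ot Q a x m z \<Longrightarrow>
      (\<And>k. k < N \<Longrightarrow> x k \<in> X \<and> m k \<in> X \<and> z k \<in> X) \<Longrightarrow>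
      \<exists>m'. (\<forall>k<N. m' k \<in> X) \<and> full_rule ut ot Q' a' x m' z"
    and unique: "unique_middles X ut ot N Q a"
  shows "tangle_replaceable X ut ot N Q Q'"
proof -
  interpret Q: full_tangle N Q a b by fact
  interpret Q': full_tangle N Q' a' b' by fact
  show ?thesis
    unfolding tangle_replaceable_def
  proof (rule conjI[OF ballI Q.full_unique[OF unique]])
    fix c assume c: "c \<in> tangle_colorings X ut ot N Q"
    obtain m' where m': "\<forall>k<N. m' k \<in> X" "full_rule ut ot Q' a' (\<lambda>k. c k (-1)) m' (\<lambda>k. c k 1)"
      using move[OF Q.coloring_full_rule[OF c]] Q.coloring_in[OF c] by blast
    show "\<exists>c'\<in>tangle_colorings X ut ot N Q'. same_ends N c c'"
    proof (rule bexI[OF _ Q'.step_coloring[OF m'(2), of X]])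
      show "same_ends N c (\<lambda>k. step (a' k) (b' k) (c k (-1)) (m' k) (c k 1))"
        by (simp add: same_ends_def Q'.step_ends)
    qed (use m' Q.coloring_in[OF c] in blast)
  qed
qed

section \<open>The Reidemeister moves\<close>

context finite_biquandle
begin

lemma pair_cell_rule:
  assumes "k1 \<in> X" "k2 \<in> X" "l1 \<in> X" "l2 \<in> X"
  shows "pair_cell w p (k1, k2) (l1, l2) \<longleftrightarrow>
    (if w then crossing_rule under_op over_op p k1 k2 l1 l2 else crossing_rule under_op over_op (\<not> p) l1 l2 k1 k2)"
  using assms by (auto simp: pair_cell_def crossing_rule_def cell_def)

lemma pair_cell_in: "pair_cell w p (k1, k2) (l1, l2) \<Longrightarrow> k1 \<in> X \<and> k2 \<in> X \<and> l1 \<in> X \<and> l2 \<in> X"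
  using cell_closed unfolding pair_cell_def by (auto split: if_splits)

text \<open>The counterpart of \<open>cell_determined\<close>: the same bijections, used for
  surjectivity.\<close>

lemma cell_exists:
  assumes "p \<in> X" "q \<in> X"
  shows "\<exists>x y a b. cell x y a b \<and> (if i then a else x) = p \<and> (if j then b else y) = q"
proof (cases i; cases j)
  assume "\<not> i" "\<not> j"
  then show ?thesis
    using assms by (auto simp: cell_def)
next
  assume ij: "i" "\<not> j"
  have "p \<in> (\<lambda>x. under_op x q) ` X"
    using under_bij[OF assms(2)] assms(1) by (simp add: bij_betw_def)
  then show ?thesis
    using ij assms by (auto simp: cell_def)
next
  assume ij: "\<not> i" "j"
  have "q \<in> (\<lambda>x. over_op x p) ` X"
    using over_bij[OF assms(1)] assms(2) by (simp add: bij_betw_def)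
  then show ?thesis
    using ij assms by (auto simp: cell_def)
next
  assume ij: "i" "j"
  have "(q, p) \<in> (\<lambda>(x, y). (over_op y x, under_op x y)) ` (X \<times> X)"
    using sideways_bij assms by (simp add: bij_betw_def)
  then show ?thesis
    using ij by (auto simp: cell_def)
qed

lemma pair_cell_exists:
  assumes "p \<in> X" "q \<in> X"
  shows "\<exists>k1 k2 l1 l2. pair_cell w s (k1, k2) (l1, l2) \<and> (if i then k2 else k1) = p \<and> (if j then l2 else l1) = q"
proof (cases w; cases s)
  assume "w" "s"
  moreover obtain x y a b where "cell x y a b" "(if j then a else x) = q" "(if \<not> i then b else y) = p"
    using cell_exists[OF assms(2,1), of j "\<not> i"] by blast
  ultimately show ?thesis
    by (intro exI[of _ b] exI[of _ y] exI[of _ x] exI[of _ a]) (auto simp: pair_cell_def split: if_splits)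
next
  assume "w" "\<not> s"
  moreover obtain x y a b where "cell x y a b" "(if \<not> j then a else x) = q" "(if i then b else y) = p"
    using cell_exists[OF assms(2,1), of "\<not> j" i] by blast
  ultimately show ?thesis
    by (intro exI[of _ y] exI[of _ b] exI[of _ a] exI[of _ x]) (auto simp: pair_cell_def split: if_splits)
next
  assume "\<not> w" "s"
  moreover obtain x y a b where "cell x y a b" "(if \<not> i then a else x) = p" "(if j then b else y) = q"
    using cell_exists[OF assms, of "\<not> i" j] by blast
  ultimately show ?thesis
    by (intro exI[of _ a] exI[of _ x] exI[of _ y] exI[of _ b]) (auto simp: pair_cell_def split: if_splits)
next
  assume "\<not> w" "\<not> s"
  moreover obtain x y a b where "cell x y a b" "(if i then a else x) = p" "(if \<not> j then b else y) = q"
    using cell_exists[OF assms, of i "\<not> j"] by blast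
  ultimately show ?thesis
    by (intro exI[of _ x] exI[of _ a] exI[of _ b] exI[of _ y]) (auto simp: pair_cell_def split: if_splits)
qed

text \<open>Exchanging before and after on both strands turns the right-hand labels of one case into
  those of the other. The second crossing of a finger is compared with the first in this
  way.\<close>

lemma pair_cell_reverse: "pair_cell w (\<not> p) (k1, k2) (l1, l2) \<longleftrightarrow> pair_cell w p (k2, k1) (l2, l1)"
  by (simp add: pair_cell_def)

text \<open>By \<open>diagonal\<close> the sideways map sends a diagonal pair (x, x) to the diagonal
  pair with entry \<open>under_op x x\<close>, so its injectivity gives injectivity here, and
  finiteness gives the rest.\<close>

lemma kink_bij: "bij_betw (\<lambda>x. under_op x x) X X"
proof -
  have "inj_on (\<lambda>x. under_op x x) X"
  proof (rule inj_onI)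
    fix x y assume xy: "x \<in> X" "y \<in> X" "under_op x x = under_op y y"
    then have "over_op x x = over_op y y"
      by (simp flip: diagonal)
    with xy show "x = y"
      using inj_onD[OF bij_betw_imp_inj_on[OF sideways_bij], of "(x, x)" "(y, y)"] by simp
  qed
  moreover have "(\<lambda>x. under_op x x) ` X = X"
    using calculation finite_X by (intro endo_inj_surj) (auto simp: under_closed)
  ultimately show ?thesis
    by (simp add: bij_betw_def)
qed

lemma kink_onto:
  assumes "m \<in> X" obtains w where "w \<in> X" "under_op w w = m"
proof -
  have "m \<in> (\<lambda>x. under_op x x) ` X"
    using bij_betw_imp_surj_on[OF kink_bij] assms by simp
  then show thesis
    using that by blast
qed

text \<open>If \<open>p\<close> fails, the sideways map sends (z, x) to (m, m). The same value is
  attained at a diagonal pair (w, w), which forces z = x.\<close>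

lemma kink_ends:
  assumes "crossing_rule under_op over_op p x m m z" "x \<in> X" "m \<in> X" "z \<in> X"
  shows "x = z"
proof (cases p)
  case True
  then show ?thesis
    using assms by (simp add: crossing_rule_def diagonal)
next
  case False
  obtain w where w: "w \<in> X" "under_op w w = m"
    using kink_onto[OF assms(3)] .
  have "over_op x z = m" "under_op z x = m"
    using False assms(1) by (auto simp: crossing_rule_def)
  moreover have "over_op w w = m"
    using w diagonal[OF w(1)] by simp
  ultimately have "(over_op x z, under_op z x) = (over_op w w, under_op w w)"
    using w(2) by simp
  then show ?thesis
    using inj_onD[OF bij_betw_imp_inj_on[OF sideways_bij], of "(z, x)" "(w, w)"] assms w by simp
qed

lemma kink_exists:
  assumes "x \<in> X"
  shows "\<exists>m\<in>X. crossing_rule under_op over_op p x m m x"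
proof (cases p)
  case True
  obtain m where "m \<in> X" "under_op m m = x"
    using kink_onto[OF assms] .
  then show ?thesis
    using True by (auto simp: crossing_rule_def diagonal[symmetric])
next
  case False
  then show ?thesis
    using assms by (auto simp: crossing_rule_def diagonal over_closed intro!: bexI[of _ "over_op x x"])
qed

lemma kink_unique:
  assumes "crossing_rule under_op over_op p x m m z" "crossing_rule under_op over_op p x m' m' z"
    "m \<in> X" "m' \<in> X"
  shows "m = m'"
  using assms inj_onD[OF bij_betw_imp_inj_on[OF kink_bij], of m m']
  by (cases p) (auto simp: crossing_rule_def)

text \<open>Read backwards, a kink that passes below first becomes one that passes above
  first.\<close>

lemma crossing_rule_reverse:
  "crossing_rule under_op over_op p m z x m \<longleftrightarrow> crossing_rule under_op over_op (\<not> p) z m m x"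
  by (auto simp: crossing_rule_def)

end

section \<open>Smoothness, ends and crossings of the model tangles\<close>

lemma has_vector_derivative_Complex:
  assumes "(f has_real_derivative f') (at u)" "(g has_real_derivative g') (at u)"
  shows "((\<lambda>u. Complex (f u) (g u)) has_vector_derivative Complex f' g') (at u)"
proof -
  have "((\<lambda>u. f u *\<^sub>R 1 + g u *\<^sub>R \<i>) has_vector_derivative f' *\<^sub>R 1 + g' *\<^sub>R \<i>) (at u)"
    using assms
    by (intro has_vector_derivative_add)
      (auto intro: has_vector_derivative_scaleR[of _ _ _ _ "\<lambda>_. _" 0, simplified]
        simp: has_real_derivative_iff_has_vector_derivative)
  moreover have "Complex x y = x *\<^sub>R 1 + y *\<^sub>R \<i>" for x y
    by (simp add: complex_eq_iff)
  ultimately show ?thesis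
    by simp
qed

lemma bump_deriv: "(bump has_real_derivative - 4 * u * (1 - u\<^sup>2)) (at u)"
  unfolding bump_def[abs_def] by (auto intro!: derivative_eq_intros simp: power2_eq_square algebra_simps)

lemma bump_nonneg: "0 \<le> bump u"
  by (simp add: bump_def)

lemma bump_le_1: "u \<in> {-1..1} \<Longrightarrow> bump u \<le> 1"
  unfolding bump_def by (intro power_le_one) (auto simp: abs_square_le_1)

text \<open>On [-1, 1] the number 1 - u^2 is nonnegative, so its square determines it and only the
  sign of \<open>u\<close> remains open.\<close>

lemma bump_eq_iff:
  assumes "u \<in> {-1..1}" "v \<in> {-1..1}"
  shows "bump u = bump v \<longleftrightarrow> u = v \<or> u = - v"
proof -
  have "0 \<le> 1 - u\<^sup>2" "0 \<le> 1 - v\<^sup>2"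
    using assms by (auto simp: abs_square_le_1)
  then have "bump u = bump v \<longleftrightarrow> 1 - u\<^sup>2 = 1 - v\<^sup>2"
    unfolding bump_def by (rule power_eq_iff_eq_base[OF zero_less_numeral])
  then show ?thesis
    by (simp add: power2_eq_iff)
qed

lemma bump_minus [simp]: "bump (- u) = bump u"
  by (simp add: bump_def)

lemma bump_1 [simp]: "bump 1 = 0"
  by (simp add: bump_def)

lemma bump_eq_0_iff: "bump u = 0 \<longleftrightarrow> u = 1 \<or> u = -1"
  by (auto simp: bump_def power2_eq_1_iff)

lemma differentiable_Complex:
  assumes "f differentiable (at u)" "g differentiable (at (u :: real))"
  shows "(\<lambda>u. Complex (f u) (g u)) differentiable (at u)"
proof -
  obtain f' g' where "(f has_real_derivative f') (at u)" "(g has_real_derivative g') (at u)"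
    using assms by (auto simp: real_differentiable_def)
  then show ?thesis
    using has_vector_derivative_Complex by (blast intro: differentiableI_vector)
qed

lemma differentiable_bump: "bump differentiable (at u)"
  using bump_deriv by (auto simp: real_differentiable_def)

lemma proper_tangleI:
  assumes "\<And>k u. k < length T \<Longrightarrow> (T ! k) differentiable (at u)"
    and "\<And>k l u v. k < length T \<Longrightarrow> l < length T \<Longrightarrow> u \<in> {-1, 1} \<Longrightarrow> v \<in> {-1..1} \<Longrightarrow>
      (T ! k) u = (T ! l) v \<Longrightarrow> k = l \<and> u = v"
  shows "proper_tangle T"
  unfolding proper_tangle_def by (intro conjI allI impI ballI assms(1)) (blast dest: assms(2))+

lemma proper_R1_flat: "proper_tangle R1_flat"
proof (rule proper_tangleI)
  show "(R1_flat ! k) differentiable (at u)" if "k < length R1_flat" for k u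
    using that by (simp add: R1_flat_def differentiable_Complex)
qed (auto simp: R1_flat_def)

lemma proper_R1_kink: "proper_tangle R1_kink"
proof (rule proper_tangleI)
  show "(R1_kink ! k) differentiable (at u)" if "k < length R1_kink" for k u
  proof -
    have "(\<lambda>u. u * (1 - 4 * bump u)) differentiable (at u)" "(\<lambda>u. bump u / 2) differentiable (at u)"
      by (rule derivative_intros differentiable_bump zero_neq_numeral[symmetric])+
    then show ?thesis
      using that by (simp add: R1_kink_def differentiable_Complex)
  qed
  fix k l :: nat and u v :: real
  assume *: "k < length R1_kink" "l < length R1_kink" "u \<in> {-1, 1}" "(R1_kink ! k) u = (R1_kink ! l) v"
  have "bump u = 0"
    using *(3) by (auto simp: bump_eq_0_iff)
  moreover have "Complex (u * (1 - 4 * bump u)) (bump u / 2) = Complex (v * (1 - 4 * bump v)) (bump v / 2)"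
    using *(1,2,4) by (simp del: complex.inject add: R1_kink_def)
  ultimately show "k = l \<and> u = v"
    using *(1,2) by (simp add: R1_kink_def)
qed

lemma proper_R2_apart: "\<sigma> = 1 \<or> \<sigma> = -1 \<Longrightarrow> proper_tangle (R2_apart \<sigma>)"
proof (rule proper_tangleI)
  show "(R2_apart \<sigma> ! k) differentiable (at u)" if "k < length (R2_apart \<sigma>)" for k u
    using that by (auto simp: R2_apart_def less_Suc_eq differentiable_Complex)
qed (auto simp: R2_apart_def less_Suc_eq)

lemma proper_R2_crossed: "\<sigma> = 1 \<or> \<sigma> = -1 \<Longrightarrow> proper_tangle (R2_crossed \<sigma>)"
proof (rule proper_tangleI)
  show "(R2_crossed \<sigma> ! k) differentiable (at u)" if "k < length (R2_crossed \<sigma>)" for k u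
    using that differentiable_bump by (auto simp: R2_crossed_def less_Suc_eq differentiable_Complex)
qed (auto simp: R2_crossed_def less_Suc_eq)

lemma proper_R3:
  assumes "\<epsilon> = 1 \<or> \<epsilon> = -1" "\<sigma> = 1 \<or> \<sigma> = -1" "\<tau> = 1 \<or> \<tau> = -1"
  shows "proper_tangle (R3_tangle \<epsilon> \<sigma> \<tau>)"
proof (rule proper_tangleI)
  show "(R3_tangle \<epsilon> \<sigma> \<tau> ! k) differentiable (at u)" if "k < length (R3_tangle \<epsilon> \<sigma> \<tau>)" for k u
  proof -
    have "(\<lambda>u. \<epsilon> * bump u / 2) differentiable (at u)" "(\<lambda>u. c * u / 2) differentiable (at u)"
      "(\<lambda>u. c * u) differentiable (at u)" for c u
      by (rule derivative_intros differentiable_bump zero_neq_numeral[symmetric])+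
    then show ?thesis
      using that by (auto simp: R3_tangle_def less_Suc_eq differentiable_Complex)
  qed
  fix k l u v
  assume *: "k < length (R3_tangle \<epsilon> \<sigma> \<tau>)" "l < length (R3_tangle \<epsilon> \<sigma> \<tau>)" "u \<in> {-1, 1}" "v \<in> {-1..1}"
    "(R3_tangle \<epsilon> \<sigma> \<tau> ! k) u = (R3_tangle \<epsilon> \<sigma> \<tau> ! l) v"
  define T where "T = R3_tangle \<epsilon> \<sigma> \<tau>"
  have T: "(T ! 0) w = Complex w (\<epsilon> * bump w / 2)" "(T ! Suc 0) w = Complex (\<sigma> * w / 2) (\<sigma> * w)"
    "(T ! 2) w = Complex (\<tau> * w / 2) (- \<tau> * w)" for w
    by (simp_all add: T_def R3_tangle_def)
  have kl: "k = 0 \<or> k = 1 \<or> k = 2" "l = 0 \<or> l = 1 \<or> l = 2"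
    using *(1,2) by (auto simp: R3_tangle_def)
  have u: "\<bar>u\<bar> = 1" "bump u = 0"
    using *(3) by (auto simp: bump_eq_0_iff)
  have signs: "\<bar>\<epsilon>\<bar> = 1" "\<bar>\<sigma>\<bar> = 1" "\<bar>\<tau>\<bar> = 1"
    using assms by auto
  \<comment> \<open>The ends of strands 1 and 2 have height 1 or -1, whereas strand 0 stays between
    -1/2 and 1/2, so they cannot meet.\<close>
  have small: "\<bar>\<epsilon> * bump v / 2\<bar> < 1"
    using bump_le_1[OF *(4)] bump_nonneg[of v] signs by (simp add: abs_mult)
  have eq: "Re ((T ! k) u) = Re ((T ! l) v)" "Im ((T ! k) u) = Im ((T ! l) v)"
    using *(5) by (simp_all add: T_def)
  have big: "\<bar>\<sigma> * u\<bar> = 1" "\<bar>\<tau> * u\<bar> = 1"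
    using u signs by (simp_all add: abs_mult)
  have nz: "\<sigma> \<noteq> 0" "\<tau> \<noteq> 0" "u \<noteq> 0"
    using signs u by auto
  show "k = l \<and> u = v"
    using kl
  proof (elim disjE)
    assume "k = 0" "l = 0" then show ?thesis using eq by (simp add: T)
  next
    assume "k = 0" "l = 1" then show ?thesis using eq u nz by (simp add: T)
  next
    assume "k = 0" "l = 2" then show ?thesis using eq u nz by (simp add: T)
  next
    assume "k = 1" "l = 0" then show ?thesis using eq small big by (simp add: T)
  next
    assume "k = 1" "l = 1" then show ?thesis using eq nz by (simp add: T)
  next
    assume "k = 1" "l = 2"
    then have "\<sigma> * u = 0" using eq by (simp add: T)
    then show ?thesis using nz by simp
  next
    assume "k = 2" "l = 0" then show ?thesis using eq small big by (simp add: T)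
  next
    assume "k = 2" "l = 1"
    then have "\<tau> * u = 0" using eq by (simp add: T)
    then show ?thesis using nz by simp
  next
    assume "k = 2" "l = 2" then show ?thesis using eq nz by (simp add: T)
  qed
qed

lemma full_rule_insert:
  "full_rule ut ot (insert (k, u, l, v, p) Q) a x m z \<longleftrightarrow>
     crossing_rule ut ot p (if u = a k then x k else m k) (if u = a k then m k else z k)
       (if v = a l then x l else m l) (if v = a l then m l else z l) \<and> full_rule ut ot Q a x m z"
  unfolding full_rule_def by auto

lemma full_rule_empty: "full_rule ut ot {} a x m z"
  by (simp add: full_rule_def)

lemma tangle_crossings_R1_flat: "tangle_crossings \<kappa> W R1_flat = {}"
  by (auto simp: tangle_crossings_def R1_flat_def)

lemma tangle_crossings_R2_apart: "\<sigma> = 1 \<or> \<sigma> = -1 \<Longrightarrow> tangle_crossings \<kappa> W (R2_apart \<sigma>) = {}"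
  by (auto simp: tangle_crossings_def R2_apart_def less_Suc_eq)

lemma tangle_crossings_virtual: "tangle_crossings \<kappa> virtual_rule T = {}"
  by (auto simp: tangle_crossings_def)

text \<open>Equal heights at different times force \<open>v = - u\<close>; the first coordinate is
  odd, so it has to vanish, which means \<open>bump u = 1 / 4\<close>, that is u^2 = 1/2.\<close>

lemma kink_double_point:
  "\<exists>a. 0 < a \<and> a < 1 \<and> (\<forall>u\<in>{-1..1}. \<forall>v\<in>{-1..1}. u \<noteq> v \<longrightarrow>
     ((R1_kink ! 0) u = (R1_kink ! 0) v \<longleftrightarrow> u = a \<and> v = - a \<or> u = - a \<and> v = a))"
proof (intro exI conjI ballI impI)
  let ?a = "sqrt (1 / 2) :: real"
  show a: "0 < ?a" "?a < 1"
    by (simp_all add: real_sqrt_lt_1_iff)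
  have bump_a: "bump ?a = 1 / 4"
    by (simp add: bump_def power2_eq_square)
  fix u v :: real assume uv: "u \<in> {-1..1}" "v \<in> {-1..1}" "u \<noteq> v"
  have quarter: "bump w = 1 / 4 \<longleftrightarrow> w = ?a \<or> w = - ?a" if "w \<in> {-1..1}" for w
    using bump_eq_iff[OF that, of ?a] a bump_a by simp
  have "(R1_kink ! 0) u = (R1_kink ! 0) v \<longleftrightarrow>
      u * (1 - 4 * bump u) = v * (1 - 4 * bump v) \<and> bump u = bump v"
    by (auto simp: R1_kink_def)
  also have "\<dots> \<longleftrightarrow> v = - u \<and> bump u = 1 / 4"
  proof
    assume *: "u * (1 - 4 * bump u) = v * (1 - 4 * bump v) \<and> bump u = bump v"
    then have "v = - u"
      using bump_eq_iff[OF uv(1,2)] uv(3) by auto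
    moreover from this * have "u * (1 - 4 * bump u) = - u * (1 - 4 * bump u)"
      by simp
    then have "u = 0 \<or> bump u = 1 / 4"
      by auto
    ultimately show "v = - u \<and> bump u = 1 / 4"
      using uv(3) by auto
  qed auto
  also have "\<dots> \<longleftrightarrow> u = ?a \<and> v = - ?a \<or> u = - ?a \<and> v = ?a"
    using quarter[OF uv(1)] by auto
  finally show "(R1_kink ! 0) u = (R1_kink ! 0) v \<longleftrightarrow> u = ?a \<and> v = - ?a \<or> u = - ?a \<and> v = ?a" .
qed

section \<open>First Reidemeister move: labels around the kink\<close>

context finite_biquandle
begin

lemma kink_replaceable:
  assumes "0 < a" "a < 1" "Q = {(0, - a, 0, a, p)} \<or> Q = {(0, a, 0, - a, p)}"
  shows "tangle_replaceable X under_op over_op 1 Q {} \<and> tangle_replaceable X under_op over_op 1 {} Q"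
proof -
  interpret full_tangle 1 Q "\<lambda>_. - a" "\<lambda>_. a"
    by unfold_locales (use assms in \<open>auto simp: passes_def\<close>)
  \<comment> \<open>\<open>f\<close> records that the first passage is the upper one. Otherwise the
    kink is read backwards, which exchanges its ends and negates the sign.\<close>
  obtain q f where rule: "\<And>x m z. full_rule under_op over_op Q (\<lambda>_. - a) x m z \<longleftrightarrow>
      (if f then crossing_rule under_op over_op q (x 0) (m 0) (m 0) (z 0)
       else crossing_rule under_op over_op q (z 0) (m 0) (m 0) (x 0))"
    using assms(3)
  proof
    assume "Q = {(0, - a, 0, a, p)}"
    then show thesis
      using assms(1) by (intro that[of True p]) (simp add: full_rule_insert full_rule_empty)
  next
    assume "Q = {(0, a, 0, - a, p)}"
    then show thesis
      using assms(1) by (intro that[of False "\<not> p"])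
        (simp add: full_rule_insert full_rule_empty crossing_rule_reverse[of p])
  qed
  have ends: "x 0 = z 0" if "full_rule under_op over_op Q (\<lambda>_. - a) x m z" "x 0 \<in> X" "m 0 \<in> X" "z 0 \<in> X" for x m z
    using that kink_ends[of q "x 0" "m 0" "z 0"] kink_ends[of q "z 0" "m 0" "x 0"]
    by (auto simp: rule split: if_splits)
  have "m 0 = m' 0" if "full_rule under_op over_op Q (\<lambda>_. - a) x m z"
    "full_rule under_op over_op Q (\<lambda>_. - a) x m' z" "m 0 \<in> X" "m' 0 \<in> X" for x m m' z
    using that kink_unique[of q "x 0" "m 0" "z 0" "m' 0"] kink_unique[of q "z 0" "m 0" "x 0" "m' 0"]
    by (auto simp: rule split: if_splits)
  then have unique: "unique_middles X under_op over_op 1 Q (\<lambda>_. - a)"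
    by (auto simp: unique_middles_def)
  have "tangle_replaceable X under_op over_op 1 Q {}"
    by (rule replaceable_empty[OF _ unique]) (use ends in auto)
  moreover have "tangle_replaceable X under_op over_op 1 {} Q"
  proof (rule empty_replaceable)
    fix x :: "nat \<Rightarrow> 'a" assume "\<And>k. k < 1 \<Longrightarrow> x k \<in> X"
    then obtain m where "m \<in> X" "crossing_rule under_op over_op q (x 0) m m (x 0)"
      using kink_exists[of "x 0" q] by auto
    then show "\<exists>m. (\<forall>k<1. m k \<in> X) \<and> full_rule under_op over_op Q (\<lambda>_. - a) x m x"
      by (intro exI[of _ "\<lambda>_. m"]) (simp add: rule)
  qed
  ultimately show ?thesis ..
qed

lemma same_colorings_classical_R1:
  assumes D: "link_diagram D" "link_diagram D'" and "classical_R1 D D'"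
  shows "same_colorings X under_op over_op D D'"
proof -
  obtain W where W: "W = (\<lambda>(k, u) (l, v). u < v) \<or> W = (\<lambda>(k, u) (l, v). v < u)"
    and move: "local_move W R1_flat R1_kink D D'"
    using assms(3) unfolding classical_R1_def by blast
  obtain a where a: "0 < a" "a < 1" and double: "\<forall>u\<in>{-1..1}. \<forall>v\<in>{-1..1}. u \<noteq> v \<longrightarrow>
     ((R1_kink ! 0) u = (R1_kink ! 0) v \<longleftrightarrow> u = a \<and> v = - a \<or> u = - a \<and> v = a)"
    using kink_double_point by blast
  show ?thesis
  proof (rule same_colorings_local_move_replaceable[OF D move proper_R1_flat proper_R1_kink])
    fix \<kappa> :: real
    define Q where "Q = tangle_crossings \<kappa> W R1_kink"
    define s where "s u v \<longleftrightarrow> \<kappa> * det2 (vector_derivative (R1_kink ! 0) (at u)) (vector_derivative (R1_kink ! 0) (at v)) > 0" for u v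
    have mem: "(k, u, l, v, p) \<in> Q \<longleftrightarrow> k = 0 \<and> l = 0 \<and> (u = a \<and> v = - a \<or> u = - a \<and> v = a) \<and> W (0, u) (0, v) \<and> (p \<longleftrightarrow> s u v)"
      for k u l v p
    proof -
      have "length R1_kink = 1"
        by (simp add: R1_kink_def)
      then have "(k, u, l, v, p) \<in> Q \<longleftrightarrow> k = 0 \<and> l = 0 \<and> u \<in> {-1..1} \<and> v \<in> {-1..1} \<and> u \<noteq> v \<and>
          (R1_kink ! 0) u = (R1_kink ! 0) v \<and> W (0, u) (0, v) \<and> (p \<longleftrightarrow> s u v)"
        unfolding Q_def tangle_crossings_def s_def by auto
      then show ?thesis
        using double[rule_format, of u v] a by auto
    qed
    have "Q = {(0, - a, 0, a, s (- a) a)} \<or> Q = {(0, a, 0, - a, s a (- a))}"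
      using W
    proof
      assume "W = (\<lambda>(k, u) (l, v). u < v)"
      then have "Q = {(0, - a, 0, a, s (- a) a)}"
        using a by (auto simp: set_eq_iff mem)
      then show ?thesis ..
    next
      assume "W = (\<lambda>(k, u) (l, v). v < u)"
      then have "Q = {(0, a, 0, - a, s a (- a))}"
        using a by (auto simp: set_eq_iff mem)
      then show ?thesis ..
    qed
    then have "tangle_replaceable X under_op over_op 1 Q {} \<and> tangle_replaceable X under_op over_op 1 {} Q"
      using kink_replaceable[OF a] by blast
    then show "tangle_replaceable X under_op over_op (length R1_flat) (tangle_crossings \<kappa> W R1_flat) (tangle_crossings \<kappa> W R1_kink) \<and>
      tangle_replaceable X under_op over_op (length R1_flat) (tangle_crossings \<kappa> W R1_kink) (tangle_crossings \<kappa> W R1_flat)"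
      unfolding tangle_crossings_R1_flat Q_def[symmetric] by (simp add: R1_flat_def)
  qed
qed

end

section \<open>Second Reidemeister move: labels around the finger\<close>

lemma passes_empty: "\<not> passes {} i s"
  by (simp add: passes_def)

lemma passes_insert:
  "passes (insert (k, u, l, v, p) Q) i s \<longleftrightarrow> i = k \<and> s = u \<or> i = l \<and> s = v \<or> passes Q i s"
  unfolding passes_def insert_iff prod.inject by blast

text \<open>The finger has height 1/2 - \<open>bump u\<close> and meets the axis where (1 - u^2)^2 =
  1/2, which explains the nested root.\<close>

lemma finger_double_points:
  "\<exists>c. 0 < c \<and> c < 1 \<and> (\<forall>u\<in>{-1..1}. bump u = 1 / 2 \<longleftrightarrow> u = c \<or> u = - c)"
proof (intro exI conjI ballI)
  let ?h = "sqrt (1 / 2) :: real" and ?c = "sqrt (1 - sqrt (1 / 2)) :: real"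
  have h: "0 < ?h" "?h < 1"
    by (simp_all add: real_sqrt_lt_1_iff)
  show c: "0 < ?c" "?c < 1"
    using h by (simp_all add: real_sqrt_lt_1_iff)
  have "?c\<^sup>2 = 1 - ?h"
    using h by (subst real_sqrt_pow2) auto
  then have half: "bump ?c = 1 / 2"
    unfolding bump_def by (simp add: real_sqrt_pow2)
  have "?c \<in> {-1..1}"
    using c unfolding atLeastAtMost_iff by linarith
  then show "bump u = 1 / 2 \<longleftrightarrow> u = ?c \<or> u = - ?c" if "u \<in> {-1..1}" for u
    using bump_eq_iff[OF that, of ?c] unfolding half by blast
qed

lemma vector_derivative_Complex:
  assumes "(f has_real_derivative f') (at u)" "(g has_real_derivative g') (at u)"
  shows "vector_derivative (\<lambda>u. Complex (f u) (g u)) (at u) = Complex f' g'"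
  by (rule vector_derivative_at[OF has_vector_derivative_Complex[OF assms]])

lemma R2_velocities:
  "vector_derivative (R2_crossed \<sigma> ! 0) (at u) = Complex 1 (4 * u * (1 - u\<^sup>2))"
  "vector_derivative (R2_crossed \<sigma> ! 1) (at u) = Complex \<sigma> 0"
proof -
  have "((\<lambda>u. 1 / 2 - bump u) has_real_derivative 4 * u * (1 - u\<^sup>2)) (at u)"
    using DERIV_diff[OF DERIV_const[of "1 / 2"] bump_deriv] by simp
  then show "vector_derivative (R2_crossed \<sigma> ! 0) (at u) = Complex 1 (4 * u * (1 - u\<^sup>2))"
    using vector_derivative_Complex[OF DERIV_ident] by (simp add: R2_crossed_def)
  have "((\<lambda>u. \<sigma> * u) has_real_derivative \<sigma>) (at u)"
    using DERIV_cmult[OF DERIV_ident] by fastforce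
  then show "vector_derivative (R2_crossed \<sigma> ! 1) (at u) = Complex \<sigma> 0"
    using vector_derivative_Complex[OF _ DERIV_const] by (simp add: R2_crossed_def)
qed

lemma R2_meet:
  assumes "\<sigma> = 1 \<or> \<sigma> = -1"
  shows "(R2_crossed \<sigma> ! 0) u = (R2_crossed \<sigma> ! 1) v \<longleftrightarrow> v = \<sigma> * u \<and> bump u = 1 / 2"
    "(R2_crossed \<sigma> ! 0) u = (R2_crossed \<sigma> ! 0) v \<longleftrightarrow> u = v"
    "(R2_crossed \<sigma> ! 1) u = (R2_crossed \<sigma> ! 1) v \<longleftrightarrow> u = v"
  using assms by (auto simp: R2_crossed_def)

context finite_biquandle
begin

text \<open>The two crossings have opposite signs. Read backwards, the second one obeys the same
  \<open>pair_cell\<close> condition as the first, with the same middle labels; as these determine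
  the outer ones, the labels on both sides of the finger agree.\<close>

lemma finger_replaceable:
  assumes c: "0 < c" "c < 1" and \<sigma>: "\<sigma> = 1 \<or> \<sigma> = -1"
    and Q: "Q = (if w then {(0, - c, 1, - \<sigma> * c, s), (0, c, 1, \<sigma> * c, \<not> s)}
        else {(1, - \<sigma> * c, 0, - c, \<not> s), (1, \<sigma> * c, 0, c, s)})"
  shows "tangle_replaceable X under_op over_op 2 Q {} \<and> tangle_replaceable X under_op over_op 2 {} Q"
proof -
  interpret full_tangle 2 Q "\<lambda>_. - c" "\<lambda>_. c"
  proof
    show "passes Q k u \<longleftrightarrow> u = - c \<or> u = c" if "k < 2" for k u
      using that \<sigma> by (cases w) (auto simp: passes_insert passes_empty Q less_2_cases_iff)
  qed (use c Q in \<open>auto split: if_splits\<close>)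
  have rule: "full_rule under_op over_op Q (\<lambda>_. - c) x m z \<longleftrightarrow>
      pair_cell w s (x 0, m 0) (if \<sigma> = 1 then (x 1, m 1) else (m 1, z 1)) \<and>
      pair_cell w s (z 0, m 0) (if \<sigma> = 1 then (z 1, m 1) else (m 1, x 1))"
    if "\<And>k. k < 2 \<Longrightarrow> x k \<in> X \<and> m k \<in> X \<and> z k \<in> X" for x m z
  proof -
    have X: "x 0 \<in> X" "m 0 \<in> X" "z 0 \<in> X" "x 1 \<in> X" "m 1 \<in> X" "z 1 \<in> X"
      using that by auto
    have "pair_cell w s (z 0, m 0) (if \<sigma> = 1 then (z 1, m 1) else (m 1, x 1)) \<longleftrightarrow>
      pair_cell w (\<not> s) (m 0, z 0) (if \<sigma> = 1 then (m 1, z 1) else (x 1, m 1))"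
      by (simp add: pair_cell_reverse)
    then show ?thesis
      using c \<sigma> X by (cases w) (auto simp: Q full_rule_insert full_rule_empty pair_cell_rule)
  qed
  have ends: "x k = z k"
    if "full_rule under_op over_op Q (\<lambda>_. - c) x m z" "\<And>k. k < 2 \<Longrightarrow> x k \<in> X \<and> m k \<in> X \<and> z k \<in> X" "k < 2" for x m z k
  proof -
    have "pair_cell w s (x 0, m 0) (if \<sigma> = 1 then (x 1, m 1) else (m 1, z 1))"
      "pair_cell w s (z 0, m 0) (if \<sigma> = 1 then (z 1, m 1) else (m 1, x 1))"
      using that(1) rule[OF that(2)] by auto
    then have "x 0 = z 0 \<and> x 1 = z 1"
      using pair_cell_determined[of w s "x 0" "m 0" "x 1" "m 1" "z 0" "m 0" "z 1" "m 1"]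
        pair_cell_determined[of w s "x 0" "m 0" "m 1" "z 1" "z 0" "m 0" "m 1" "x 1"]
      by (cases "\<sigma> = 1") simp_all
    then show ?thesis
      using that(3) by (auto simp: less_2_cases_iff)
  qed
  have unique: "unique_middles X under_op over_op 2 Q (\<lambda>_. - c)"
    unfolding unique_middles_def
  proof (intro allI impI, elim conjE)
    fix x m m' z :: "nat \<Rightarrow> 'a" and k :: nat
    assume *: "full_rule under_op over_op Q (\<lambda>_. - c) x m z" "full_rule under_op over_op Q (\<lambda>_. - c) x m' z"
      "\<forall>k<2. x k \<in> X \<and> m k \<in> X \<and> m' k \<in> X \<and> z k \<in> X" "k < 2"
    have "pair_cell w s (x 0, m 0) (if \<sigma> = 1 then (x 1, m 1) else (m 1, z 1))"
      "pair_cell w s (x 0, m' 0) (if \<sigma> = 1 then (x 1, m' 1) else (m' 1, z 1))"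
      using * rule[of x m z] rule[of x m' z] by auto
    then have "m 0 = m' 0 \<and> m 1 = m' 1"
      using pair_cell_determined[of w s "x 0" "m 0" "x 1" "m 1" "x 0" "m' 0" "x 1" "m' 1"]
        pair_cell_determined[of w s "x 0" "m 0" "m 1" "z 1" "x 0" "m' 0" "m' 1" "z 1"]
      by (cases "\<sigma> = 1") simp_all
    then show "m k = m' k"
      using *(4) by (auto simp: less_2_cases_iff)
  qed
  have "tangle_replaceable X under_op over_op 2 Q {}"
    by (rule replaceable_empty[OF _ unique]) (rule ends)
  moreover have "tangle_replaceable X under_op over_op 2 {} Q"
  proof (rule empty_replaceable)
    fix x :: "nat \<Rightarrow> 'a" assume x: "\<And>k. k < 2 \<Longrightarrow> x k \<in> X"
    \<comment> \<open>The given labels prescribe one label of each strand at the first crossing.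
      With equal ends the condition at the second crossing is literally the same.\<close>
    obtain m0 m1 where m: "pair_cell w s (x 0, m0) (if \<sigma> = 1 then (x 1, m1) else (m1, x 1))"
      using pair_cell_exists[of "x 0" "x 1" w s False False] pair_cell_exists[of "x 0" "x 1" w s False True] x
      by (cases "\<sigma> = 1") fastforce+
    then have mX: "m0 \<in> X" "m1 \<in> X"
      using pair_cell_in[of w s "x 0" m0 "x 1" m1] pair_cell_in[of w s "x 0" m0 m1 "x 1"]
      by (cases "\<sigma> = 1"; simp)+
    let ?m = "\<lambda>k :: nat. if k = 0 then m0 else m1"
    have "full_rule under_op over_op Q (\<lambda>_. - c) x ?m x"
      by (subst rule) (use x mX m in auto)
    then show "\<exists>m. (\<forall>k<2. m k \<in> X) \<and> full_rule under_op over_op Q (\<lambda>_. - c) x m x"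
      using mX by (intro exI[of _ ?m]) simp
  qed
  ultimately show ?thesis ..
qed

lemma same_colorings_classical_R2:
  assumes D: "link_diagram D" "link_diagram D'" and "classical_R2 D D'"
  shows "same_colorings X under_op over_op D D'"
proof -
  obtain \<sigma> W where \<sigma>: "\<sigma> = 1 \<or> \<sigma> = -1"
    and W: "W = (\<lambda>(k, u) (l, v). k < l) \<or> W = (\<lambda>(k, u) (l, v). l < k)"
    and move: "local_move W (R2_apart \<sigma>) (R2_crossed \<sigma>) D D'"
    using assms(3) unfolding classical_R2_def by blast
  obtain c where c: "0 < c" "c < 1" and half: "\<forall>u\<in>{-1..1}. bump u = 1 / 2 \<longleftrightarrow> u = c \<or> u = - c"
    using finger_double_points by blast
  show ?thesis
  proof (rule same_colorings_local_move_replaceable[OF D move proper_R2_apart[OF \<sigma>] proper_R2_crossed[OF \<sigma>]])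
    fix \<kappa> :: real assume \<kappa>: "\<kappa> = 1 \<or> \<kappa> = -1"
    define Q where "Q = tangle_crossings \<kappa> W (R2_crossed \<sigma>)"
    define s where "s \<longleftrightarrow> \<kappa> * \<sigma> > 0"
    \<comment> \<open>The determinant of the two directions is the slope of the finger times -
      \<sigma>. The slope is \<open>d\<close> at \<open>c\<close> and \<open>- d\<close> at
      \<open>- c\<close>, hence the opposite signs.\<close>
    define d where "d = 4 * c * (1 - c\<^sup>2)"
    have d: "0 < d"
      using c by (simp add: d_def power_less_one_iff)
    have sign: "\<kappa> * det2 (Complex 1 (4 * u * (1 - u\<^sup>2))) (Complex \<sigma> 0) > 0 \<longleftrightarrow> (if u = c then \<not> s else s)"
      "\<kappa> * det2 (Complex \<sigma> 0) (Complex 1 (4 * u * (1 - u\<^sup>2))) > 0 \<longleftrightarrow> (if u = c then s else \<not> s)"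
      if "u = c \<or> u = - c" for u
    proof -
      have e: "4 * u * (1 - u\<^sup>2) = (if u = c then d else - d)"
        using that c by (auto simp: d_def)
      show "\<kappa> * det2 (Complex 1 (4 * u * (1 - u\<^sup>2))) (Complex \<sigma> 0) > 0 \<longleftrightarrow> (if u = c then \<not> s else s)"
        "\<kappa> * det2 (Complex \<sigma> 0) (Complex 1 (4 * u * (1 - u\<^sup>2))) > 0 \<longleftrightarrow> (if u = c then s else \<not> s)"
        unfolding e using d \<sigma> \<kappa> by (auto simp: det2_def s_def)
    qed
    have len: "length (R2_crossed \<sigma>) = 2"
      by (simp add: R2_crossed_def)
    have Q_eq: "Q = (if w then {(0, - c, 1, - \<sigma> * c, s), (0, c, 1, \<sigma> * c, \<not> s)}
        else {(1, - \<sigma> * c, 0, - c, \<not> s), (1, \<sigma> * c, 0, c, s)})"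
      if w: "W = (if w then (\<lambda>(k, u) (l, v). k < l) else (\<lambda>(k, u) (l, v). l < k))" for w
    proof -
      have "(k, u, l, v, p) \<in> Q \<longleftrightarrow> (if w then k = 0 \<and> l = 1 \<and> v = \<sigma> * u \<and> (u = c \<or> u = - c) \<and> p = (if u = c then \<not> s else s)
          else k = 1 \<and> l = 0 \<and> u = \<sigma> * v \<and> (v = c \<or> v = - c) \<and> p = (if v = c then s else \<not> s))" for k u l v p
      proof (cases w)
        case True
        have "(k, u, l, v, p) \<in> Q \<longleftrightarrow> k = 0 \<and> l = 1 \<and> u \<in> {-1..1} \<and> v \<in> {-1..1} \<and> v = \<sigma> * u \<and> bump u = 1 / 2 \<and>
            (p \<longleftrightarrow> \<kappa> * det2 (Complex 1 (4 * u * (1 - u\<^sup>2))) (Complex \<sigma> 0) > 0)"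
          using True by (auto simp: Q_def tangle_crossings_def len w less_2_cases_iff R2_meet[OF \<sigma>, simplified] R2_velocities[simplified])
        also have "\<dots> \<longleftrightarrow> k = 0 \<and> l = 1 \<and> v = \<sigma> * u \<and> (u = c \<or> u = - c) \<and> p = (if u = c then \<not> s else s)"
          using half[rule_format, of u] c \<sigma> sign(1)[of u] by auto
        finally show ?thesis
          using True by simp
      next
        case False
        have "(k, u, l, v, p) \<in> Q \<longleftrightarrow> k = 1 \<and> l = 0 \<and> u \<in> {-1..1} \<and> v \<in> {-1..1} \<and> u = \<sigma> * v \<and> bump v = 1 / 2 \<and>
            (p \<longleftrightarrow> \<kappa> * det2 (Complex \<sigma> 0) (Complex 1 (4 * v * (1 - v\<^sup>2))) > 0)"
          using False R2_meet(1)[OF \<sigma>, of v u, simplified]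
          by (auto simp: Q_def tangle_crossings_def len w less_2_cases_iff R2_velocities[simplified])
        also have "\<dots> \<longleftrightarrow> k = 1 \<and> l = 0 \<and> u = \<sigma> * v \<and> (v = c \<or> v = - c) \<and> p = (if v = c then s else \<not> s)"
          using half[rule_format, of v] c \<sigma> sign(2)[of v] by auto
        finally show ?thesis
          using False by simp
      qed
      then show ?thesis
        using c by (auto simp: set_eq_iff)
    qed
    obtain w where "W = (if w then (\<lambda>(k, u) (l, v). k < l) else (\<lambda>(k, u) (l, v). l < k))"
    proof (cases "W = (\<lambda>(k, u) (l, v). k < l)")
      case True
      then show ?thesis
        by (intro that[of True]) simp
    next
      case False
      then show ?thesis
        using W by (intro that[of False]) simp
    qed
    then have "tangle_replaceable X under_op over_op 2 Q {} \<and> tangle_replaceable X under_op over_op 2 {} Q"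
      by (rule finger_replaceable[OF c \<sigma> Q_eq])
    then show "tangle_replaceable X under_op over_op (length (R2_apart \<sigma>)) (tangle_crossings \<kappa> W (R2_apart \<sigma>)) (tangle_crossings \<kappa> W (R2_crossed \<sigma>)) \<and>
      tangle_replaceable X under_op over_op (length (R2_apart \<sigma>)) (tangle_crossings \<kappa> W (R2_crossed \<sigma>)) (tangle_crossings \<kappa> W (R2_apart \<sigma>))"
      unfolding tangle_crossings_R2_apart[OF \<sigma>] Q_def[symmetric] by (simp add: R2_apart_def numeral_2_eq_2)
  qed
qed

end

section \<open>Third Reidemeister move: crossings of the model and their signs\<close>

lemma bump_linear_root:
  "\<exists>r. 0 < r \<and> r < 1 / 2 \<and> (\<forall>u\<in>{-1..1}. bump u = 4 * u \<longleftrightarrow> u = r)"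
proof -
  \<comment> \<open>Strand 0 at height \<open>bump u / 2\<close> meets the line of slope 2 through
    the origin, on which strand 1 runs, where \<open>bump u = 4 * u\<close>. The bound 1/2 on the
    root keeps the time \<open>2 * r\<close> on the straight strands below 1.\<close>
  define g where "g u = 4 * u - bump u" for u
  have deriv: "(g has_real_derivative 4 + 4 * u * (1 - u\<^sup>2)) (at u)" for u
    using DERIV_diff[OF DERIV_cmult[OF DERIV_ident, of 4 u] bump_deriv[of u]]
    unfolding g_def[abs_def] by simp
  have mono: "g u < g v" if "u < v" "-1 \<le> u" "v \<le> 1" for u v
  proof (rule DERIV_pos_imp_increasing_open[OF that(1)])
    show "\<exists>y. (g has_real_derivative y) (at x) \<and> y > 0" if "u < x" "x < v" for x
    proof (intro exI conjI)
      show "(g has_real_derivative 4 + 4 * x * (1 - x\<^sup>2)) (at x)"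
        by (rule deriv)
      have x: "-1 < x" "x < 1"
        using that \<open>-1 \<le> u\<close> \<open>v \<le> 1\<close> by auto
      then have "0 < 1 - x\<^sup>2" "1 - x\<^sup>2 \<le> 1"
        by (simp_all add: abs_square_less_1)
      then have "- (1 - x\<^sup>2) < x * (1 - x\<^sup>2)"
        using mult_strict_right_mono[of "-1" x "1 - x\<^sup>2"] x by simp
      then have "-1 < x * (1 - x\<^sup>2)"
        using \<open>1 - x\<^sup>2 \<le> 1\<close> by linarith
      moreover have "4 + 4 * x * (1 - x\<^sup>2) = 4 * (1 + x * (1 - x\<^sup>2))"
        by (simp add: algebra_simps)
      ultimately show "4 + 4 * x * (1 - x\<^sup>2) > 0"
        by simp
    qed
    show "continuous_on {u..v} g"
      using deriv DERIV_isCont by (intro continuous_at_imp_continuous_on) blast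
  qed
  have "g 0 < 0" "g (1 / 2) > 0"
    by (simp_all add: g_def bump_def power2_eq_square)
  moreover have "continuous_on {0..1 / 2} g"
    using deriv DERIV_isCont by (intro continuous_at_imp_continuous_on) blast
  ultimately obtain r where r: "0 \<le> r" "r \<le> 1 / 2" "g r = 0"
    using IVT'[of g 0 0 "1 / 2"] by auto
  have "r \<noteq> 0" "r \<noteq> 1 / 2"
    using r(3) \<open>g 0 < 0\<close> \<open>g (1 / 2) > 0\<close> by (metis less_irrefl)+
  moreover have "bump u = 4 * u \<longleftrightarrow> u = r" if u: "u \<in> {-1..1}" for u
  proof -
    have "g u = 0 \<longleftrightarrow> u = r"
      using mono[of u r] mono[of r u] r u by (cases u r rule: linorder_cases) auto
    then show ?thesis
      by (auto simp: g_def)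
  qed
  ultimately show ?thesis
    using r by (intro exI[of _ r]) auto
qed

lemma R3_nth:
  "(R3_tangle \<epsilon> \<sigma> \<tau> ! 0) u = Complex u (\<epsilon> * bump u / 2)"
  "(R3_tangle \<epsilon> \<sigma> \<tau> ! 1) u = Complex (\<sigma> * u / 2) (\<sigma> * u)"
  "(R3_tangle \<epsilon> \<sigma> \<tau> ! 2) u = Complex (\<tau> * u / 2) (- \<tau> * u)"
  by (simp_all add: R3_tangle_def)

lemma R3_velocities:
  "vector_derivative (R3_tangle \<epsilon> \<sigma> \<tau> ! 0) (at u) = Complex 1 (- 2 * \<epsilon> * u * (1 - u\<^sup>2))"
  "vector_derivative (R3_tangle \<epsilon> \<sigma> \<tau> ! 1) (at u) = Complex (\<sigma> / 2) \<sigma>"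
  "vector_derivative (R3_tangle \<epsilon> \<sigma> \<tau> ! 2) (at u) = Complex (\<tau> / 2) (- \<tau>)"
proof -
  have lin: "((\<lambda>u. a * u) has_real_derivative a) (at u)" for a :: real
    by (rule DERIV_cmult_Id)
  note lin_div = DERIV_cdivide[OF lin]
  have "((\<lambda>u. \<epsilon> * bump u / 2) has_real_derivative - 2 * \<epsilon> * u * (1 - u\<^sup>2)) (at u)"
    by (rule DERIV_cong[OF DERIV_cdivide[OF DERIV_cmult[OF bump_deriv]]]) simp
  then show "vector_derivative (R3_tangle \<epsilon> \<sigma> \<tau> ! 0) (at u) = Complex 1 (- 2 * \<epsilon> * u * (1 - u\<^sup>2))"
    using vector_derivative_Complex[OF DERIV_ident] by (simp add: R3_tangle_def)
  show "vector_derivative (R3_tangle \<epsilon> \<sigma> \<tau> ! 1) (at u) = Complex (\<sigma> / 2) \<sigma>"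
    by (simp add: R3_tangle_def vector_derivative_Complex[OF lin_div lin])
  show "vector_derivative (R3_tangle \<epsilon> \<sigma> \<tau> ! 2) (at u) = Complex (\<tau> / 2) (- \<tau>)"
    by (simp add: R3_tangle_def vector_derivative_Complex[OF lin_div lin[of "- \<tau>", simplified]])
qed

lemma length_R3: "length (R3_tangle \<epsilon> \<sigma> \<tau>) = 3"
  by (simp add: R3_tangle_def)

text \<open>A crossing lists its upper strand first, and exchanging the strands reverses the sign of
  the determinant. The flag \<open>w\<close> says that strand \<open>k\<close> is the upper
  one.\<close>

definition flip_crossing :: "bool \<Rightarrow> crossing \<Rightarrow> crossing" where
  "flip_crossing w = (\<lambda>(k, u, l, v, p). if w then (k, u, l, v, p) else (l, v, k, u, \<not> p))"

lemma R3_meet: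
  assumes r: "\<forall>u\<in>{-1..1}. bump u = 4 * u \<longleftrightarrow> u = r"
    and signs: "\<epsilon> = 1 \<or> \<epsilon> = -1" "\<sigma> = 1 \<or> \<sigma> = -1" "\<tau> = 1 \<or> \<tau> = -1"
  shows "u \<in> {-1..1} \<Longrightarrow> (R3_tangle \<epsilon> \<sigma> \<tau> ! 0) u = (R3_tangle \<epsilon> \<sigma> \<tau> ! 1) v \<longleftrightarrow> u = \<epsilon> * r \<and> v = 2 * \<sigma> * \<epsilon> * r"
    "u \<in> {-1..1} \<Longrightarrow> (R3_tangle \<epsilon> \<sigma> \<tau> ! 0) u = (R3_tangle \<epsilon> \<sigma> \<tau> ! 2) v \<longleftrightarrow> u = - \<epsilon> * r \<and> v = - 2 * \<tau> * \<epsilon> * r"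
    "(R3_tangle \<epsilon> \<sigma> \<tau> ! 1) u = (R3_tangle \<epsilon> \<sigma> \<tau> ! 2) v \<longleftrightarrow> u = 0 \<and> v = 0"
    "(R3_tangle \<epsilon> \<sigma> \<tau> ! 0) u = (R3_tangle \<epsilon> \<sigma> \<tau> ! 0) v \<longleftrightarrow> u = v"
    "(R3_tangle \<epsilon> \<sigma> \<tau> ! 1) u = (R3_tangle \<epsilon> \<sigma> \<tau> ! 1) v \<longleftrightarrow> u = v"
    "(R3_tangle \<epsilon> \<sigma> \<tau> ! 2) u = (R3_tangle \<epsilon> \<sigma> \<tau> ! 2) v \<longleftrightarrow> u = v"
proof -
  \<comment> \<open>The case \<open>\<delta> = -1\<close> is obtained by reflection, since
    \<open>bump\<close> is even.\<close>
  have root: "bump u = 4 * (\<delta> * u) \<longleftrightarrow> u = \<delta> * r" if u: "u \<in> {-1..1}" and \<delta>: "\<delta> = 1 \<or> \<delta> = -1" for u \<delta>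
  proof (cases "\<delta> = 1")
    case True
    then show ?thesis
      using r[rule_format, OF u] by simp
  next
    case False
    then have \<delta>: "\<delta> = -1"
      using \<delta> by simp
    have "- u \<in> {-1..1}"
      using u by auto
    from r[rule_format, OF this] have "bump u = - (4 * u) \<longleftrightarrow> - u = r"
      by simp
    then show ?thesis
      unfolding \<delta> by (smt (verit))
  qed
  have swap: "x = e * y \<longleftrightarrow> y = e * x" if "e = 1 \<or> e = -1" for x y e :: real
    using that by auto
  show "(R3_tangle \<epsilon> \<sigma> \<tau> ! 0) u = (R3_tangle \<epsilon> \<sigma> \<tau> ! 1) v \<longleftrightarrow> u = \<epsilon> * r \<and> v = 2 * \<sigma> * \<epsilon> * r" if u: "u \<in> {-1..1}"
  proof -
    have "(R3_tangle \<epsilon> \<sigma> \<tau> ! 0) u = (R3_tangle \<epsilon> \<sigma> \<tau> ! 1) v \<longleftrightarrow> 2 * u = \<sigma> * v \<and> 4 * u = \<epsilon> * bump u"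
      unfolding R3_nth complex.inject by (safe; linarith)
    also have "\<dots> \<longleftrightarrow> v = \<sigma> * (2 * u) \<and> bump u = \<epsilon> * (4 * u)"
      by (simp only: swap[OF signs(2), of "2 * u"] swap[OF signs(1), of "4 * u"])
    also have "bump u = \<epsilon> * (4 * u) \<longleftrightarrow> u = \<epsilon> * r"
      unfolding root[OF u signs(1), symmetric] by (simp only: mult_ac)
    also have "v = \<sigma> * (2 * u) \<and> u = \<epsilon> * r \<longleftrightarrow> u = \<epsilon> * r \<and> v = 2 * \<sigma> * \<epsilon> * r"
      by auto
    finally show ?thesis .
  qed
  show "(R3_tangle \<epsilon> \<sigma> \<tau> ! 0) u = (R3_tangle \<epsilon> \<sigma> \<tau> ! 2) v \<longleftrightarrow> u = - \<epsilon> * r \<and> v = - 2 * \<tau> * \<epsilon> * r" if u: "u \<in> {-1..1}"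
  proof -
    have \<epsilon>: "- \<epsilon> = 1 \<or> - \<epsilon> = -1"
      using signs(1) by linarith
    have "(R3_tangle \<epsilon> \<sigma> \<tau> ! 0) u = (R3_tangle \<epsilon> \<sigma> \<tau> ! 2) v \<longleftrightarrow> 2 * u = \<tau> * v \<and> 4 * u = - \<epsilon> * bump u"
      unfolding R3_nth complex.inject by (safe; linarith)
    also have "\<dots> \<longleftrightarrow> v = \<tau> * (2 * u) \<and> bump u = - \<epsilon> * (4 * u)"
      by (simp only: swap[OF signs(3), of "2 * u"] swap[OF \<epsilon>, of "4 * u"])
    also have "bump u = - \<epsilon> * (4 * u) \<longleftrightarrow> u = - \<epsilon> * r"
      unfolding root[OF u \<epsilon>, symmetric] by (simp only: mult_ac)
    also have "v = \<tau> * (2 * u) \<and> u = - \<epsilon> * r \<longleftrightarrow> u = - \<epsilon> * r \<and> v = - 2 * \<tau> * \<epsilon> * r"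
      by auto
    finally show ?thesis .
  qed
  show "(R3_tangle \<epsilon> \<sigma> \<tau> ! 1) u = (R3_tangle \<epsilon> \<sigma> \<tau> ! 2) v \<longleftrightarrow> u = 0 \<and> v = 0"
  proof -
    have "(R3_tangle \<epsilon> \<sigma> \<tau> ! 1) u = (R3_tangle \<epsilon> \<sigma> \<tau> ! 2) v \<longleftrightarrow> \<sigma> * u = 0 \<and> \<tau> * v = 0"
      unfolding R3_nth complex.inject by (safe; linarith)
    then show ?thesis
      using signs by auto
  qed
  show "(R3_tangle \<epsilon> \<sigma> \<tau> ! 0) u = (R3_tangle \<epsilon> \<sigma> \<tau> ! 0) v \<longleftrightarrow> u = v"
    by (auto simp: R3_nth)
  show "(R3_tangle \<epsilon> \<sigma> \<tau> ! 1) u = (R3_tangle \<epsilon> \<sigma> \<tau> ! 1) v \<longleftrightarrow> u = v" "(R3_tangle \<epsilon> \<sigma> \<tau> ! 2) u = (R3_tangle \<epsilon> \<sigma> \<tau> ! 2) v \<longleftrightarrow> u = v"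
    unfolding R3_nth complex.inject using signs by auto
qed

lemma R3_crossings:
  assumes r: "0 < r" "r < 1 / 2" "\<forall>u\<in>{-1..1}. bump u = 4 * u \<longleftrightarrow> u = r"
    and signs: "\<epsilon> = 1 \<or> \<epsilon> = -1" "\<sigma> = 1 \<or> \<sigma> = -1" "\<tau> = 1 \<or> \<tau> = -1" "\<kappa> = 1 \<or> \<kappa> = -1"
    and h: "inj (h :: nat \<Rightarrow> nat)"
  shows "tangle_crossings \<kappa> (\<lambda>(k, u) (l, v). h l < h k) (R3_tangle \<epsilon> \<sigma> \<tau>) =
    {flip_crossing (h 1 < h 0) (0, \<epsilon> * r, 1, 2 * \<sigma> * \<epsilon> * r, \<kappa> * \<sigma> > 0),
     flip_crossing (h 2 < h 0) (0, - \<epsilon> * r, 2, - 2 * \<tau> * \<epsilon> * r, \<kappa> * \<tau> < 0),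
     flip_crossing (h 2 < h 1) (1, 0, 2, 0, \<kappa> * \<sigma> * \<tau> < 0)}" (is "?Q = ?R")
proof -
  note meet = R3_meet[OF r(3) signs(1-3)]
  let ?T = "R3_tangle \<epsilon> \<sigma> \<tau>"
  let ?d = "\<lambda>k l u v. \<kappa> * det2 (vector_derivative (?T ! k) (at u)) (vector_derivative (?T ! l) (at v))"
  have rr: "0 < r * (1 - r\<^sup>2)"
    using r by (simp add: power_less_one_iff)
  have d01: "?d 0 1 (\<epsilon> * r) v = \<kappa> * \<sigma> * (1 + r * (1 - r\<^sup>2))" for v
    unfolding R3_velocities using signs(1) by (auto simp: det2_def algebra_simps)
  have d02: "?d 0 2 (- \<epsilon> * r) v = - (\<kappa> * \<tau> * (1 + r * (1 - r\<^sup>2)))" for v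
    unfolding R3_velocities using signs(1) by (auto simp: det2_def algebra_simps)
  have d12: "?d 1 2 u v = - (\<kappa> * \<sigma> * \<tau>)" for u v
    unfolding R3_velocities by (simp add: det2_def algebra_simps)
  have d10: "?d 1 0 v (\<epsilon> * r) = - (\<kappa> * \<sigma> * (1 + r * (1 - r\<^sup>2)))" for v
    unfolding R3_velocities using signs(1) by (auto simp: det2_def algebra_simps)
  have d20: "?d 2 0 v (- \<epsilon> * r) = - (- (\<kappa> * \<tau> * (1 + r * (1 - r\<^sup>2))))" for v
    unfolding R3_velocities using signs(1) by (auto simp: det2_def algebra_simps)
  have d21: "?d 2 1 v u = \<kappa> * \<sigma> * \<tau>" for u v
    unfolding R3_velocities by (simp add: det2_def algebra_simps)
  \<comment> \<open>A positive factor common to the determinants involving strand 0. Their signs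
    thus depend on \<kappa>, \<sigma>, \<tau> but not on \<epsilon>, so the move preserves
    them.\<close>
  define q where "q = 1 + r * (1 - r\<^sup>2)"
  have "q > 0"
    using rr by (simp add: q_def)
  then have q: "x * q > 0 \<longleftrightarrow> x > 0" "- (x * q) > 0 \<longleftrightarrow> x < 0" "- (- (x * q)) > 0 \<longleftrightarrow> x > 0" for x
    by (simp_all add: zero_less_mult_iff mult_less_0_iff)
  have sg: "\<kappa> * \<sigma> < 0 \<longleftrightarrow> \<not> \<kappa> * \<sigma> > 0" "\<kappa> * \<tau> > 0 \<longleftrightarrow> \<not> \<kappa> * \<tau> < 0" "\<kappa> * \<sigma> * \<tau> > 0 \<longleftrightarrow> \<not> \<kappa> * \<sigma> * \<tau> < 0"
    using signs(2-4) by auto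
  have s01: "?d 0 1 (\<epsilon> * r) v > 0 \<longleftrightarrow> \<kappa> * \<sigma> > 0" "?d 1 0 v (\<epsilon> * r) > 0 \<longleftrightarrow> \<not> \<kappa> * \<sigma> > 0" for v
    unfolding d01 d10 q_def[symmetric] q using sg by simp_all
  have s02: "?d 0 2 (- \<epsilon> * r) v > 0 \<longleftrightarrow> \<kappa> * \<tau> < 0" "?d 2 0 v (- \<epsilon> * r) > 0 \<longleftrightarrow> \<not> \<kappa> * \<tau> < 0" for v
    unfolding d02 d20 q_def[symmetric] q using sg by simp_all
  have s12: "?d 1 2 u v > 0 \<longleftrightarrow> \<kappa> * \<sigma> * \<tau> < 0" "?d 2 1 v u > 0 \<longleftrightarrow> \<not> \<kappa> * \<sigma> * \<tau> < 0" for u v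
    unfolding d12 d21 using sg by simp_all
  have "h 0 \<noteq> h 1" "h 0 \<noteq> h 2" "h 1 \<noteq> h 2"
    using injD[OF h, of 0 1] injD[OF h, of 0 2] injD[OF h, of 1 2] by auto
  then have hne: "h 0 < h 1 \<longleftrightarrow> \<not> h 1 < h 0" "h 0 < h 2 \<longleftrightarrow> \<not> h 2 < h 0" "h 1 < h 2 \<longleftrightarrow> \<not> h 2 < h 1"
    by linarith+
  have bd: "\<epsilon> * r \<in> {-1..1}" "- \<epsilon> * r \<in> {-1..1}" "2 * \<sigma> * \<epsilon> * r \<in> {-1..1}" "- 2 * \<tau> * \<epsilon> * r \<in> {-1..1}" "(0 :: real) \<in> {-1..1}"
    using r(1,2) signs(1-3) by (elim disjE; simp)+
  have mem: "(k, u, l, v, p) \<in> ?Q \<longleftrightarrow> k < 3 \<and> l < 3 \<and> u \<in> {-1..1} \<and> v \<in> {-1..1} \<and> (k, u) \<noteq> (l, v) \<and>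
      (?T ! k) u = (?T ! l) v \<and> h l < h k \<and> (p \<longleftrightarrow> ?d k l u v > 0)" for k u l v p
    unfolding tangle_crossings_def length_R3 by simp
  have cross: "(k, u, l, v, p) \<in> ?Q \<longleftrightarrow> h l < h k \<and> u = u0 \<and> v = v0 \<and> (p \<longleftrightarrow> b)"
    if "k < 3" "l < 3" "k \<noteq> l" "\<And>u v. u \<in> {-1..1} \<Longrightarrow> v \<in> {-1..1} \<Longrightarrow> (?T ! k) u = (?T ! l) v \<longleftrightarrow> u = u0 \<and> v = v0"
      "u0 \<in> {-1..1}" "v0 \<in> {-1..1}" "?d k l u0 v0 > 0 \<longleftrightarrow> b" for k l u0 v0 b u v p
    unfolding mem using that by blast
  have k3: "k = 0 \<or> k = 1 \<or> k = 2" if "k < 3" for k :: nat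
    using that by auto
  show ?thesis
  proof (rule Set.set_eqI)
    fix c :: crossing
    obtain k u l v p where c: "c = (k, u, l, v, p)"
      by (cases c)
    consider "\<not> (k < 3 \<and> l < 3) \<or> k = l" | "k = 0" "l = 1" | "k = 1" "l = 0" | "k = 0" "l = 2" | "k = 2" "l = 0" | "k = 1" "l = 2" | "k = 2" "l = 1"
      using k3[of k] k3[of l] by blast
    then show "c \<in> ?Q \<longleftrightarrow> c \<in> ?R"
    proof cases
      case 1
      then have "c \<notin> ?Q"
        using less_irrefl[of "h l"] unfolding c mem by blast
      moreover have "c \<notin> ?R"
        using 1 unfolding c flip_crossing_def by (auto split: if_splits)
      ultimately show ?thesis
        by simp
    next
      case 2
      have "c \<in> ?Q \<longleftrightarrow> h 1 < h 0 \<and> u = \<epsilon> * r \<and> v = 2 * \<sigma> * \<epsilon> * r \<and> (p \<longleftrightarrow> \<kappa> * \<sigma> > 0)"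
        unfolding c 2 by (rule cross[OF _ _ _ meet(1) bd(1) bd(3) s01(1)]) simp_all
      then show ?thesis
        unfolding c 2 by (simp add: flip_crossing_def)
    next
      case 3
      have "c \<in> ?Q \<longleftrightarrow> h 0 < h 1 \<and> u = 2 * \<sigma> * \<epsilon> * r \<and> v = \<epsilon> * r \<and> (p \<longleftrightarrow> \<not> \<kappa> * \<sigma> > 0)"
        unfolding c 3
      proof (rule cross[OF _ _ _ _ bd(3) bd(1) s01(2)])
        show "(?T ! 1) u = (?T ! 0) v \<longleftrightarrow> u = 2 * \<sigma> * \<epsilon> * r \<and> v = \<epsilon> * r" if "u \<in> {-1..1}" "v \<in> {-1..1}" for u v
          using meet(1)[OF that(2), of u] by metis
      qed simp_all
      then show ?thesis
        unfolding c 3 hne by (simp add: flip_crossing_def)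
    next
      case 4
      have "c \<in> ?Q \<longleftrightarrow> h 2 < h 0 \<and> u = - \<epsilon> * r \<and> v = - 2 * \<tau> * \<epsilon> * r \<and> (p \<longleftrightarrow> \<kappa> * \<tau> < 0)"
        unfolding c 4 by (rule cross[OF _ _ _ meet(2) bd(2) bd(4) s02(1)]) simp_all
      then show ?thesis
        unfolding c 4 by (simp add: flip_crossing_def)
    next
      case 5
      have "c \<in> ?Q \<longleftrightarrow> h 0 < h 2 \<and> u = - 2 * \<tau> * \<epsilon> * r \<and> v = - \<epsilon> * r \<and> (p \<longleftrightarrow> \<not> \<kappa> * \<tau> < 0)"
        unfolding c 5
      proof (rule cross[OF _ _ _ _ bd(4) bd(2) s02(2)])
        show "(?T ! 2) u = (?T ! 0) v \<longleftrightarrow> u = - 2 * \<tau> * \<epsilon> * r \<and> v = - \<epsilon> * r" if "u \<in> {-1..1}" "v \<in> {-1..1}" for u v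
          using meet(2)[OF that(2), of u] by metis
      qed simp_all
      then show ?thesis
        unfolding c 5 hne by (simp add: flip_crossing_def)
    next
      case 6
      have "c \<in> ?Q \<longleftrightarrow> h 2 < h 1 \<and> u = 0 \<and> v = 0 \<and> (p \<longleftrightarrow> \<kappa> * \<sigma> * \<tau> < 0)"
        unfolding c 6 by (rule cross[OF _ _ _ meet(3) bd(5) bd(5) s12(1)]) simp_all
      then show ?thesis
        unfolding c 6 by (simp add: flip_crossing_def)
    next
      case 7
      have "c \<in> ?Q \<longleftrightarrow> h 1 < h 2 \<and> u = 0 \<and> v = 0 \<and> (p \<longleftrightarrow> \<not> \<kappa> * \<sigma> * \<tau> < 0)"
        unfolding c 7
      proof (rule cross[OF _ _ _ _ bd(5) bd(5) s12(2)])
        show "(?T ! 2) u = (?T ! 1) v \<longleftrightarrow> u = 0 \<and> v = 0" if "u \<in> {-1..1}" "v \<in> {-1..1}" for u v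
          using meet(3)[of v u] by metis
      qed simp_all
      then show ?thesis
        unfolding c 7 hne by (simp add: flip_crossing_def)
    qed
  qed
qed

lemma passes_insert_flip:
  "passes (insert (flip_crossing w (k, u, l, v, p)) Q) i s \<longleftrightarrow> i = k \<and> s = u \<or> i = l \<and> s = v \<or> passes Q i s"
  by (cases w) (auto simp: flip_crossing_def passes_insert)

text \<open>Strand 0 has its crossings at - r and r, a straight strand at 0 and at one of - 2 r and
  2 r; which of these occurs depends on its direction and on the side where strand 0 passes.\<close>

definition R3_start :: "real \<Rightarrow> real \<Rightarrow> real \<Rightarrow> real \<Rightarrow> nat \<Rightarrow> real" where
  "R3_start r \<epsilon> \<sigma> \<tau> k =
     (if k = 0 then - r else if k = 1 then (if \<sigma> = \<epsilon> then 0 else - (2 * r)) else if \<tau> = \<epsilon> then - (2 * r) else 0)"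

definition R3_stop :: "real \<Rightarrow> real \<Rightarrow> real \<Rightarrow> real \<Rightarrow> nat \<Rightarrow> real" where
  "R3_stop r \<epsilon> \<sigma> \<tau> k =
     (if k = 0 then r else if k = 1 then (if \<sigma> = \<epsilon> then 2 * r else 0) else if \<tau> = \<epsilon> then 0 else 2 * r)"

lemma R3_full_tangle:
  assumes r: "0 < r" "r < 1 / 2"
    and signs: "\<epsilon> = 1 \<or> \<epsilon> = -1" "\<sigma> = 1 \<or> \<sigma> = -1" "\<tau> = 1 \<or> \<tau> = -1"
  shows "full_tangle 3 {flip_crossing w01 (0, \<epsilon> * r, 1, 2 * \<sigma> * \<epsilon> * r, p01),
     flip_crossing w02 (0, - \<epsilon> * r, 2, - 2 * \<tau> * \<epsilon> * r, p02), flip_crossing w12 (1, 0, 2, 0, p12)}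
     (R3_start r \<epsilon> \<sigma> \<tau>) (R3_stop r \<epsilon> \<sigma> \<tau>)"
proof
  have k3: "k = 0 \<or> k = 1 \<or> k = 2" if "k < 3" for k :: nat
    using that by auto
  show "-1 < R3_start r \<epsilon> \<sigma> \<tau> k \<and> R3_start r \<epsilon> \<sigma> \<tau> k < R3_stop r \<epsilon> \<sigma> \<tau> k \<and> R3_stop r \<epsilon> \<sigma> \<tau> k < 1" if "k < 3" for k
    using r by (auto simp: R3_start_def R3_stop_def)
  show "passes {flip_crossing w01 (0, \<epsilon> * r, 1, 2 * \<sigma> * \<epsilon> * r, p01),
     flip_crossing w02 (0, - \<epsilon> * r, 2, - 2 * \<tau> * \<epsilon> * r, p02), flip_crossing w12 (1, 0, 2, 0, p12)} k u \<longleftrightarrow>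
      u = R3_start r \<epsilon> \<sigma> \<tau> k \<or> u = R3_stop r \<epsilon> \<sigma> \<tau> k" if "k < 3" for k u
    unfolding passes_insert_flip using k3[OF that] signs
    by (elim disjE; simp add: passes_empty R3_start_def R3_stop_def; blast?)
qed (auto simp: flip_crossing_def split: if_splits)

context finite_biquandle
begin

lemma full_rule_insert_flip:
  assumes "x k \<in> X" "m k \<in> X" "z k \<in> X" "x l \<in> X" "m l \<in> X" "z l \<in> X"
  shows "full_rule under_op over_op (insert (flip_crossing w (k, u, l, v, p)) Q) a x m z \<longleftrightarrow>
     pair_cell w p (if u = a k then (x k, m k) else (m k, z k)) (if v = a l then (x l, m l) else (m l, z l)) \<and>
     full_rule under_op over_op Q a x m z"
  using assms
  by (cases "u = a k"; cases "v = a l"; cases w) (simp_all add: flip_crossing_def full_rule_insert pair_cell_rule)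

text \<open>For the order of the crossings along the strands and for their signs it matters only
  which of \<epsilon>, \<sigma>, \<tau>, \<kappa> equal 1, so real times disappear in favour of the
  Booleans of \<open>triangle\<close>.\<close>

lemma R3_full_rule:
  assumes r: "0 < r"
    and signs: "\<epsilon> = 1 \<or> \<epsilon> = -1" "\<sigma> = 1 \<or> \<sigma> = -1" "\<tau> = 1 \<or> \<tau> = -1" "\<kappa> = 1 \<or> \<kappa> = (-1 :: real)"
    and X: "\<And>k. k < 3 \<Longrightarrow> x k \<in> X \<and> m k \<in> X \<and> z k \<in> X"
  shows "full_rule under_op over_op
     {flip_crossing w01 (0, \<epsilon> * r, 1, 2 * \<sigma> * \<epsilon> * r, \<kappa> * \<sigma> > 0),
      flip_crossing w02 (0, - \<epsilon> * r, 2, - 2 * \<tau> * \<epsilon> * r, \<kappa> * \<tau> < 0), flip_crossing w12 (1, 0, 2, 0, \<kappa> * \<sigma> * \<tau> < 0)}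
     (R3_start r \<epsilon> \<sigma> \<tau>) x m z \<longleftrightarrow>
     triangle (\<epsilon> = 1) (\<sigma> = 1) (\<tau> = 1) (\<kappa> = 1) w01 w02 w12 (x 0) (x 1) (x 2) (m 0) (m 1) (m 2) (z 0) (z 1) (z 2)"
proof -
  have X: "x 0 \<in> X" "m 0 \<in> X" "z 0 \<in> X" "x 1 \<in> X" "m 1 \<in> X" "z 1 \<in> X" "x 2 \<in> X" "m 2 \<in> X" "z 2 \<in> X"
    using X by simp_all
  have sgn: "\<kappa> * \<sigma> > 0 \<longleftrightarrow> (\<kappa> = 1) = (\<sigma> = 1)" "\<kappa> * \<tau> < 0 \<longleftrightarrow> (\<kappa> = 1) \<noteq> (\<tau> = 1)"
    "\<kappa> * \<sigma> * \<tau> < 0 \<longleftrightarrow> (\<kappa> = 1) \<noteq> ((\<sigma> = 1) = (\<tau> = 1))"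
    using signs(2-4) by auto
  have hit: "\<epsilon> * r = R3_start r \<epsilon> \<sigma> \<tau> 0 \<longleftrightarrow> \<not> \<epsilon> = 1" "- \<epsilon> * r = R3_start r \<epsilon> \<sigma> \<tau> 0 \<longleftrightarrow> \<epsilon> = 1"
    "2 * \<sigma> * \<epsilon> * r = R3_start r \<epsilon> \<sigma> \<tau> 1 \<longleftrightarrow> \<not> (\<sigma> = 1) = (\<epsilon> = 1)" "0 = R3_start r \<epsilon> \<sigma> \<tau> 1 \<longleftrightarrow> (\<sigma> = 1) = (\<epsilon> = 1)"
    "- 2 * \<tau> * \<epsilon> * r = R3_start r \<epsilon> \<sigma> \<tau> 2 \<longleftrightarrow> (\<tau> = 1) = (\<epsilon> = 1)" "0 = R3_start r \<epsilon> \<sigma> \<tau> 2 \<longleftrightarrow> \<not> (\<tau> = 1) = (\<epsilon> = 1)"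
    using r signs(1-3) by (elim disjE; simp add: R3_start_def)+
  show ?thesis
    unfolding full_rule_insert_flip[OF X(1-3) X(4-6)] full_rule_insert_flip[OF X(1-3) X(7-9)]
      full_rule_insert_flip[OF X(4-6) X(7-9)] sgn hit triangle_def
    by (simp add: full_rule_empty)
qed

text \<open>Moving strand 0 to the other side replaces \<epsilon> by - \<epsilon> and keeps heights,
  signs and ends, which is the situation of \<open>triangle_move\<close>; uniqueness is
  \<open>triangle_unique\<close>.\<close>

lemma R3_replaceable:
  assumes r: "0 < r" "r < 1 / 2"
    and signs: "\<epsilon> = 1 \<or> \<epsilon> = -1" "\<sigma> = 1 \<or> \<sigma> = -1" "\<tau> = 1 \<or> \<tau> = -1" "\<kappa> = 1 \<or> \<kappa> = (-1 :: real)"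
    and order: "w01 \<and> w12 \<longrightarrow> w02" "\<not> w01 \<and> \<not> w12 \<longrightarrow> \<not> w02"
  defines "Q \<equiv> \<lambda>\<epsilon>. {flip_crossing w01 (0, \<epsilon> * r, 1, 2 * \<sigma> * \<epsilon> * r, \<kappa> * \<sigma> > 0),
      flip_crossing w02 (0, - \<epsilon> * r, 2, - 2 * \<tau> * \<epsilon> * r, \<kappa> * \<tau> < 0), flip_crossing w12 (1, 0, 2, 0, \<kappa> * \<sigma> * \<tau> < 0)}"
  shows "tangle_replaceable X under_op over_op 3 (Q \<epsilon>) (Q (- \<epsilon>))"
proof (rule full_replaceable)
  have \<epsilon>: "- \<epsilon> = 1 \<or> - \<epsilon> = -1" "(- \<epsilon> = 1) = (\<not> \<epsilon> = 1)"
    using signs(1) by linarith+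
  interpret Q: full_tangle 3 "Q \<epsilon>" "R3_start r \<epsilon> \<sigma> \<tau>" "R3_stop r \<epsilon> \<sigma> \<tau>"
    unfolding Q_def by (rule R3_full_tangle[OF r signs(1-3)])
  show "full_tangle 3 (Q \<epsilon>) (R3_start r \<epsilon> \<sigma> \<tau>) (R3_stop r \<epsilon> \<sigma> \<tau>)"
    by (rule Q.full_tangle_axioms)
  show "full_tangle 3 (Q (- \<epsilon>)) (R3_start r (- \<epsilon>) \<sigma> \<tau>) (R3_stop r (- \<epsilon>) \<sigma> \<tau>)"
    unfolding Q_def by (rule R3_full_tangle[OF r \<epsilon>(1) signs(2,3)])
  have rule: "full_rule under_op over_op (Q e) (R3_start r e \<sigma> \<tau>) x m z \<longleftrightarrow>
     triangle (e = 1) (\<sigma> = 1) (\<tau> = 1) (\<kappa> = 1) w01 w02 w12 (x 0) (x 1) (x 2) (m 0) (m 1) (m 2) (z 0) (z 1) (z 2)"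
    if "e = 1 \<or> e = -1" "\<And>k. k < 3 \<Longrightarrow> x k \<in> X \<and> m k \<in> X \<and> z k \<in> X" for e x m z
    unfolding Q_def by (rule R3_full_rule[OF r(1) that(1) signs(2-4) that(2)])
  show "\<exists>m'. (\<forall>k<3. m' k \<in> X) \<and> full_rule under_op over_op (Q (- \<epsilon>)) (R3_start r (- \<epsilon>) \<sigma> \<tau>) x m' z"
    if full: "full_rule under_op over_op (Q \<epsilon>) (R3_start r \<epsilon> \<sigma> \<tau>) x m z"
      and X: "\<And>k. k < 3 \<Longrightarrow> x k \<in> X \<and> m k \<in> X \<and> z k \<in> X" for x m z
  proof -
    obtain m0 m1 m2 where tri: "triangle (\<not> \<epsilon> = 1) (\<sigma> = 1) (\<tau> = 1) (\<kappa> = 1) w01 w02 w12 (x 0) (x 1) (x 2) m0 m1 m2 (z 0) (z 1) (z 2)"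
      using triangle_move[OF iffD1[OF rule[OF signs(1) X] full] order] by blast
    then have m: "m0 \<in> X" "m1 \<in> X" "m2 \<in> X"
      unfolding triangle_def by (auto dest!: pair_cell_in split: if_splits)
    define m' where "m' = (\<lambda>k :: nat. if k = 0 then m0 else if k = 1 then m1 else m2)"
    have m': "m' 0 = m0" "m' 1 = m1" "m' 2 = m2" "\<forall>k<3. m' k \<in> X"
      using m by (simp_all add: m'_def)
    have "x k \<in> X \<and> m' k \<in> X \<and> z k \<in> X" if "k < 3" for k
      using X[OF that] m'(4) that by blast
    then have "full_rule under_op over_op (Q (- \<epsilon>)) (R3_start r (- \<epsilon>) \<sigma> \<tau>) x m' z"
      by (intro iffD2[OF rule[OF \<epsilon>(1)]]) (simp_all only: m'(1-3) \<epsilon>(2) tri)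
    then show ?thesis
      using m'(4) by blast
  qed
  show "unique_middles X under_op over_op 3 (Q \<epsilon>) (R3_start r \<epsilon> \<sigma> \<tau>)"
    unfolding unique_middles_def
  proof (intro allI impI, elim conjE)
    fix x m m' z and k :: nat
    assume full: "full_rule under_op over_op (Q \<epsilon>) (R3_start r \<epsilon> \<sigma> \<tau>) x m z"
      "full_rule under_op over_op (Q \<epsilon>) (R3_start r \<epsilon> \<sigma> \<tau>) x m' z"
      and X: "\<forall>k<3. x k \<in> X \<and> m k \<in> X \<and> m' k \<in> X \<and> z k \<in> X" and "k < 3"
    have tri: "triangle (\<epsilon> = 1) (\<sigma> = 1) (\<tau> = 1) (\<kappa> = 1) w01 w02 w12 (x 0) (x 1) (x 2) (m 0) (m 1) (m 2) (z 0) (z 1) (z 2)"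
      "triangle (\<epsilon> = 1) (\<sigma> = 1) (\<tau> = 1) (\<kappa> = 1) w01 w02 w12 (x 0) (x 1) (x 2) (m' 0) (m' 1) (m' 2) (z 0) (z 1) (z 2)"
      using rule[OF signs(1), of x m z] rule[OF signs(1), of x m' z] X full by blast+
    have "k = 0 \<or> k = 1 \<or> k = 2"
      using \<open>k < 3\<close> by auto
    then show "m k = m' k"
      using triangle_unique[OF tri] by blast
  qed
qed

lemma same_colorings_classical_R3:
  assumes D: "link_diagram D" "link_diagram D'" and "classical_R3 D D'"
  shows "same_colorings X under_op over_op D D'"
proof -
  obtain \<sigma> \<tau> h where signs: "\<sigma> = 1 \<or> \<sigma> = -1" "\<tau> = 1 \<or> \<tau> = -1" and h: "inj (h :: nat \<Rightarrow> nat)"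
    and move: "local_move (\<lambda>(k, u) (l, v). h l < h k) (R3_tangle 1 \<sigma> \<tau>) (R3_tangle (-1) \<sigma> \<tau>) D D'"
    using assms(3) unfolding classical_R3_def by blast
  have one: "(1 :: real) = 1 \<or> (1 :: real) = -1" "(-1 :: real) = 1 \<or> (-1 :: real) = -1"
    by simp_all
  obtain r where r: "0 < r" "r < 1 / 2" "\<forall>u\<in>{-1..1}. bump u = 4 * u \<longleftrightarrow> u = r"
    using bump_linear_root by blast
  show ?thesis
  proof (rule same_colorings_local_move_replaceable[OF D move proper_R3[OF one(1) signs] proper_R3[OF one(2) signs]])
    fix \<kappa> :: real assume \<kappa>: "\<kappa> = 1 \<or> \<kappa> = -1"
    \<comment> \<open>Heights are natural numbers, whose linear order rules out the cyclic
      arrangements.\<close>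
    have order: "h 1 < h 0 \<and> h 2 < h 1 \<longrightarrow> h 2 < h 0" "\<not> h 1 < h 0 \<and> \<not> h 2 < h 1 \<longrightarrow> \<not> h 2 < h 0"
      by linarith+
    note repl = R3_replaceable[OF r(1,2) _ signs \<kappa> order]
    show "tangle_replaceable X under_op over_op (length (R3_tangle 1 \<sigma> \<tau>))
        (tangle_crossings \<kappa> (\<lambda>(k, u) (l, v). h l < h k) (R3_tangle 1 \<sigma> \<tau>))
        (tangle_crossings \<kappa> (\<lambda>(k, u) (l, v). h l < h k) (R3_tangle (-1) \<sigma> \<tau>)) \<and>
      tangle_replaceable X under_op over_op (length (R3_tangle 1 \<sigma> \<tau>))
        (tangle_crossings \<kappa> (\<lambda>(k, u) (l, v). h l < h k) (R3_tangle (-1) \<sigma> \<tau>))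
        (tangle_crossings \<kappa> (\<lambda>(k, u) (l, v). h l < h k) (R3_tangle 1 \<sigma> \<tau>))"
      unfolding R3_crossings[OF r one(1) signs \<kappa> h] R3_crossings[OF r one(2) signs \<kappa> h] length_R3
      using repl[OF one(1)] repl[OF one(2)] unfolding minus_minus by (rule conjI)
  qed
qed

end

text \<open>Under \<open>virtual_rule\<close> both tangles contribute the empty crossing
  set.\<close>

lemma same_colorings_virtual_move:
  assumes D: "link_diagram D" "link_diagram D'" and "virtual_R1 D D' \<or> virtual_R2 D D' \<or> virtual_R3 D D'"
  shows "same_colorings X ut ot D D'"
proof -
  have one: "(1 :: real) = 1 \<or> (1 :: real) = -1" "(-1 :: real) = 1 \<or> (-1 :: real) = -1"
    by simp_all
  obtain T T' where "local_move virtual_rule T T' D D'" "proper_tangle T" "proper_tangle T'"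
    using assms(3)
  proof (elim disjE)
    assume "virtual_R1 D D'"
    then show ?thesis
      unfolding virtual_R1_def by (rule that[OF _ proper_R1_flat proper_R1_kink])
  next
    assume "virtual_R2 D D'"
    then obtain \<sigma> where "\<sigma> = 1 \<or> \<sigma> = -1" "local_move virtual_rule (R2_apart \<sigma>) (R2_crossed \<sigma>) D D'"
      unfolding virtual_R2_def by blast
    then show ?thesis
      using that proper_R2_apart proper_R2_crossed by blast
  next
    assume "virtual_R3 D D'"
    then obtain \<sigma> \<tau> where "\<sigma> = 1 \<or> \<sigma> = -1" "\<tau> = 1 \<or> \<tau> = -1"
      "local_move virtual_rule (R3_tangle 1 \<sigma> \<tau>) (R3_tangle (-1) \<sigma> \<tau>) D D'"
      unfolding virtual_R3_def by blast
    then show ?thesis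
      using that proper_R3[OF one(1)] proper_R3[OF one(2)] by blast
  qed
  then show ?thesis
    using same_colorings_local_move_same_crossings[OF D] tangle_crossings_virtual by metis
qed

text \<open>The only classical crossing is the one of strands 1 and 2, which do not move.\<close>

lemma same_colorings_mixed_move:
  assumes D: "link_diagram D" "link_diagram D'" and "mixed_move D D'"
  shows "same_colorings X ut ot D D'"
proof -
  have one: "(1 :: real) = 1 \<or> (1 :: real) = -1" "(-1 :: real) = 1 \<or> (-1 :: real) = -1"
    by simp_all
  obtain \<sigma> \<tau> W where signs: "\<sigma> = 1 \<or> \<sigma> = -1" "\<tau> = 1 \<or> \<tau> = -1"
    and W: "W = (\<lambda>(k, u) (l, v). k = 1 \<and> l = 2) \<or> W = (\<lambda>(k, u) (l, v). k = 2 \<and> l = 1)"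
    and move: "local_move W (R3_tangle 1 \<sigma> \<tau>) (R3_tangle (-1) \<sigma> \<tau>) D D'"
    using assms(3) unfolding mixed_move_def by blast
  have fixed: "R3_tangle 1 \<sigma> \<tau> ! k = R3_tangle (-1) \<sigma> \<tau> ! k" if "k = 1 \<or> k = 2" for k
    using that by (auto simp: R3_tangle_def)
  have W12: "(k = 1 \<or> k = 2) \<and> (l = 1 \<or> l = 2)" if "W (k, u) (l, v)" for k u l v
    using W that by auto
  show ?thesis
  proof (rule same_colorings_local_move_same_crossings[OF D move proper_R3[OF one(1) signs] proper_R3[OF one(2) signs]])
    fix \<kappa> :: real
    have "c \<in> tangle_crossings \<kappa> W (R3_tangle 1 \<sigma> \<tau>) \<longleftrightarrow> c \<in> tangle_crossings \<kappa> W (R3_tangle (-1) \<sigma> \<tau>)" for c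
    proof -
      obtain k u l v p where c: "c = (k, u, l, v, p)"
        by (cases c)
      show ?thesis
      proof (cases "W (k, u) (l, v)")
        case True
        then show ?thesis
          unfolding c tangle_crossings_def using fixed W12[OF True] by (simp add: length_R3)
      qed (simp add: c tangle_crossings_def)
    qed
    then show "tangle_crossings \<kappa> W (R3_tangle 1 \<sigma> \<tau>) = tangle_crossings \<kappa> W (R3_tangle (-1) \<sigma> \<tau>)"
      by blast
  qed
qed

lemma (in finite_biquandle) same_colorings_virtual_step:
  assumes "virtual_step D D'"
  shows "same_colorings X under_op over_op D D'"
  using assms same_colorings_reparametrized same_colorings_planar_isotopic same_colorings_classical_R1
    same_colorings_classical_R2 same_colorings_classical_R3 same_colorings_virtual_move same_colorings_mixed_move
  unfolding virtual_step_def by metis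

theorem corollary3p3p2:
  fixes X :: "'a set"
    and ut ot :: "'a \<Rightarrow> 'a \<Rightarrow> 'a"
    and S :: "nat \<Rightarrow> ('a \<Rightarrow> 'a) set"
    and m N :: nat
    and L1 L2 :: vdiagram
  assumes "biquandle X ut ot"
    and "finite X"
    and "End_filtration X ut ot m S"
    and "S 0 = {}"
    and "N \<ge> 1"
    and "link_diagram L1"
    and "link_diagram L2"
    and "virtually_equivalent L1 L2"
  shows "persistence_pair N X ut ot m S L1 = persistence_pair N X ut ot m S L2"
proof -
  interpret finite_biquandle X ut ot
    by (intro finite_biquandle.intro finite_biquandle_axioms.intro assms)
  have step: "persistence_pair N X ut ot m S D = persistence_pair N X ut ot m S D'" if "virtual_step D D'" for D D'
    by (rule persistence_pair_eq[OF assms(2,3) same_colorings_virtual_step[OF that]])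
  \<comment> \<open>Steps may be followed in either direction, which equality of the pairs permits;
    each step carries the conditions that both of its sides are link diagrams.\<close>
  have "equivclp virtual_step L1 L2"
    using assms(8) unfolding virtually_equivalent_def .
  then show ?thesis
    by (induction rule: equivclp_induct) (use step in auto)
qed

end
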